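(* Let $\lambda,\mu,k,r,m,n$ be positive integers with $\mu>\lambda$, $m\ge 2n-1$ and $r\ge 2$, and put $p=r(2n-m)/2$. Let $\mathcal{G}$ be a decomposition of $\lambda K_n$ into $k$ colors. Then $\mathcal{G}$ can be enclosed in some $2$-edge-connected $r$-factorization of $\mu K_m$ (into $k$ colors) if and only if all of the following hold: (B1) $rk=\mu(m-1)$ and $rm$ is even; (B2) $\mathcal{G}$ is $r$-admissible; (B3) $\displaystyle\sum_{i=0}^{p}(p-i)\,|\mathcal{S}_i(\mathcal{G})|\le(\mu-\lambda)\frac{n(n-1)}{2}$.
   Context: Graphs are finite and undirected and may have multiple edges but no loops. $\lambda K_n$ is the complete graph on $n$ vertices in which every pair of distinct vertices is joined by exactly $\lambda$ parallel edges; for $\lambda\le\mu$ and $n\le m$, $\lambda K_n$ is regarded as a subgraph of $\mu K_m$. A decomposition of a graph $G$ into $k$ colors is a collection $\mathcal{G}=\{\mathcal{G}(1),\dots,\mathcal{G}(k)\}$ of spanning subgraphs of $G$ (color classes), indexed by $1,\dots,k$, whose edge sets partition $E(G)$; color classes may have isolated vertices and may have no edges. A decomposition $\mathcal{G}$ of $\lambda K_n$ into $k$ colors is enclosed in a decomposition $\mathcal{H}$ of $\mu K_m$ into $k$ colors if $\mathcal{G}(i)$ is a subgraph of $\mathcal{H}(i)$ for every $1\le i\le k$. A $2$-edge-connected $r$-factorization of a graph is a decomposition of it in which every color class is an $r$-regular, $2$-edge-connected spanning subgraph. A decomposition $\mathcal{G}$ into $k$ colors (with vertex set $V(K_n)$)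 is $r$-admissible if: (1) $d_{\mathcal{G}(i)}(v)\le r$ for every vertex $v$ and every $1\le i\le k$, where $d_{\mathcal{G}(i)}(v)$ is the degree of $v$ in $\mathcal{G}(i)$; (2) every connected component of every $\mathcal{G}(i)$ (including single isolated vertices) contains a vertex of degree at most $r-2$ in $\mathcal{G}(i)$ or at least two vertices of degree at most $r-1$ in $\mathcal{G}(i)$; (3) if $C$ is a connected component of some $\mathcal{G}(i)$ and $e$ is a cutedge of $C$, then each of the two components of $C-e$ contains a vertex of degree at most $r-1$ in $\mathcal{G}(i)$. $\mathcal{S}_i(\mathcal{G})$ denotes the set of color classes of $\mathcal{G}$ that contain exactly $i$ edges. The sum in (B3) is over the integers $i$ with $0\le i\le p$, and is empty (equal to $0$) if $p<0$. *)

theory Defs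
  imports Complex_Main
begin

text \<open>
  An edge is a pair of its set of end vertices and a label; the labels tell parallel edges
  apart. Since an edge determines its ends, subgraphs are given by inclusion of vertex and
  edge sets.
\<close>

type_synonym 'v edge = "'v set \<times> nat"

record 'v mgraph =
  verts :: "'v set"
  edges :: "'v edge set"

definition multigraph :: "'v mgraph \<Rightarrow> bool" where
  "multigraph G \<longleftrightarrow> finite (verts G) \<and> finite (edges G) \<and>
     (\<forall>e\<in>edges G. fst e \<subseteq> verts G \<and> card (fst e) = 2)"

definition subgraph :: "'v mgraph \<Rightarrow> 'v mgraph \<Rightarrow> bool" where
  "subgraph H G \<longleftrightarrow> multigraph H \<and> multigraph G \<and>
     verts H \<subseteq> verts G \<and> edges H \<subseteq> edges G"

definition spanning_subgraph :: "'v mgraph \<Rightarrow> 'v mgraph \<Rightarrow> bool" where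
  "spanning_subgraph H G \<longleftrightarrow> subgraph H G \<and> verts H = verts G"

text \<open>
  \<open>complete_mgraph l n\<close> is the graph $\lambda K_n$ for \<open>l\<close> $= \lambda$. The labels are
  \<open>0, \<dots>, l - 1\<close>, which makes $\lambda K_n$ literally a subgraph of $\mu K_m$ when
  $\lambda \le \mu$ and $n \le m$.
\<close>

definition complete_mgraph :: "nat \<Rightarrow> nat \<Rightarrow> nat mgraph" where
  "complete_mgraph l n =
     \<lparr>verts = {..<n}, edges = {e. fst e \<subseteq> {..<n} \<and> card (fst e) = 2 \<and> snd e < l}\<rparr>"

lemma multigraph_complete_mgraph: "multigraph (complete_mgraph l n)"
proof -
  have "{e. fst e \<subseteq> {..<n} \<and> card (fst e) = 2 \<and> snd e < l} \<subseteq> Pow {..<n} \<times> {..<l}"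
    by auto
  then have "finite {e. fst e \<subseteq> {..<n} \<and> card (fst e) = 2 \<and> snd e < l}"
    by (rule finite_subset) simp
  then show ?thesis
    by (auto simp: multigraph_def complete_mgraph_def)
qed

lemma subgraph_complete_mgraph:
  assumes "l \<le> l'" "n \<le> n'"
  shows "subgraph (complete_mgraph l n) (complete_mgraph l' n')"
  using assms multigraph_complete_mgraph[of l n] multigraph_complete_mgraph[of l' n']
  by (fastforce simp: subgraph_def complete_mgraph_def)

text \<open>Counting incident edges is correct because there are no loops.\<close>

definition degree :: "'v mgraph \<Rightarrow> 'v \<Rightarrow> nat" where
  "degree G v = card {e \<in> edges G. v \<in> fst e}"

definition regular_mgraph :: "nat \<Rightarrow> 'v mgraph \<Rightarrow> bool" where
  "regular_mgraph r G \<longleftrightarrow> (\<forall>v\<in>verts G. degree G v = r)"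

definition adjacency :: "'v mgraph \<Rightarrow> ('v \<times> 'v) set" where
  "adjacency G = {(u, v). \<exists>e\<in>edges G. fst e = {u, v}}"

definition connected_mgraph :: "'v mgraph \<Rightarrow> bool" where
  "connected_mgraph G \<longleftrightarrow> verts G \<noteq> {} \<and>
     (\<forall>u\<in>verts G. \<forall>v\<in>verts G. (u, v) \<in> (adjacency G)\<^sup>*)"

definition conn_components :: "'v mgraph \<Rightarrow> 'v mgraph set" where
  "conn_components G = {C. subgraph C G \<and> connected_mgraph C \<and>
     (\<forall>D. subgraph D G \<and> connected_mgraph D \<and> subgraph C D \<longrightarrow> D = C)}"

definition delete_edge :: "'v mgraph \<Rightarrow> 'v edge \<Rightarrow> 'v mgraph" where
  "delete_edge G e = \<lparr>verts = verts G, edges = edges G - {e}\<rparr>"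

definition cutedge :: "'v mgraph \<Rightarrow> 'v edge \<Rightarrow> bool" where
  "cutedge G e \<longleftrightarrow> e \<in> edges G \<and>
     card (conn_components G) < card (conn_components (delete_edge G e))"

definition two_edge_connected :: "'v mgraph \<Rightarrow> bool" where
  "two_edge_connected G \<longleftrightarrow> connected_mgraph G \<and>
     (\<forall>e\<in>edges G. connected_mgraph (delete_edge G e))"

text \<open>
  A family of color classes is a function on \<open>nat\<close> of which only the values at
  \<open>1, \<dots>, k\<close> matter.
\<close>

definition decomposition :: "'v mgraph \<Rightarrow> nat \<Rightarrow> (nat \<Rightarrow> 'v mgraph) \<Rightarrow> bool" where
  "decomposition G k \<G> \<longleftrightarrow>
     (\<forall>i\<in>{1..k}. spanning_subgraph (\<G> i) G) \<and>
     (\<forall>i\<in>{1..k}. \<forall>j\<in>{1..k}. i \<noteq> j \<longrightarrow> edges (\<G> i) \<inter> edges (\<G> j) = {}) \<and>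
     (\<Union>i\<in>{1..k}. edges (\<G> i)) = edges G"

definition enclosed_in ::
  "nat \<Rightarrow> (nat \<Rightarrow> 'v mgraph) \<Rightarrow> (nat \<Rightarrow> 'v mgraph) \<Rightarrow> bool" where
  "enclosed_in k \<G> \<H> \<longleftrightarrow> (\<forall>i\<in>{1..k}. subgraph (\<G> i) (\<H> i))"

definition two_edge_connected_factorization ::
  "'v mgraph \<Rightarrow> nat \<Rightarrow> nat \<Rightarrow> (nat \<Rightarrow> 'v mgraph) \<Rightarrow> bool" where
  "two_edge_connected_factorization G r k \<H> \<longleftrightarrow> decomposition G k \<H> \<and>
     (\<forall>i\<in>{1..k}. regular_mgraph r (\<H> i) \<and> two_edge_connected (\<H> i))"

text \<open>
  The conditions $d \le r - 2$ and $d \le r - 1$ are written as \<open>d + 2 \<le> r\<close> and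
  \<open>d + 1 \<le> r\<close> to avoid truncated subtraction. All degrees are taken in the color class
  \<open>\<G> i\<close>, also in the third condition, and not in the component \<open>C\<close> with \<open>e\<close> deleted.
\<close>

definition admissible :: "nat \<Rightarrow> nat \<Rightarrow> (nat \<Rightarrow> 'v mgraph) \<Rightarrow> bool" where
  "admissible r k \<G> \<longleftrightarrow>
     (\<forall>i\<in>{1..k}. \<forall>v\<in>verts (\<G> i). degree (\<G> i) v \<le> r) \<and>
     (\<forall>i\<in>{1..k}. \<forall>C\<in>conn_components (\<G> i).
        (\<exists>v\<in>verts C. degree (\<G> i) v + 2 \<le> r) \<or>
        card {v \<in> verts C. degree (\<G> i) v + 1 \<le> r} \<ge> 2) \<and>
     (\<forall>i\<in>{1..k}. \<forall>C\<in>conn_components (\<G> i). \<forall>e. cutedge C e \<longrightarrow>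
        (\<forall>D\<in>conn_components (delete_edge C e). \<exists>v\<in>verts D. degree (\<G> i) v + 1 \<le> r))"

text \<open>
  Color classes are counted by their index, so that several color classes without edges
  (which are equal as graphs) are counted separately.
\<close>

definition classes_of_size :: "nat \<Rightarrow> (nat \<Rightarrow> 'v mgraph) \<Rightarrow> nat \<Rightarrow> nat set" where
  "classes_of_size k \<G> s = {i \<in> {1..k}. card (edges (\<G> i)) = s}"

end

theory Submission
  imports Defs
begin

text \<open>
  Forget the edges and keep, for each color, only the multiplicities \<open>a u v\<close>. If no degree exceeds
  \<open>r\<close>, admissibility says that every nonempty vertex set \<open>S\<close> is left by at least 2 edges when each
  missing degree is counted as one more edge leaving \<open>S\<close>; equivalently, \<open>S\<close> spans at most
  \<open>(r |S| - 2) / 2\<close> edges. This is necessary because the color classes of the factorization have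
  all cuts of size at least 2, and it is the only property to be maintained.

  First the pairs of old vertices are filled up to multiplicity \<open>\<mu>\<close>. A color with fewer than \<open>p\<close>
  edges is so sparse, since \<open>p \<le> r / 2\<close>, that it takes any missing edge, and the sum condition says
  that there are enough of them. A further missing edge \<open>u v\<close> fits into some color, for otherwise the
  degrees of \<open>u\<close> and \<open>v\<close> add up to at least \<open>r\<close> in every color, exceeding what \<open>m \<ge> 2 n - 1\<close> allows.

  Then the new vertices are added one at a time. When \<open>w\<close> vertices are missing, the next one has to
  receive a \<open>w\<close>-th part of the missing degree, fairly divided over the colors, over the vertices and,
  within each color, over its components and the sides of its bridges. Two laminar families of sets
  can always be divided fairly at the same time, and a fair division creates no violation.
\<close>

section \<open>Equitable division with respect to two laminar families\<close>

text \<open>The condition on \<open>S\<close> is a forecast: each unit of missing degree in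
  \<open>S\<close> becomes at most one edge leaving \<open>S\<close>, so edges leaving plus deficits
  bound the final cut of \<open>S\<close> from above. The number p is forced. In one color at most
  r(m - n) edges join old to new vertices, so at least rn - r(m - n) = 2p of the rn edge ends at old
  vertices belong to edges inside the old graph. The assumption m >= 2n - 1 says precisely that p <=
  r/2. The obstacle is that a new vertex must be served fairly in two directions of the grid colors
  x vertices: every vertex needs exactly \<mu> edges to it over all colors, and in every color no
  cut may become too small. The columns are disjoint and the rows carry nested sets, so each
  direction is one laminar family. A laminar family can be respected by pairing elements inside its
  members, and the union of two pairings has only even cycles; this is why two families can be
  served together. The price is that only one side of each bridge is divided fairly. The other side
  is controlled by comparing it with the whole component.\<close>

definition laminar :: "'a set set \<Rightarrow> bool" where
  "laminar F \<longleftrightarrow> (\<forall>A\<in>F. \<forall>B\<in>F. A \<inter> B = {} \<or> A \<subseteq> B \<or> B \<subseteq> A)"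

text \<open>Pair two elements \<open>x\<close>, \<open>y\<close> of a member \<open>P\<close> whose
  trace on \<open>X\<close> is smallest among those with at least 2 elements. Any other member with
  such a trace contains both or neither: a member inside \<open>P\<close> has the same trace by
  minimality. So a pairing of the remaining elements extends. The fixed points of \<sigma> are the
  unpaired elements.\<close>

lemma laminar_pairing:
  fixes X :: "'a set"
  assumes "finite X" "laminar F"
  shows "\<exists>\<sigma>. (\<forall>x. \<sigma> (\<sigma> x) = x) \<and> (\<forall>x. x \<notin> X \<longrightarrow> \<sigma> x = x) \<and>
    (\<forall>P\<in>F. card {x \<in> P \<inter> X. \<sigma> x \<notin> P \<or> \<sigma> x = x} \<le> 1)"
  using assms(1)
proof (induction "card X" arbitrary: X rule: less_induct)
  case less
  show ?case
  proof (cases "\<exists>P\<in>F. 2 \<le> card (P \<inter> X)")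
    case False
    have "card {x \<in> P \<inter> X. id x \<notin> P \<or> id x = x} \<le> 1" if "P \<in> F" for P
    proof -
      have "{x \<in> P \<inter> X. id x \<notin> P \<or> id x = x} = P \<inter> X" by auto
      then show ?thesis using False that by fastforce
    qed
    then show ?thesis by (intro exI[of _ id]) auto
  next
    case True
    then obtain P where P: "P \<in> F" "2 \<le> card (P \<inter> X)"
      and Pmin: "\<And>Q. Q \<in> F \<Longrightarrow> 2 \<le> card (Q \<inter> X) \<Longrightarrow> card (P \<inter> X) \<le> card (Q \<inter> X)"
      using ex_has_least_nat[of "\<lambda>P. P \<in> F \<and> 2 \<le> card (P \<inter> X)" _ "\<lambda>P. card (P \<inter> X)"]
      by blast
    obtain x y where xy: "x \<in> P \<inter> X" "y \<in> P \<inter> X" "x \<noteq> y"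
      using P(2) card_le_Suc0_iff_eq[of "P \<inter> X"] \<open>finite X\<close>
      by (metis (no_types, lifting) finite_Int not_less_eq_eq numeral_2_eq_2)
    let ?Y = "X - {x, y}"
    have "card ?Y < card X"
      using xy less.prems by (intro psubset_card_mono) auto
    then obtain \<sigma> where \<sigma>: "\<And>z. \<sigma> (\<sigma> z) = z" "\<And>z. z \<notin> ?Y \<Longrightarrow> \<sigma> z = z"
      "\<And>Q. Q \<in> F \<Longrightarrow> card {z \<in> Q \<inter> ?Y. \<sigma> z \<notin> Q \<or> \<sigma> z = z} \<le> 1"
      using less.hyps[of ?Y] less.prems by auto
    define \<rho> where "\<rho> z = (if z = x then y else if z = y then x else \<sigma> z)" for z
    have sx: "\<sigma> z = x \<longleftrightarrow> z = x" "\<sigma> z = y \<longleftrightarrow> z = y" for z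
      using \<sigma>(1)[of z] \<sigma>(2)[of x] \<sigma>(2)[of y] by auto
    have r1: "\<rho> (\<rho> z) = z" for z
      using \<sigma>(1) sx xy(3) by (auto simp: \<rho>_def)
    have r2: "\<rho> z = z" if "z \<notin> X" for z
      using that xy \<sigma>(2) by (auto simp: \<rho>_def)
    have r3: "card {z \<in> Q \<inter> X. \<rho> z \<notin> Q \<or> \<rho> z = z} \<le> 1" if Q: "Q \<in> F" for Q
    proof (cases "2 \<le> card (Q \<inter> X)")
      case False
      have "card {z \<in> Q \<inter> X. \<rho> z \<notin> Q \<or> \<rho> z = z} \<le> card (Q \<inter> X)"
        using less.prems by (intro card_mono) auto
      then show ?thesis using False by simp
    next
      case True
      have both: "x \<in> Q \<longleftrightarrow> y \<in> Q"
      proof -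
        consider "P \<inter> Q = {}" | "P \<subseteq> Q" | "Q \<subseteq> P"
          using assms(2) P(1) Q unfolding laminar_def by blast
        then show ?thesis
        proof cases
          case 3
          then have "Q \<inter> X = P \<inter> X"
            using Pmin[OF Q True] less.prems by (intro card_seteq) auto
          then show ?thesis using xy by blast
        qed (use xy in auto)
      qed
      have "{z \<in> Q \<inter> X. \<rho> z \<notin> Q \<or> \<rho> z = z} \<subseteq> {z \<in> Q \<inter> ?Y. \<sigma> z \<notin> Q \<or> \<sigma> z = z}"
        using both xy by (auto simp: \<rho>_def split: if_splits)
      then have "card {z \<in> Q \<inter> X. \<rho> z \<notin> Q \<or> \<rho> z = z} \<le> card {z \<in> Q \<inter> ?Y. \<sigma> z \<notin> Q \<or> \<sigma> z = z}"
        using less.prems by (intro card_mono) auto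
      then show ?thesis using \<sigma>(3)[OF Q] by linarith
    qed
    show ?thesis using r1 r2 r3 by blast
  qed
qed

lemma involution_coloring:
  fixes \<tau> :: "'a \<Rightarrow> 'a"
  assumes "\<And>x. \<tau> (\<tau> x) = x"
  shows "\<exists>f :: 'a \<Rightarrow> bool. \<forall>x. \<tau> x \<noteq> x \<longrightarrow> f (\<tau> x) \<noteq> f x"
proof -
  \<comment> \<open>The choice depends on the set alone, so both partners select the same
    representative.\<close>
  define rep where "rep x = (SOME y. y \<in> {x, \<tau> x})" for x
  have "rep x \<in> {x, \<tau> x}" for x
    unfolding rep_def by (rule someI[of _ x]) simp
  moreover have "rep (\<tau> x) = rep x" for x
    unfolding rep_def using assms by (simp add: insert_commute)
  ultimately have "\<forall>x. \<tau> x \<noteq> x \<longrightarrow> (rep (\<tau> x) = \<tau> x) \<noteq> (rep x = x)"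
    by (metis insertE singletonD)
  then show ?thesis by (intro exI[of _ "\<lambda>x. rep x = x"])
qed

text \<open>The edges of the union of the two pairings alternate, so its finite cycles are even.
  Instead of following paths and cycles, the induction removes one \<sigma>-pair and joins the
  \<tau>-partners of its two ends, which preserves the alternation.\<close>

lemma two_involutions_coloring:
  fixes \<sigma> \<tau> :: "'a \<Rightarrow> 'a"
  assumes "finite {x. \<sigma> x \<noteq> x}" "\<And>x. \<sigma> (\<sigma> x) = x" "\<And>x. \<tau> (\<tau> x) = x"
  shows "\<exists>f :: 'a \<Rightarrow> bool. \<forall>x. (\<sigma> x \<noteq> x \<longrightarrow> f (\<sigma> x) \<noteq> f x) \<and> (\<tau> x \<noteq> x \<longrightarrow> f (\<tau> x) \<noteq> f x)"
  using assms
proof (induction "card {x. \<sigma> x \<noteq> x}" arbitrary: \<sigma> \<tau> rule: less_induct)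
  case less
  show ?case
  proof (cases "\<exists>a. \<sigma> a \<noteq> a")
    case False
    then show ?thesis using involution_coloring[of \<tau>] less.prems by auto
  next
    case True
    then obtain a where a: "\<sigma> a \<noteq> a" by blast
    define b where "b = \<sigma> a"
    have ab: "b \<noteq> a" "\<sigma> b = a" "\<sigma> a = b" using a less.prems by (auto simp: b_def)
    define \<sigma>' where "\<sigma>' x = (if x \<in> {a, b} then x else \<sigma> x)" for x
    \<comment> \<open>Bypass the pair \<open>{a, b}\<close>: their \<open>\<tau>\<close>-partners are paired with each other.\<close>
    define \<tau>' where "\<tau>' x = (if x \<in> {a, b} then x
      else if \<tau> x = a then (if \<tau> b = b then x else \<tau> b)
      else if \<tau> x = b then (if \<tau> a = a then x else \<tau> a) else \<tau> x)" for x
    have sub: "{x. \<sigma>' x \<noteq> x} \<subset> {x. \<sigma> x \<noteq> x}"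
    proof
      show "{x. \<sigma>' x \<noteq> x} \<subseteq> {x. \<sigma> x \<noteq> x}" unfolding \<sigma>'_def by auto
      have "a \<in> {x. \<sigma> x \<noteq> x}" "a \<notin> {x. \<sigma>' x \<noteq> x}" using a unfolding \<sigma>'_def by auto
      then show "{x. \<sigma>' x \<noteq> x} \<noteq> {x. \<sigma> x \<noteq> x}" by metis
    qed
    have c: "card {x. \<sigma>' x \<noteq> x} < card {x. \<sigma> x \<noteq> x}"
      using less.prems(1) sub by (rule psubset_card_mono)
    have fin: "finite {x. \<sigma>' x \<noteq> x}" using sub less.prems(1) by (meson finite_subset psubset_imp_subset)
    have s: "\<sigma>' (\<sigma>' x) = x" for x
    proof -
      have "\<sigma> x \<notin> {a, b}" if "x \<notin> {a, b}"
        using that ab less.prems(2) by (metis insertE insertI1 insertI2 singletonD)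
      then show ?thesis using less.prems(2) unfolding \<sigma>'_def by presburger
    qed
    have teq: "\<tau> x = y \<longleftrightarrow> x = \<tau> y" for x y using less.prems(3) by metis
    have t: "\<tau>' (\<tau>' x) = x" for x
      using teq ab by (smt (verit) \<tau>'_def insert_iff singletonD)
    have "\<exists>f :: 'a \<Rightarrow> bool. \<forall>x. (\<sigma>' x \<noteq> x \<longrightarrow> f (\<sigma>' x) \<noteq> f x) \<and> (\<tau>' x \<noteq> x \<longrightarrow> f (\<tau>' x) \<noteq> f x)"
      using c fin s t by (rule less.hyps)
    then obtain f :: "'a \<Rightarrow> bool"
      where "\<forall>x. (\<sigma>' x \<noteq> x \<longrightarrow> f (\<sigma>' x) \<noteq> f x) \<and> (\<tau>' x \<noteq> x \<longrightarrow> f (\<tau>' x) \<noteq> f x)"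
      by (rule exE)
    then have f: "\<And>x. \<sigma>' x \<noteq> x \<Longrightarrow> f (\<sigma>' x) \<noteq> f x" "\<And>x. \<tau>' x \<noteq> x \<Longrightarrow> f (\<tau>' x) \<noteq> f x"
      by simp_all
    \<comment> \<open>The color of \<open>a\<close> has to differ from that of its \<tau>-partner.
      If this partner is absent or is \<open>b\<close>, the demand comes from \<open>b\<close>
      instead: \<open>b\<close> gets the opposite color of \<open>a\<close>, so \<open>a\<close>
      must agree with the partner of \<open>b\<close>. When both partners exist outside the pair,
      \<open>fb\<close> makes the two demands agree.\<close>
    define \<alpha> where "\<alpha> = (if \<tau> a \<in> {a, b} then (if \<tau> b \<in> {a, b} then True else f (\<tau> b))
       else \<not> f (\<tau> a))"
    define g where "g x = (if x = a then \<alpha> else if x = b then \<not> \<alpha> else f x)" for x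
    have sg: "\<sigma> x \<noteq> x \<longrightarrow> g (\<sigma> x) \<noteq> g x" for x
    proof (cases "x \<in> {a, b}")
      case True then show ?thesis using ab by (auto simp: g_def)
    next
      case False
      then have "\<sigma> x \<notin> {a, b}" using ab less.prems(2) by (metis insertE insertI1 insertI2 singletonD)
      then show ?thesis using False f(1)[of x] by (auto simp: g_def \<sigma>'_def)
    qed
    have fb: "f (\<tau> a) \<noteq> f (\<tau> b)" if "\<tau> a \<notin> {a, b}" "\<tau> b \<notin> {a, b}"
    proof -
      have "\<tau>' (\<tau> a) = \<tau> b" using that less.prems(3) by (simp add: \<tau>'_def)
      moreover have "\<tau> a \<noteq> \<tau> b" using ab teq by metis
      ultimately show ?thesis using f(2)[of "\<tau> a"] by auto
    qed
    have gt: "g (\<tau> a) \<noteq> g a" if "\<tau> a \<noteq> a"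
      using that ab by (auto simp: g_def \<alpha>_def)
    have gt2: "g (\<tau> b) \<noteq> g b" if "\<tau> b \<noteq> b"
    proof (cases "\<tau> b = a")
      case True then show ?thesis using ab by (auto simp: g_def)
    next
      case False
      then have "\<tau> b \<notin> {a, b}" "\<tau> a \<noteq> b" using that teq by auto
      then show ?thesis using fb ab by (auto simp: g_def \<alpha>_def)
    qed
    have tg: "\<tau> x \<noteq> x \<longrightarrow> g (\<tau> x) \<noteq> g x" for x
    proof (cases "x \<in> {a, b} \<or> \<tau> x \<in> {a, b}")
      case True
      then show ?thesis using gt gt2 teq by (metis insertE singletonD)
    next
      case False
      then have "\<tau>' x = \<tau> x" by (auto simp: \<tau>'_def)
      then show ?thesis using False f(2)[of x] by (auto simp: g_def)
    qed
    show ?thesis using sg tg by blast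
  qed
qed

text \<open>A pair inside a member contributes one element to each half, and at most one element of
  the member has no partner inside it, so the halves differ by at most 1. The coloring splits the
  pairs of both pairings at once.\<close>

lemma laminar_bisection:
  assumes "finite X" "laminar F" "laminar G"
  shows "\<exists>L\<subseteq>X. \<forall>P\<in>F \<union> G. card (P \<inter> L) \<le> card (P \<inter> (X - L)) + 1 \<and>
    card (P \<inter> (X - L)) \<le> card (P \<inter> L) + 1"
proof -
  obtain \<sigma> where s: "\<And>x. \<sigma> (\<sigma> x) = x" "\<And>x. x \<notin> X \<Longrightarrow> \<sigma> x = x"
    "\<And>P. P \<in> F \<Longrightarrow> card {x \<in> P \<inter> X. \<sigma> x \<notin> P \<or> \<sigma> x = x} \<le> 1"
    using laminar_pairing[OF assms(1,2)] by blast
  obtain \<tau> where t: "\<And>x. \<tau> (\<tau> x) = x" "\<And>x. x \<notin> X \<Longrightarrow> \<tau> x = x"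
    "\<And>P. P \<in> G \<Longrightarrow> card {x \<in> P \<inter> X. \<tau> x \<notin> P \<or> \<tau> x = x} \<le> 1"
    using laminar_pairing[OF assms(1,3)] by blast
  have fin: "finite {x. \<sigma> x \<noteq> x}" using s(2) by (intro finite_subset[OF _ assms(1)]) auto
  obtain f :: "'a \<Rightarrow> bool"
    where "\<forall>x. (\<sigma> x \<noteq> x \<longrightarrow> f (\<sigma> x) \<noteq> f x) \<and> (\<tau> x \<noteq> x \<longrightarrow> f (\<tau> x) \<noteq> f x)"
    using two_involutions_coloring[of \<sigma> \<tau>, OF fin s(1) t(1)] by (rule exE)
  then have f: "\<And>x. \<sigma> x \<noteq> x \<Longrightarrow> f (\<sigma> x) \<noteq> f x" "\<And>x. \<tau> x \<noteq> x \<Longrightarrow> f (\<tau> x) \<noteq> f x"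
    by simp_all
  have gen: "card {x \<in> P \<inter> X. g x} \<le> card {x \<in> P \<inter> X. \<not> g x} + 1"
    if r: "\<And>x. \<rho> (\<rho> x) = x" "\<And>x. x \<notin> X \<Longrightarrow> \<rho> x = x" "\<And>x. \<rho> x \<noteq> x \<Longrightarrow> g (\<rho> x) \<noteq> g x"
      and c: "card {x \<in> P \<inter> X. \<rho> x \<notin> P \<or> \<rho> x = x} \<le> 1" for \<rho> P and g :: "'a \<Rightarrow> bool"
  proof -
    let ?U = "{x \<in> P \<inter> X. \<rho> x \<notin> P \<or> \<rho> x = x}"
    have rX: "\<rho> x \<in> X" if "x \<in> X" for x using r that by metis
    have "card {x \<in> P \<inter> X. g x} \<le> card (?U \<union> {x \<in> P \<inter> X - ?U. g x})"
      using assms(1) by (intro card_mono) auto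
    also have "\<dots> \<le> card ?U + card {x \<in> P \<inter> X - ?U. g x}" by (rule card_Un_le)
    also have "card {x \<in> P \<inter> X - ?U. g x} \<le> card {x \<in> P \<inter> X. \<not> g x}"
    proof (rule card_inj_on_le[of \<rho>])
      show "inj_on \<rho> {x \<in> P \<inter> X - ?U. g x}" by (rule inj_on_inverseI[of _ \<rho>]) (rule r(1))
      show "\<rho> ` {x \<in> P \<inter> X - ?U. g x} \<subseteq> {x \<in> P \<inter> X. \<not> g x}" using rX r(3) by auto
    qed (use assms(1) in auto)
    finally show ?thesis using c by linarith
  qed
  have e: "{x \<in> P \<inter> X. f x} = P \<inter> {x \<in> X. f x}" "{x \<in> P \<inter> X. \<not> f x} = P \<inter> (X - {x \<in> X. f x})"
    for P by auto
  have "card (P \<inter> {x \<in> X. f x}) \<le> card (P \<inter> (X - {x \<in> X. f x})) + 1 \<and>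
    card (P \<inter> (X - {x \<in> X. f x})) \<le> card (P \<inter> {x \<in> X. f x}) + 1" if "P \<in> F \<union> G" for P
  proof (cases "P \<in> F")
    case True
    then show ?thesis
      unfolding e[symmetric] using gen[of \<sigma> f P] gen[of \<sigma> "\<lambda>x. \<not> f x" P] s f(1) by simp
  next
    case False
    then have "P \<in> G" using that by blast
    then show ?thesis
      unfolding e[symmetric] using gen[of \<tau> f P] gen[of \<tau> "\<lambda>x. \<not> f x" P] t f(2) by simp
  qed
  then show ?thesis by (intro exI[of _ "{x \<in> X. f x}"] conjI ballI) blast+
qed

section \<open>From halves to \<open>w\<close> equal parts\<close>

lemma sum_squares_balanced:
  fixes x y x' y' :: nat
  assumes "x + y = x' + y'" "x' \<le> y' + 1" "y' \<le> x' + 1"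
  shows "x'\<^sup>2 + y'\<^sup>2 \<le> x\<^sup>2 + y\<^sup>2" "y + 1 < x \<Longrightarrow> x'\<^sup>2 + y'\<^sup>2 < x\<^sup>2 + y\<^sup>2"
proof -
  define D D' where "D = int x - int y" and "D' = int x' - int y'"
  have s: "2 * (int x ^2 + int y ^2) = (int x + int y)^2 + D^2"
     "2 * (int x' ^2 + int y' ^2) = (int x' + int y')^2 + D'^2"
    by (simp_all add: D_def D'_def power2_eq_square algebra_simps)
  have eq: "int x + int y = int x' + int y'" using assms by linarith
  have D': "\<bar>D'\<bar> \<le> 1" using assms by (auto simp: D'_def)
  \<comment> \<open>Both differences have the parity of the common sum, so \<open>D = 0\<close>
    excludes \<open>D'\<close> being 1 or -1.\<close>
  have "\<bar>D'\<bar> \<le> \<bar>D\<bar>"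
  proof (cases "D = 0")
    case True
    then have "int x' + int y' = 2 * int y" using eq by (simp add: D_def)
    then have "D' = 0" using D' unfolding D'_def by presburger
    then show ?thesis by simp
  qed (use D' in linarith)
  then have "D'\<^sup>2 \<le> D\<^sup>2" by (rule abs_le_square_iff[THEN iffD1])
  then have "int x' ^2 + int y' ^2 \<le> int x ^2 + int y ^2" using s eq by simp
  then show "x'\<^sup>2 + y'\<^sup>2 \<le> x\<^sup>2 + y\<^sup>2" by (metis of_nat_add of_nat_le_iff of_nat_power)
  assume "y + 1 < x"
  then have "1 < D" by (auto simp: D_def)
  then have "\<bar>D'\<bar> < \<bar>D\<bar>" using D' by linarith
  then have "D'\<^sup>2 < D\<^sup>2" using abs_le_square_iff[of D D'] by linarith
  then have "int x' ^2 + int y' ^2 < int x ^2 + int y ^2" using s eq by simp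
  then show "x'\<^sup>2 + y'\<^sup>2 < x\<^sup>2 + y\<^sup>2" by (metis of_nat_add of_nat_less_iff of_nat_power)
qed

text \<open>Values within 1 of each other are the average rounded down or up;
  \<open>(x + w - 1) div w\<close> is x/w rounded up.\<close>

lemma equitable_div_bounds:
  fixes g :: "nat \<Rightarrow> nat"
  assumes "0 < w" "\<And>i j. i < w \<Longrightarrow> j < w \<Longrightarrow> g i \<le> g j + 1" "j < w"
  shows "sum g {..<w} div w \<le> g j" "g j \<le> (sum g {..<w} + w - 1) div w"
proof -
  have split: "sum g {..<w} = g j + sum g ({..<w} - {j})"
    using assms by (simp add: sum.remove)
  have card: "card ({..<w} - {j}) = w - 1" using assms by simp
  have "sum g ({..<w} - {j}) \<le> (w - 1) * (g j + 1)"
    using sum_bounded_above[of "{..<w} - {j}" g "g j + 1"] assms card by auto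
  then have "sum g {..<w} < w * (g j + 1)"
    using assms(1) split by (cases w) (auto simp: algebra_simps)
  then have "sum g {..<w} div w < g j + 1"
    using assms(1) by (simp add: less_mult_imp_div_less mult.commute)
  then show "sum g {..<w} div w \<le> g j" by simp
  have "(w - 1) * (g j - 1) \<le> sum g ({..<w} - {j})"
    using sum_bounded_below[of "{..<w} - {j}" "g j - 1" g] assms card by (auto simp: le_diff_conv)
  then have "w * g j \<le> sum g {..<w} + w - 1"
    using assms(1) split by (cases w; cases "g j") (auto simp: algebra_simps)
  then have "w * g j div w \<le> (sum g {..<w} + w - 1) div w" by (rule div_le_mono)
  then show "g j \<le> (sum g {..<w} + w - 1) div w" using assms(1) by simp
qed

text \<open>Repeated halving would give only powers of 2 as the number of parts. Instead, take a
  labelling by 0, ..., w - 1 with the least sum of squared class sizes over all members. If two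
  classes differed by more than 1 on some member, bisecting their union anew would lower the cost
  there and raise it nowhere. Any one class of an optimal labelling then serves as
  \<open>L\<close>.\<close>

lemma laminar_equitable_subset:
  assumes "finite X" "laminar F" "laminar G" "finite F" "finite G" "0 < w"
  shows "\<exists>L\<subseteq>X. \<forall>P\<in>F \<union> G. card (P \<inter> X) div w \<le> card (P \<inter> L) \<and>
    card (P \<inter> L) \<le> (card (P \<inter> X) + w - 1) div w"
proof -
  define cls where "cls h j = {x \<in> X. h x = j}" for h :: "'a \<Rightarrow> nat" and j
  define cost where "cost h = (\<Sum>P\<in>F \<union> G. \<Sum>j<w. (card (P \<inter> cls h j))\<^sup>2)" for h
  have "\<exists>h. (\<forall>x\<in>X. h x < w) \<and> (\<forall>h'. (\<forall>x\<in>X. h' x < w) \<longrightarrow> cost h \<le> cost h')"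
    using ex_has_least_nat[of "\<lambda>h. \<forall>x\<in>X. h x < w" "\<lambda>_. 0" cost] assms(6) by blast
  then obtain h where h: "\<And>x. x \<in> X \<Longrightarrow> h x < w"
    and hmin: "\<And>h'. (\<forall>x\<in>X. h' x < w) \<Longrightarrow> cost h \<le> cost h'" by blast
  have bal: "card (P \<inter> cls h i) \<le> card (P \<inter> cls h j) + 1"
    if P: "P \<in> F \<union> G" and ij: "i < w" "j < w" for P i j
  proof (rule ccontr)
    assume neg: "\<not> ?thesis"
    then have ne: "i \<noteq> j" by auto
    let ?Y = "cls h i \<union> cls h j"
    have finY: "finite ?Y" using assms(1) by (auto simp: cls_def)
    obtain L where L: "L \<subseteq> ?Y" "\<And>Q. Q \<in> F \<union> G \<Longrightarrow> card (Q \<inter> L) \<le> card (Q \<inter> (?Y - L)) + 1 \<and>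
      card (Q \<inter> (?Y - L)) \<le> card (Q \<inter> L) + 1"
      using laminar_bisection[OF finY assms(2,3)] by blast
    define h' where "h' x = (if x \<in> L then i else if x \<in> ?Y then j else h x)" for x
    have "\<forall>x\<in>X. h' x < w" using h ij by (auto simp: h'_def)
    then have le: "cost h \<le> cost h'" by (rule hmin)
    have ci: "cls h' i = L" using L(1) ne by (auto simp: cls_def h'_def)
    have cj: "cls h' j = ?Y - L" using L(1) ne by (auto simp: cls_def h'_def split: if_splits)
    have co: "cls h' l = cls h l" if "l \<noteq> i" "l \<noteq> j" for l
      using L(1) that by (auto simp: cls_def h'_def split: if_splits)
    have split: "(\<Sum>l<w. u l) = u i + u j + (\<Sum>l\<in>{..<w} - {i, j}. u l)" for u :: "nat \<Rightarrow> nat"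
    proof -
      have "{..<w} = insert i (insert j ({..<w} - {i, j}))" using ij by auto
      then show ?thesis using ne
        by (metis (no_types, lifting) Diff_iff Diff_insert_absorb add.assoc finite_Diff finite_insert
            finite_lessThan insertCI insert_iff singletonD sum.insert)
    qed
    have tot: "card (Q \<inter> cls h i) + card (Q \<inter> cls h j) = card (Q \<inter> L) + card (Q \<inter> (?Y - L))" for Q
    proof -
      have "card (Q \<inter> cls h i) + card (Q \<inter> cls h j) = card ((Q \<inter> cls h i) \<union> (Q \<inter> cls h j))"
        using finY ne by (intro card_Un_disjoint[symmetric]) (auto simp: cls_def)
      also have "(Q \<inter> cls h i) \<union> (Q \<inter> cls h j) = (Q \<inter> L) \<union> (Q \<inter> (?Y - L))"
        using L(1) by auto
      also have "card \<dots> = card (Q \<inter> L) + card (Q \<inter> (?Y - L))"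
        using finY L(1) by (intro card_Un_disjoint) (auto intro: finite_subset)
      finally show ?thesis .
    qed
    have "cost h' < cost h"
      unfolding cost_def
    proof (rule sum_strict_mono_ex1)
      show "finite (F \<union> G)" using assms by simp
      show "\<forall>Q\<in>F \<union> G. (\<Sum>l<w. (card (Q \<inter> cls h' l))\<^sup>2) \<le> (\<Sum>l<w. (card (Q \<inter> cls h l))\<^sup>2)"
      proof
        fix Q assume Q: "Q \<in> F \<union> G"
        show "(\<Sum>l<w. (card (Q \<inter> cls h' l))\<^sup>2) \<le> (\<Sum>l<w. (card (Q \<inter> cls h l))\<^sup>2)"
          unfolding split ci cj
          using sum_squares_balanced(1)[OF tot[of Q]] L(2)[OF Q] by (simp add: co)
      qed
      have "(\<Sum>l<w. (card (P \<inter> cls h' l))\<^sup>2) < (\<Sum>l<w. (card (P \<inter> cls h l))\<^sup>2)"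
        unfolding split ci cj
        using sum_squares_balanced(2)[OF tot[of P]] L(2)[OF P] neg by (simp add: co)
      then show "\<exists>Q\<in>F \<union> G. (\<Sum>l<w. (card (Q \<inter> cls h' l))\<^sup>2) < (\<Sum>l<w. (card (Q \<inter> cls h l))\<^sup>2)"
        using P by blast
    qed
    then show False using le by simp
  qed
  have tot: "card (P \<inter> X) = (\<Sum>j<w. card (P \<inter> cls h j))" for P
  proof -
    have "P \<inter> X = (\<Union>j<w. P \<inter> cls h j)" using h by (auto simp: cls_def)
    moreover have "card (\<Union>j<w. P \<inter> cls h j) = (\<Sum>j<w. card (P \<inter> cls h j))"
      using assms(1) by (intro card_UN_disjoint) (auto simp: cls_def)
    ultimately show ?thesis by simp
  qed
  have "card (P \<inter> X) div w \<le> card (P \<inter> cls h 0) \<and>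
    card (P \<inter> cls h 0) \<le> (card (P \<inter> X) + w - 1) div w" if "P \<in> F \<union> G" for P
    unfolding tot using equitable_div_bounds[of w "\<lambda>j. card (P \<inter> cls h j)" 0] bal[OF that] assms(6)
    by simp
  then show ?thesis by (intro exI[of _ "cls h 0"]) (auto simp: cls_def)
qed

text \<open>Each \<open>y\<close> is replaced by \<open>b y\<close> copies, which keeps the families
  laminar; \<open>c y\<close> is the number of selected copies.\<close>

lemma laminar_equitable_weights:
  fixes b :: "'a \<Rightarrow> nat"
  assumes "finite Y" "laminar F" "laminar G" "F \<subseteq> Pow Y" "G \<subseteq> Pow Y" "0 < w"
  shows "\<exists>c. (\<forall>y. c y \<le> b y) \<and> (\<forall>P\<in>F \<union> G. sum b P div w \<le> sum c P \<and>
    sum c P \<le> (sum b P + w - 1) div w)"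
proof -
  define up where "up P = Sigma P (\<lambda>y. {..<b y})" for P
  have lam: "laminar (up ` H)" if "laminar H" for H
    using that unfolding laminar_def up_def by (auto; blast)
  have fin: "finite (up ` H)" if "H \<subseteq> Pow Y" for H
    using that assms(1) by (intro finite_imageI) (auto intro: finite_subset)
  have finX: "finite (up Y)" using assms(1) by (simp add: up_def)
  obtain L where L: "L \<subseteq> up Y" "\<forall>P\<in>up ` F \<union> up ` G.
    card (P \<inter> up Y) div w \<le> card (P \<inter> L) \<and> card (P \<inter> L) \<le> (card (P \<inter> up Y) + w - 1) div w"
    using laminar_equitable_subset[OF finX lam[OF assms(2)] lam[OF assms(3)]
        fin[OF assms(4)] fin[OF assms(5)] assms(6)] by (elim exE conjE)
  define c where "c y = card {j. (y, j) \<in> L}" for y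
  have "{j. (y, j) \<in> L} \<subseteq> {..<b y}" for y using L(1) by (auto simp: up_def)
  then have cb: "c y \<le> b y" for y
    unfolding c_def by (metis card_lessThan card_mono finite_lessThan)
  have cs: "sum c P = card (up P \<inter> L)" if "P \<subseteq> Y" for P
  proof -
    have "up P \<inter> L = Sigma P (\<lambda>y. {j. (y, j) \<in> L})" using L(1) by (auto simp: up_def)
    moreover have "finite P" using that assms(1) by (rule finite_subset)
    moreover have "finite {j. (y, j) \<in> L}" for y
      using \<open>\<And>y. {j. (y, j) \<in> L} \<subseteq> {..<b y}\<close> by (meson finite_lessThan finite_subset)
    ultimately show ?thesis by (simp add: c_def)
  qed
  have bs: "sum b P = card (up P \<inter> up Y)" if "P \<subseteq> Y" for P
  proof -
    have "up P \<inter> up Y = up P" using that by (auto simp: up_def)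
    moreover have "finite P" using that assms(1) by (rule finite_subset)
    ultimately show ?thesis by (simp add: up_def)
  qed
  have "sum b P div w \<le> sum c P \<and> sum c P \<le> (sum b P + w - 1) div w" if "P \<in> F \<union> G" for P
  proof -
    have "P \<subseteq> Y" using that assms by blast
    then show ?thesis using L(2) that by (auto simp: cs bs)
  qed
  then show ?thesis using cb by blast
qed

section \<open>Cuts and deficits of one color\<close>

definition multiplicity :: "('a \<Rightarrow> 'a \<Rightarrow> nat) \<Rightarrow> bool" where
  "multiplicity a \<longleftrightarrow> (\<forall>u v. a u v = a v u) \<and> (\<forall>u. a u u = 0)"

text \<open>The sum runs over ordered pairs: \<open>weight a S S\<close> is twice the number of
  edges inside \<open>S\<close>, while an edge between disjoint sets counts once.\<close>

definition weight :: "('a \<Rightarrow> 'a \<Rightarrow> nat) \<Rightarrow> 'a set \<Rightarrow> 'a set \<Rightarrow> nat" where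
  "weight a A B = (\<Sum>u\<in>A. \<Sum>v\<in>B. a u v)"

lemma weight_empty [simp]: "weight a {} B = 0" "weight a A {} = 0"
  by (simp_all add: weight_def)

lemma weight_commute: "multiplicity a \<Longrightarrow> weight a A B = weight a B A"
  unfolding weight_def multiplicity_def by (subst sum.swap) simp

lemma weight_Un_left:
  "finite A \<Longrightarrow> finite A' \<Longrightarrow> A \<inter> A' = {} \<Longrightarrow> weight a (A \<union> A') B = weight a A B + weight a A' B"
  by (simp add: weight_def sum.union_disjoint)

lemma weight_Un_right:
  "finite B \<Longrightarrow> finite B' \<Longrightarrow> B \<inter> B' = {} \<Longrightarrow> weight a A (B \<union> B') = weight a A B + weight a A B'"
  by (simp add: weight_def sum.union_disjoint sum.distrib)

lemma weight_split_right:
  "finite V \<Longrightarrow> T \<subseteq> V \<Longrightarrow> weight a A V = weight a A T + weight a A (V - T)"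
  by (metis Diff_disjoint Diff_partition finite_Diff finite_subset weight_Un_right)

lemma weight_split_left:
  "finite V \<Longrightarrow> T \<subseteq> V \<Longrightarrow> weight a V A = weight a T A + weight a (V - T) A"
  by (metis Diff_disjoint Diff_partition finite_Diff finite_subset weight_Un_left)

lemma weight_mono:
  "finite A' \<Longrightarrow> finite B' \<Longrightarrow> A \<subseteq> A' \<Longrightarrow> B \<subseteq> B' \<Longrightarrow> weight a A B \<le> weight a A' B'"
  unfolding weight_def
  by (rule order_trans[of _ "\<Sum>u\<in>A. \<Sum>v\<in>B'. a u v"]) (auto intro!: sum_mono sum_mono2)

lemma weight_eq_0_iff:
  "finite A \<Longrightarrow> finite B \<Longrightarrow> weight a A B = 0 \<longleftrightarrow> (\<forall>u\<in>A. \<forall>v\<in>B. a u v = 0)"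
  by (simp add: weight_def)

lemma weight_degrees: "weight a A B = (\<Sum>v\<in>A. weight a {v} B)"
  by (simp add: weight_def)

lemma weight_insert_self:
  assumes "finite S" "x \<notin> S" "multiplicity a"
  shows "weight a (insert x S) (insert x S) = weight a S S + 2 * weight a {x} S"
proof -
  have l: "weight a (insert x S) B = weight a {x} B + weight a S B" for B
    using weight_Un_left[of "{x}" S a B] assms by simp
  have r: "weight a B (insert x S) = weight a B {x} + weight a B S" for B
    using weight_Un_right[of "{x}" S a B] assms by simp
  have "weight a {x} {x} = 0" using assms(3) by (simp add: weight_def multiplicity_def)
  then show ?thesis using weight_commute[OF assms(3), of S "{x}"] by (simp add: l r)
qed

text \<open>A vertex joining \<open>S\<close> contributes its edges to \<open>S\<close> twice. This
  parity settles the tight cases below in which an estimate falls short by one.\<close>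

lemma even_weight_self:
  assumes "multiplicity a"
  shows "even (weight a S S)"
proof (cases "finite S")
  case True
  then show ?thesis
    by (induction S rule: finite_induct) (simp_all add: weight_insert_self assms)
qed (simp add: weight_def)

definition deficit :: "nat \<Rightarrow> 'a set \<Rightarrow> ('a \<Rightarrow> 'a \<Rightarrow> nat) \<Rightarrow> 'a \<Rightarrow> nat" where
  "deficit r V a v = r - weight a {v} V"

text \<open>
  With degrees at most \<open>r\<close>, the inequality for \<open>S\<close> says that the number of edges leaving \<open>S\<close>
  plus the total deficit of \<open>S\<close> is at least 2.
\<close>

definition sparse :: "nat \<Rightarrow> 'a set \<Rightarrow> ('a \<Rightarrow> 'a \<Rightarrow> nat) \<Rightarrow> bool" where
  "sparse r V a \<longleftrightarrow> (\<forall>v\<in>V. weight a {v} V \<le> r) \<and>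
     (\<forall>S\<subseteq>V. S \<noteq> {} \<longrightarrow> weight a S S + 2 \<le> r * card S)"

text \<open>The \<open>r\<close> units of each vertex of \<open>T\<close> are either deficit, ends
  of edges inside \<open>T\<close>, or ends of edges leaving \<open>T\<close>. This identity
  translates between edges spanned and edges leaving.\<close>

lemma sum_deficit:
  assumes "finite V" "T \<subseteq> V" "\<And>v. v \<in> V \<Longrightarrow> weight a {v} V \<le> r"
  shows "sum (deficit r V a) T + weight a T T + weight a T (V - T) = r * card T"
proof -
  have "sum (deficit r V a) T + (\<Sum>v\<in>T. weight a {v} V) = (\<Sum>v\<in>T. r)"
    unfolding sum.distrib[symmetric]
    using assms by (intro sum.cong) (auto simp: deficit_def)
  moreover have "(\<Sum>v\<in>T. weight a {v} V) = weight a T T + weight a T (V - T)"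
    using weight_degrees[of a T V] weight_split_right[OF assms(1,2), of a T] by simp
  ultimately show ?thesis by (simp add: mult.commute)
qed

lemma sparse_iff:
  assumes "finite V" "\<And>v. v \<in> V \<Longrightarrow> weight a {v} V \<le> r"
  shows "sparse r V a \<longleftrightarrow>
    (\<forall>S\<subseteq>V. S \<noteq> {} \<longrightarrow> 2 \<le> weight a S (V - S) + sum (deficit r V a) S)"
proof -
  have "weight a S S + 2 \<le> r * card S \<longleftrightarrow> 2 \<le> weight a S (V - S) + sum (deficit r V a) S"
    if "S \<subseteq> V" for S
    using sum_deficit[where a=a, OF assms(1) that assms(2)] by linarith
  then show ?thesis using assms(2) unfolding sparse_def by blast
qed

section \<open>Components and bridge sides of one color\<close>

definition atom :: "'a set \<Rightarrow> ('a \<Rightarrow> 'a \<Rightarrow> nat) \<Rightarrow> 'a set \<Rightarrow> bool" where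
  "atom V a C \<longleftrightarrow> C \<noteq> {} \<and> C \<subseteq> V \<and> weight a C (V - C) = 0 \<and>
     (\<forall>Z. Z \<subset> C \<longrightarrow> Z \<noteq> {} \<longrightarrow> weight a Z (V - Z) \<noteq> 0)"

text \<open>
  The atoms are the vertex sets of the components. A bridge separates its component \<open>C\<close> into two
  sides; keeping only the side without the root \<open>Min C\<close> makes the family laminar.
\<close>

definition bridge_family :: "nat set \<Rightarrow> (nat \<Rightarrow> nat \<Rightarrow> nat) \<Rightarrow> nat set set" where
  "bridge_family V a = {C. atom V a C} \<union>
     {T. \<exists>C. atom V a C \<and> T \<subset> C \<and> T \<noteq> {} \<and> weight a T (V - T) = 1 \<and> Min C \<notin> T}"

text \<open>Take a smallest set around \<open>v\<close> that no edge leaves. If no edge left some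
  proper nonempty part of it, none would leave the rest either, and one of these two smaller sets
  contains \<open>v\<close>.\<close>

lemma atom_exists:
  assumes "finite V" "multiplicity a" "v \<in> V"
  shows "\<exists>C. atom V a C \<and> v \<in> C"
proof -
  let ?P = "\<lambda>C. v \<in> C \<and> C \<subseteq> V \<and> weight a C (V - C) = 0"
  have "?P V" using assms by simp
  then obtain C where C: "?P C" and min: "\<And>D. ?P D \<Longrightarrow> card C \<le> card D"
    using ex_has_least_nat[of ?P V card] by blast
  have fC: "finite C" using C assms(1) finite_subset by blast
  have "weight a Z (V - Z) \<noteq> 0" if Z: "Z \<subset> C" "Z \<noteq> {}" for Z
  proof
    assume 0: "weight a Z (V - Z) = 0"
    have z: "\<And>x y. x \<in> Z \<Longrightarrow> y \<in> V - Z \<Longrightarrow> a x y = 0"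
      using 0 Z fC assms(1) by (subst (asm) weight_eq_0_iff) (auto intro: finite_subset)
    have c: "\<And>x y. x \<in> C \<Longrightarrow> y \<in> V - C \<Longrightarrow> a x y = 0"
      using C fC assms(1) by (subst (asm) weight_eq_0_iff) (auto intro: finite_subset)
    have d: "weight a (C - Z) (V - (C - Z)) = 0"
    proof (subst weight_eq_0_iff)
      show "\<forall>x\<in>C - Z. \<forall>y\<in>V - (C - Z). a x y = 0"
      proof (intro ballI)
        fix x y assume xy: "x \<in> C - Z" "y \<in> V - (C - Z)"
        show "a x y = 0"
        proof (cases "y \<in> Z")
          case True
          then have "a y x = 0" using z xy C by blast
          then show ?thesis using assms(2) unfolding multiplicity_def by metis
        qed (use xy c in blast)
      qed
    qed (use fC assms(1) in auto)
    show False
    proof (cases "v \<in> Z")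
      case True
      then have "?P Z" using 0 Z C by auto
      then show False using min[of Z] psubset_card_mono[OF fC Z(1)] by simp
    next
      case False
      then have "?P (C - Z)" using d C by auto
      moreover have "card (C - Z) < card C"
        using Z fC by (intro psubset_card_mono) auto
      ultimately show False using min[of "C - Z"] by simp
    qed
  qed
  then show ?thesis using C unfolding atom_def by blast
qed

text \<open>Sets that no edge leaves are closed under intersection, so \<open>C \<inter> T\<close>
  cannot be a proper part of the atom.\<close>

lemma atom_subset:
  assumes "finite V" "atom V a C" "T \<subseteq> V" "weight a T (V - T) = 0" "C \<inter> T \<noteq> {}"
  shows "C \<subseteq> T"
proof -
  have C: "C \<subseteq> V" "weight a C (V - C) = 0" using assms(2) by (auto simp: atom_def)
  have fin: "finite C" "finite T" using C(1) assms(1,3) finite_subset by blast+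
  have "\<And>x y. x \<in> C \<Longrightarrow> y \<in> V - C \<Longrightarrow> a x y = 0" "\<And>x y. x \<in> T \<Longrightarrow> y \<in> V - T \<Longrightarrow> a x y = 0"
    using C(2) assms(1,4) fin by (auto simp: weight_eq_0_iff)
  then have "\<forall>x\<in>C \<inter> T. \<forall>y\<in>V - C \<inter> T. a x y = 0" by blast
  then have "weight a (C \<inter> T) (V - C \<inter> T) = 0"
    using fin assms(1) by (subst weight_eq_0_iff) auto
  then have "\<not> C \<inter> T \<subset> C" using assms(2,5) unfolding atom_def by blast
  then show ?thesis by blast
qed

lemma atom_disjoint:
  assumes "finite V" "atom V a C" "atom V a D" "C \<inter> D \<noteq> {}"
  shows "C = D"
proof (rule subset_antisym)
  show "C \<subseteq> D" using atom_subset[of V a C D] assms by (auto simp: atom_def)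
  show "D \<subseteq> C" using atom_subset[of V a D C] assms by (auto simp: atom_def)
qed

lemma atom_cut:
  assumes "finite V" "atom V a C" "X \<subseteq> C"
  shows "weight a X (V - X) = weight a X (C - X)"
proof -
  have C: "C \<subseteq> V" "weight a C (V - C) = 0" using assms(2) by (auto simp: atom_def)
  have fin: "finite C" using C(1) assms(1) finite_subset by blast
  have "weight a X (V - C) = 0"
    using weight_mono[of C "V - C" X "V - C" a] C assms fin by simp
  moreover have "V - X = (C - X) \<union> (V - C)" using C(1) assms(3) by auto
  ultimately show ?thesis
    using weight_Un_right[of "C - X" "V - C" a X] fin assms(1) by auto
qed

text \<open>If \<open>A\<close> and \<open>B\<close> crossed, they would cut \<open>C\<close> into
  four nonempty pieces, the outer one containing \<open>z\<close>. Every edge between different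
  pieces lies in one of the two cuts, so there are at most two such edges. Each piece is left by at
  least one, so the edges would match the pieces in pairs; but no such matching gives both
  \<open>A\<close> and \<open>B\<close> a cut of exactly 1. The final linear system expresses this
  in the six edge counts between pieces.\<close>

lemma bridge_sides_nested:
  assumes V: "finite V" and a: "multiplicity a" and C: "atom V a C"
    and A: "A \<subset> C" "weight a A (V - A) = 1" and B: "B \<subset> C" "weight a B (V - B) = 1"
    and z: "z \<in> C" "z \<notin> A" "z \<notin> B"
  shows "A \<inter> B = {} \<or> A \<subseteq> B \<or> B \<subseteq> A"
proof (rule ccontr)
  assume neg: "\<not> ?thesis"
  define P Q R Z where PQRZ: "P = A \<inter> B" "Q = A - B" "R = B - A" "Z = C - (A \<union> B)"
  have fC: "finite C" using C V unfolding atom_def by (meson finite_subset)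
  have fin: "finite P" "finite Q" "finite R" "finite Z"
    using fC A(1) B(1) by (auto simp: PQRZ intro: finite_subset)
  have disj: "P \<inter> Q = {}" "P \<inter> R = {}" "P \<inter> Z = {}" "Q \<inter> R = {}" "Q \<inter> Z = {}" "R \<inter> Z = {}"
    by (auto simp: PQRZ)
  have ne: "P \<noteq> {}" "Q \<noteq> {}" "R \<noteq> {}" "Z \<noteq> {}" using neg z by (auto simp: PQRZ)
  have cut: "weight a X (V - X) = weight a X Y" if "X \<union> Y = C" "X \<inter> Y = {}" for X Y
  proof -
    have "Y = C - X" using that by auto
    then show ?thesis using atom_cut[OF V C, of X] that by auto
  qed
  have pos: "1 \<le> weight a X Y" if "X \<union> Y = C" "X \<inter> Y = {}" "X \<noteq> {}" "Y \<noteq> {}" for X Y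
  proof -
    have "X \<subset> C" using that by auto
    then show ?thesis using C that cut[of X Y] unfolding atom_def by (metis less_one not_le)
  qed
  have AB: "A = P \<union> Q" "B = P \<union> R" using A B by (auto simp: PQRZ)
  have "A \<union> (R \<union> Z) = C" "A \<inter> (R \<union> Z) = {}" "B \<union> (Q \<union> Z) = C" "B \<inter> (Q \<union> Z) = {}"
    using A(1) B(1) unfolding PQRZ by blast+
  then have "weight a A (R \<union> Z) = 1" "weight a B (Q \<union> Z) = 1"
    using cut[of A "R \<union> Z"] cut[of B "Q \<union> Z"] A(2) B(2) by simp_all
  then have "weight a (P \<union> Q) (R \<union> Z) = 1" "weight a (P \<union> R) (Q \<union> Z) = 1"
    by (simp_all add: AB[symmetric])
  moreover have "1 \<le> weight a P (Q \<union> (R \<union> Z))" "1 \<le> weight a Q (P \<union> (R \<union> Z))"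
    "1 \<le> weight a R (P \<union> (Q \<union> Z))" "1 \<le> weight a Z (P \<union> (Q \<union> R))"
    using A(1) B(1) ne unfolding PQRZ by (intro pos; blast)+
  moreover have "weight a Q P = weight a P Q" "weight a R P = weight a P R" "weight a Z P = weight a P Z"
    "weight a R Q = weight a Q R" "weight a Z Q = weight a Q Z" "weight a Z R = weight a R Z"
    using a by (auto intro: weight_commute)
  moreover have "Q \<inter> P = {}" "R \<inter> P = {}" "Z \<inter> P = {}" "R \<inter> Q = {}" "Z \<inter> Q = {}" "Z \<inter> R = {}"
    using disj by auto
  moreover have False
    if "pr + qr + (pz + qz) = Suc 0" "pq + qr + (pz + rz) = Suc 0" "Suc 0 \<le> pq + (pr + pz)"
      "Suc 0 \<le> pq + (qr + qz)" "Suc 0 \<le> pr + (qr + rz)" "Suc 0 \<le> pz + (qz + rz)"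
    for pq pr pz qr qz rz :: nat
    using that by presburger
  ultimately show False
    using fin disj by (simp add: weight_Un_left weight_Un_right Int_Un_distrib Int_Un_distrib2)
qed

lemma laminar_bridge_family:
  assumes V: "finite V" and a: "multiplicity a"
  shows "laminar (bridge_family V a)"
  unfolding laminar_def
proof (intro ballI)
  have elem: "\<exists>C. atom V a C \<and> (A = C \<or> A \<subset> C \<and> weight a A (V - A) = 1 \<and> Min C \<notin> A)"
    if "A \<in> bridge_family V a" for A
    using that unfolding bridge_family_def by blast
  fix A B assume "A \<in> bridge_family V a" "B \<in> bridge_family V a"
  then obtain C D where C: "atom V a C" "A = C \<or> A \<subset> C \<and> weight a A (V - A) = 1 \<and> Min C \<notin> A"
    and D: "atom V a D" "B = D \<or> B \<subset> D \<and> weight a B (V - B) = 1 \<and> Min D \<notin> B"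
    using elem by meson
  show "A \<inter> B = {} \<or> A \<subseteq> B \<or> B \<subseteq> A"
  proof (cases "C = D")
    case True
    have "finite C" "C \<noteq> {}" using C(1) V unfolding atom_def by (auto intro: finite_subset)
    then have "Min C \<in> C" by (rule Min_in)
    then show ?thesis
      using C D True bridge_sides_nested[OF V a C(1), of A B "Min C"] by blast
  next
    case False
    then have "C \<inter> D = {}" using atom_disjoint[OF V C(1) D(1)] by blast
    then show ?thesis using C(2) D(2) by blast
  qed
qed

text \<open>While at least two vertices are missing, a fair share is at most one half, even after
  rounding up.\<close>

lemma div_le_half:
  fixes x w :: nat
  assumes "2 \<le> w"
  shows "(x + w - 1) div w \<le> (x + 1) div 2"
proof -
  define q where "q = (x + 1) div 2"
  have "x \<le> 2 * q" by (simp add: q_def)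
  have "x \<le> q * w" using \<open>x \<le> 2 * q\<close> mult_le_mono2[OF assms, of q] by linarith
  then have "x + w - 1 < (q + 1) * w" using assms by simp
  then have "(x + w - 1) div w < q + 1" by (rule less_mult_imp_div_less)
  then show ?thesis by (simp add: q_def)
qed

text \<open>
  In terms of cuts, the conclusion says that the part \<open>c\<close> of the deficit can be attached to a new
  vertex of degree \<open>r\<close>: a violation is a set \<open>T\<close> separated from the rest by at most one edge
  which sends almost all its deficit, and almost everything the new vertex receives, to the new vertex.
\<close>

lemma sparse_extension_bound:
  fixes a :: "nat \<Rightarrow> nat \<Rightarrow> nat"
  assumes V: "finite V" and a: "multiplicity a" and sp: "sparse r V a"
    and r: "2 \<le> r" and w: "2 \<le> w"
    and c: "\<And>v. v \<in> V \<Longrightarrow> c v \<le> deficit r V a v" "sum c V \<le> r"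
    and fair: "\<And>T. T \<in> bridge_family V a \<Longrightarrow> sum (deficit r V a) T div w \<le> sum c T \<and>
       sum c T \<le> (sum (deficit r V a) T + w - 1) div w"
    and T: "T \<subseteq> V"
  shows "2 * sum c T + weight a T T + 2 \<le> r * (card T + 1)"
proof (rule ccontr)
  assume neg: "\<not> ?thesis"
  let ?b = "deficit r V a" and ?d = "\<lambda>T. weight a T (V - T)"
  have deg: "\<And>v. v \<in> V \<Longrightarrow> weight a {v} V \<le> r" using sp by (auto simp: sparse_def)
  have sd: "sum ?b X + weight a X X + ?d X = r * card X" if "X \<subseteq> V" for X
    using sum_deficit[OF V that deg] by simp
  have two: "2 \<le> ?d X + sum ?b X" if "X \<subseteq> V" "X \<noteq> {}" for X
    using sp that sparse_iff[where a=a, OF V deg] by blast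
  have cb: "sum c X \<le> sum ?b X" if "X \<subseteq> V" for X
    using that c(1) by (intro sum_mono) auto
  have cr: "sum c X \<le> r" if "X \<subseteq> V" for X
    using sum_mono2[OF V that, of c] c(2) by simp
  have half: "2 * sum c X \<le> sum ?b X + 1" if "X \<in> bridge_family V a" for X
    using fair[OF that] div_le_half[OF w, of "sum ?b X"] by linarith
  \<comment> \<open>A component has deficit at least 2 and gives away at most half of it, rounded
    up, so it keeps some.\<close>
  have at: "sum c C + 1 \<le> sum ?b C" if "atom V a C" for C
  proof -
    have "2 \<le> sum ?b C" using that two[of C] by (auto simp: atom_def)
    moreover have "2 * sum c C \<le> sum ?b C + 1"
      using that by (intro half) (simp add: bridge_family_def)
    ultimately show ?thesis by linarith
  qed
  have fin: "finite X" if "X \<subseteq> V" for X using that V by (rule finite_subset)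
  have one: "sum c X + 1 \<le> sum ?b X" if "X \<subseteq> V" "atom V a C" "C \<subseteq> X" for X C
  proof -
    have "sum f X = sum f C + sum f (X - C)" for f :: "nat \<Rightarrow> nat"
      using sum.subset_diff[OF that(3) fin[OF that(1)], of f] by simp
    then show ?thesis using at[OF that(2)] cb[of "X - C"] that(1) by fastforce
  qed
  have bad: "sum ?b T + ?d T + r \<le> 2 * sum c T + 1"
    using neg sd[OF T] by (simp add: algebra_simps)
  have "T \<noteq> {}" using bad r by auto
  then obtain v where v: "v \<in> T" by blast
  then obtain C where C: "atom V a C" "v \<in> C" using atom_exists[OF V a] T by blast
  have CV: "C \<subseteq> V" using C by (simp add: atom_def)
  \<comment> \<open>\<open>T\<close> sends at most its deficit and at most \<open>r\<close>, so
    \<open>bad\<close> leaves room for at most one edge leaving \<open>T\<close>.\<close>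
  consider "?d T = 0" | "?d T = 1" using bad cb[OF T] cr[OF T] by linarith
  then show False
  proof cases
    case 1
    have CT: "C \<subseteq> T" using atom_subset[OF V C(1) T 1] C(2) v by blast
    show False
    proof (cases "C = T")
      case True
      \<comment> \<open>For a single component only \<open>r = 2\<close> with an odd deficit
        remains, which parity excludes.\<close>
      have "2 * sum c T \<le> sum ?b T + 1"
        using C(1) True by (intro half) (simp add: bridge_family_def)
      then have "r = 2" "2 * sum c T = sum ?b T + 1" using bad 1 r by linarith+
      then have "odd (sum ?b T)" by (metis dvd_triv_left even_plus_one_iff)
      moreover have "sum ?b T + weight a T T = 2 * card T" using sd[OF T] 1 \<open>r = 2\<close> by simp
      ultimately show False using even_weight_self[OF a, of T] by (metis dvd_triv_left even_add)
    next
      case False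
      then obtain v' where v': "v' \<in> T - C" using CT by blast
      then obtain D where D: "atom V a D" "v' \<in> D" using atom_exists[OF V a] T by blast
      have DT: "D \<subseteq> T" using atom_subset[OF V D(1) T 1] D(2) v' by blast
      have "D \<inter> C = {}" using atom_disjoint[OF V D(1) C(1)] D(2) v' by blast
      then have DT: "D \<subseteq> T - C" using DT by blast
      have "sum f T = sum f C + sum f (T - C)" for f :: "nat \<Rightarrow> nat"
        using sum.subset_diff[OF CT fin[OF T], of f] by simp
      moreover have "sum c (T - C) + 1 \<le> sum ?b (T - C)"
        using T by (intro one[OF _ D(1) DT]) auto
      \<comment> \<open>\<open>C\<close> and the rest of \<open>T\<close> each contain a whole
        component and so each keep a unit of deficit; \<open>bad\<close> allows only one unit in
        total.\<close>
      ultimately have "sum c T + 2 \<le> sum ?b T" using at[OF C(1)] by simp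
      then show False using bad cr[OF T] by linarith
    qed
  next
    case 2
    \<comment> \<open>Now all estimates are tight: \<open>T\<close> sends its entire deficit, so by
      \<open>one\<close> it contains no component.\<close>
    have eq: "sum ?b T = r" "sum c T = r" using bad 2 cb[OF T] cr[OF T] by linarith+
    have noatom: "\<not> D \<subseteq> T" if "atom V a D" for D
      using one[OF T that] eq by auto
    \<comment> \<open>The part of \<open>T\<close> inside \<open>C\<close> already uses up the
      single leaving edge. Hence no edge would leave the part outside \<open>C\<close>, and a
      nonempty such part would contain a component.\<close>
    have "T - C = {}"
    proof (rule ccontr)
      assume ne: "T - C \<noteq> {}"
      let ?X = "T \<inter> C"
      have "?X \<subset> C" "?X \<noteq> {}" using noatom[OF C(1)] v C(2) by blast+
      then have "1 \<le> ?d ?X" using C(1) unfolding atom_def by (metis less_one not_le)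
      moreover have "?d ?X = weight a ?X (C - ?X)" by (rule atom_cut[OF V C(1)]) simp
      moreover have "weight a ?X (C - ?X) \<le> weight a ?X (V - T)"
        using V CV by (intro weight_mono) (auto intro: fin)
      moreover have "?d T = weight a ?X (V - T) + weight a (T - C) (V - T)"
        using weight_split_left[of T ?X a "V - T"] fin[OF T] by (simp add: Diff_Int)
      ultimately have 0: "weight a (T - C) (V - T) = 0" using 2 by linarith
      have "weight a (T - C) ?X \<le> weight a (V - C) C"
        using V CV T by (intro weight_mono) (auto intro: fin)
      also have "\<dots> = 0" using C(1) weight_commute[OF a, of C "V - C"] by (simp add: atom_def)
      finally have "weight a (T - C) ((V - T) \<union> ?X) = 0"
        using 0 V fin[OF T] by (subst weight_Un_right) auto
      moreover have "(V - T) \<union> ?X = V - (T - C)" using T CV by auto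
      ultimately have dTC: "?d (T - C) = 0" by simp
      obtain v' where v': "v' \<in> T - C" using ne by blast
      then obtain D where D: "atom V a D" "v' \<in> D" using atom_exists[OF V a] T by blast
      have "D \<subseteq> T - C" using atom_subset[OF V D(1) _ dTC] T D(2) v' by blast
      then show False using noatom[OF D(1)] by blast
    qed
    then have TC: "T \<subset> C" using noatom[OF C(1)] by blast
    have "r + weight a T T + 1 = r * card T" using sd[OF T] 2 eq by simp
    then have "odd r" using even_weight_self[OF a, of T]
      by (metis even_add even_mult_iff odd_one)
    then have r3: "3 \<le> r" using r by (cases "r = 2") auto
    \<comment> \<open>A member of the family sends at most half of its deficit \<open>r\<close>,
      rounded up, which is less than \<open>r\<close>. So \<open>T\<close> is the side with the
      root, and the side divided fairly is its complement \<open>S\<close> in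
      \<open>C\<close>.\<close>
    have notfam: "T \<notin> bridge_family V a" using half[of T] eq r by auto
    define S where "S = C - T"
    have S: "S \<subset> C" "S \<noteq> {}" "S \<subseteq> V" using TC CV v C(2) by (auto simp: S_def)
    have "?d S = weight a S (C - S)" using S by (intro atom_cut[OF V C(1)]) auto
    also have "C - S = T" using TC by (auto simp: S_def)
    also have "weight a S T = weight a T S" using a by (rule weight_commute)
    also have "\<dots> = ?d T" using TC atom_cut[OF V C(1), of T] by (simp add: S_def)
    finally have dS: "?d S = 1" using 2 by simp
    have "Min C \<in> T" using notfam C(1) TC 2 v unfolding bridge_family_def by blast
    then have Sfam: "S \<in> bridge_family V a"
      using C(1) S dS unfolding bridge_family_def by (auto simp: S_def)
    have split: "sum f C = sum f S + sum f T" for f :: "nat \<Rightarrow> nat"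
      using sum.subset_diff[of T C f] TC fin[OF CV] by (auto simp: S_def)
    \<comment> \<open>\<open>T\<close> alone already exhausts the degree \<open>r\<close> of the new
      vertex. As nothing comes from \<open>S\<close>, fairness forces the deficit of
      \<open>S\<close> below \<open>w\<close>.\<close>
    have cS: "sum c S = 0" using split[of c] cr[OF CV] eq by simp
    then have "sum ?b S div w = 0" using fair[OF Sfam] by simp
    then have bS: "sum ?b S < w" using w by (auto simp: div_eq_0_iff)
    \<comment> \<open>The deficit of \<open>C\<close> is thus at most r + w - 1, and its
      \<open>w\<close>-th part, rounded up, is less than \<open>r\<close> once \<open>r\<close> is
      at least 3.\<close>
    have "r = sum c C" using split[of c] cS eq by simp
    also have "\<dots> \<le> (sum ?b C + w - 1) div w"
      using fair[of C] C(1) by (simp add: bridge_family_def)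
    also have "\<dots> \<le> ((r - 2) + 2 * w) div w"
      using split[of ?b] eq bS r by (intro div_le_mono) linarith
    also have "\<dots> = (r - 2) div w + 2" using w by simp
    also have "(r - 2) div w \<le> (r - 2) div 2" using w by (intro div_le_mono2) auto
    finally show False using r3 by linarith
  qed
qed

section \<open>Adding vertices\<close>

definition extend_at :: "nat \<Rightarrow> (nat \<Rightarrow> nat \<Rightarrow> nat) \<Rightarrow> (nat \<Rightarrow> nat) \<Rightarrow> nat \<Rightarrow> nat \<Rightarrow> nat" where
  "extend_at s a c u v = (if u < s \<and> v < s then a u v else if u < s \<and> v = s then c u
     else if u = s \<and> v < s then c v else 0)"

lemma multiplicity_extend_at: "multiplicity a \<Longrightarrow> multiplicity (extend_at s a c)"
  unfolding multiplicity_def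
proof (intro conjI allI)
  fix u v assume "(\<forall>u v. a u v = a v u) \<and> (\<forall>u. a u u = 0)"
  then have a: "a u v = a v u" "a u u = 0" by blast+
  show "extend_at s a c u v = extend_at s a c v u"
    unfolding extend_at_def a(1) by (cases u s rule: linorder_cases; cases v s rule: linorder_cases) simp_all
  show "extend_at s a c u u = 0" unfolding extend_at_def a(2) by simp
qed

lemma weight_extend_at:
  assumes "A \<subseteq> {..<s}"
  shows "B \<subseteq> {..<s} \<Longrightarrow> weight (extend_at s a c) A B = weight a A B"
    and "weight (extend_at s a c) A {s} = sum c A"
    and "weight (extend_at s a c) {s} A = sum c A"
proof -
  have A: "u < s" if "u \<in> A" for u using that assms by auto
  show "weight (extend_at s a c) A B = weight a A B" if "B \<subseteq> {..<s}"
    unfolding weight_def using A that by (intro sum.cong refl) (auto simp: extend_at_def)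
  show "weight (extend_at s a c) A {s} = sum c A" "weight (extend_at s a c) {s} A = sum c A"
    unfolding weight_def using A by (simp_all add: extend_at_def)
qed

lemma weight_extend_at_degree:
  "v < s \<Longrightarrow> weight (extend_at s a c) {v} {..<Suc s} = weight a {v} {..<s} + c v"
  "weight (extend_at s a c) {s} {..<Suc s} = sum c {..<s}"
proof -
  have split: "weight (extend_at s a c) X {..<Suc s} =
      weight (extend_at s a c) X {s} + weight (extend_at s a c) X {..<s}" for X
    using weight_Un_right[of "{s}" "{..<s}" "extend_at s a c" X] by (simp add: lessThan_Suc)
  show "v < s \<Longrightarrow> weight (extend_at s a c) {v} {..<Suc s} = weight a {v} {..<s} + c v"
    using weight_extend_at[of "{v}" s] by (simp add: split)
  have "weight (extend_at s a c) {s} {s} = 0" by (simp add: weight_def extend_at_def)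
  then show "weight (extend_at s a c) {s} {..<Suc s} = sum c {..<s}"
    using weight_extend_at(3)[of "{..<s}" s] by (simp add: split)
qed

lemma sparse_extend_at:
  assumes a: "multiplicity a" and sp: "sparse r {..<s} a"
    and c: "\<And>v. v < s \<Longrightarrow> c v \<le> deficit r {..<s} a v" "sum c {..<s} \<le> r"
    and T: "\<And>T. T \<subseteq> {..<s} \<Longrightarrow> 2 * sum c T + weight a T T + 2 \<le> r * (card T + 1)"
  shows "sparse r {..<Suc s} (extend_at s a c)"
  unfolding sparse_def
proof (intro conjI ballI allI impI)
  fix v assume "v \<in> {..<Suc s}"
  then consider "v < s" | "v = s" by fastforce
  then show "weight (extend_at s a c) {v} {..<Suc s} \<le> r"
  proof cases
    case 1
    then have "weight a {v} {..<s} \<le> r" using sp by (simp add: sparse_def)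
    then show ?thesis using 1 c(1)[OF 1] by (simp add: weight_extend_at_degree deficit_def)
  qed (use c(2) in \<open>simp add: weight_extend_at_degree\<close>)
next
  fix S assume S: "S \<subseteq> {..<Suc s}" "S \<noteq> {}"
  show "weight (extend_at s a c) S S + 2 \<le> r * card S"
  proof (cases "s \<in> S")
    case False
    then have "S \<subseteq> {..<s}" using S by (auto simp: less_Suc_eq)
    then show ?thesis using sp S by (simp add: weight_extend_at sparse_def)
  next
    case True
    define X where "X = S - {s}"
    have X: "X \<subseteq> {..<s}" "S = insert s X" "s \<notin> X" using S True by (auto simp: X_def less_Suc_eq)
    then have "finite X" by (meson finite_lessThan finite_subset)
    then show ?thesis
      using T[OF X(1)] X weight_insert_self[of X s, OF _ _ multiplicity_extend_at[OF a]]
      by (simp add: weight_extend_at)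
  qed
qed

text \<open>The bound on the total deficit says that the \<open>m - s\<close> missing vertices, each
  of degree \<open>r\<close>, can absorb what the present ones lack in this color.\<close>

definition partial_factorization ::
  "nat \<Rightarrow> nat \<Rightarrow> nat \<Rightarrow> nat \<Rightarrow> nat \<Rightarrow> (nat \<Rightarrow> nat \<Rightarrow> nat \<Rightarrow> nat) \<Rightarrow> bool" where
  "partial_factorization \<mu> r k m s A \<longleftrightarrow>
     (\<forall>i\<in>{1..k}. multiplicity (A i) \<and> sparse r {..<s} (A i) \<and>
        sum (deficit r {..<s} (A i)) {..<s} \<le> r * (m - s)) \<and>
     (\<forall>u<s. \<forall>v<s. u \<noteq> v \<longrightarrow> (\<Sum>i\<in>{1..k}. A i u v) = \<mu>)"

lemma sum_weight_row:
  assumes "\<And>i. i \<in> I \<Longrightarrow> multiplicity (A i)" "v < s"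
    and "\<And>u. u < s \<Longrightarrow> u \<noteq> v \<Longrightarrow> (\<Sum>i\<in>I. A i v u) = \<mu>"
  shows "(\<Sum>i\<in>I. weight (A i) {v} {..<s}) = \<mu> * (s - 1)"
proof -
  have "(\<Sum>i\<in>I. weight (A i) {v} {..<s}) = (\<Sum>u<s. \<Sum>i\<in>I. A i v u)"
    unfolding weight_def by simp (rule sum.swap)
  also have "\<dots> = (\<Sum>i\<in>I. A i v v) + (\<Sum>u\<in>{..<s} - {v}. \<Sum>i\<in>I. A i v u)"
    using assms(2) by (subst sum.remove[of _ v]) auto
  also have "(\<Sum>i\<in>I. A i v v) = 0" using assms(1) by (auto simp: multiplicity_def)
  also have "(\<Sum>u\<in>{..<s} - {v}. \<Sum>i\<in>I. A i v u) = (\<Sum>u\<in>{..<s} - {v}. \<mu>)"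
    using assms(3) by (intro sum.cong) auto
  also have "\<dots> = \<mu> * (s - 1)" using assms(2) by simp
  finally show ?thesis by simp
qed

lemma sum_deficit_colors:
  assumes A: "partial_factorization \<mu> r k m s A" and v: "v < s" and m: "s \<le> m"
    and rk: "r * k = \<mu> * (m - 1)"
  shows "(\<Sum>i\<in>{1..k}. deficit r {..<s} (A i) v) = \<mu> * (m - s)"
proof -
  have w: "(\<Sum>i\<in>{1..k}. weight (A i) {v} {..<s}) = \<mu> * (s - 1)"
    using A v unfolding partial_factorization_def by (intro sum_weight_row) auto
  have "(\<Sum>i\<in>{1..k}. deficit r {..<s} (A i) v) + (\<Sum>i\<in>{1..k}. weight (A i) {v} {..<s}) =
      (\<Sum>i\<in>{1..k}. r)"
    unfolding sum.distrib[symmetric]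
    using A v by (intro sum.cong) (auto simp: deficit_def partial_factorization_def sparse_def)
  also have "\<dots> = \<mu> * (m - s) + \<mu> * (s - 1)"
    using rk v m by (simp add: mult.commute flip: add_mult_distrib2)
  finally show ?thesis using w by simp
qed

lemma laminar_add_vertex:
  fixes s :: nat
  assumes "laminar L" "L \<subseteq> Pow {..<s}"
  shows "laminar (insert {..s} (insert {s} L))"
proof -
  have *: "B \<subseteq> {..s} \<and> s \<notin> B" if "B \<in> L" for B
  proof -
    have "B \<subseteq> {..<s}" using that assms(2) by blast
    then show ?thesis by auto
  qed
  show ?thesis
    using assms(1) unfolding laminar_def
    by (auto dest: *)
qed

lemma ceiling_div_mult: "0 < w \<Longrightarrow> (x * w + w - 1) div w = x" for x w :: nat
proof -
  assume "0 < w"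
  then obtain y where "w = Suc y" by (cases w) auto
  then show ?thesis by (simp add: div_nat_eqI)
qed

lemma sum_row: "sum f ({i} \<times> T) = (\<Sum>v\<in>T. f (i, v))"
proof -
  have "{i} \<times> T = Pair i ` T" by auto
  then show ?thesis by (simp add: sum.reindex inj_on_def)
qed

lemma sum_column: "sum f (I \<times> {v}) = (\<Sum>i\<in>I. f (i, v))"
proof -
  have "I \<times> {v} = (\<lambda>i. (i, v)) ` I" by auto
  then show ?thesis by (simp add: sum.reindex inj_on_def)
qed

text \<open>
  Index \<open>s\<close> of \<open>b\<close> stands for the ends of those edges of a color that join two of the vertices
  not yet present: together with the deficits there are \<open>r (m - s)\<close> ends in each color,
  of which the new vertex has to receive exactly \<open>r\<close>.
\<close>

lemma partial_factorization_step:
  assumes A: "partial_factorization \<mu> r k m s A"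
    and rk: "r * k = \<mu> * (m - 1)" and ev: "even (r * m)" and r: "2 \<le> r" and s: "s + 2 \<le> m"
  shows "\<exists>A'. partial_factorization \<mu> r k m (Suc s) A' \<and>
    (\<forall>i. \<forall>u<s. \<forall>v<s. A' i u v = A i u v)"
proof -
  let ?V = "{..<s}"
  define w where "w = m - s"
  have w: "2 \<le> w" "0 < w" using s by (auto simp: w_def)
  define D where "D i = sum (deficit r ?V (A i)) ?V" for i
  define b where "b = (\<lambda>(i, v). if v < s then deficit r ?V (A i) v else r * w - D i)"
  \<comment> \<open>The whole row \<open>{..s}\<close> fixes the degree of the new vertex at
    \<open>r\<close>; the singleton \<open>{s}\<close> limits what the new vertex leaves open for
    edges to later vertices.\<close>
  define fam where "fam i = insert {..s} (insert {s} (bridge_family ?V (A i)))" for i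
  define F where "F = (\<Union>i\<in>{1..k}. (\<lambda>T. {i} \<times> T) ` fam i)"
  \<comment> \<open>One column for each vertex already present, so that its edges to the new vertex
    number exactly \<mu> over all colors.\<close>
  define G where "G = (\<lambda>v. {1..k} \<times> {v}) ` ?V"
  have mul: "multiplicity (A i)" and sp: "sparse r ?V (A i)" and Dle: "D i \<le> r * w"
    if "i \<in> {1..k}" for i
    using A that by (auto simp: partial_factorization_def D_def w_def)
  have bf: "bridge_family ?V (A i) \<subseteq> Pow ?V" for i
    by (auto simp: bridge_family_def atom_def)
  have lamfam: "laminar (fam i)" if "i \<in> {1..k}" for i
    unfolding fam_def
    using laminar_bridge_family[OF _ mul[OF that]] bf by (intro laminar_add_vertex) auto
  have "laminar F"
    unfolding laminar_def
  proof (intro ballI)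
    fix P Q assume "P \<in> F" "Q \<in> F"
    then obtain i j S T where *: "i \<in> {1..k}" "S \<in> fam i" "P = {i} \<times> S" "j \<in> {1..k}" "T \<in> fam j" "Q = {j} \<times> T"
      by (auto simp: F_def)
    show "P \<inter> Q = {} \<or> P \<subseteq> Q \<or> Q \<subseteq> P"
    proof (cases "i = j")
      case True
      then have "S \<inter> T = {} \<or> S \<subseteq> T \<or> T \<subseteq> S"
        using lamfam[OF *(1)] * unfolding laminar_def by blast
      then show ?thesis using * True by auto
    qed (use * in auto)
  qed
  moreover have "laminar G" by (auto simp: laminar_def G_def)
  moreover have "F \<subseteq> Pow ({1..k} \<times> {..s})"
  proof -
    have "fam i \<subseteq> Pow {..s}" for i using bf[of i] by (fastforce simp: fam_def)
    then show ?thesis unfolding F_def by blast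
  qed
  moreover have "G \<subseteq> Pow ({1..k} \<times> {..s})" by (auto simp: G_def)
  ultimately have "\<exists>c. (\<forall>y. c y \<le> b y) \<and> (\<forall>P\<in>F \<union> G. sum b P div w \<le> sum c P \<and>
      sum c P \<le> (sum b P + w - 1) div w)"
    using w by (intro laminar_equitable_weights[of "{1..k} \<times> {..s}"]) simp_all
  then obtain c0 where c0: "\<And>y. c0 y \<le> b y"
    "\<And>P. P \<in> F \<union> G \<Longrightarrow> sum b P div w \<le> sum c0 P \<and> sum c0 P \<le> (sum b P + w - 1) div w"
    by blast
  define c where "c i v = c0 (i, v)" for i v
  have fair: "(\<Sum>v\<in>T. b (i, v)) div w \<le> sum (c i) T \<and>
      sum (c i) T \<le> ((\<Sum>v\<in>T. b (i, v)) + w - 1) div w" if "i \<in> {1..k}" "T \<in> fam i" for i T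
  proof -
    have "{i} \<times> T \<in> F \<union> G" using that by (auto simp: F_def)
    from c0(2)[OF this] show ?thesis by (simp add: sum_row c_def)
  qed
  have cb: "c i v \<le> deficit r ?V (A i) v" if "v < s" for i v
    using c0(1)[of "(i, v)"] that by (simp add: c_def b_def)
  have bV: "(\<Sum>v\<in>T. b (i, v)) = sum (deficit r ?V (A i)) T" if "T \<subseteq> ?V" for i T
    using that by (intro sum.cong) (auto simp: b_def)
  have tot: "sum (c i) ?V + c i s = r" if i: "i \<in> {1..k}" for i
  proof -
    have "(\<Sum>v\<le>s. b (i, v)) = (\<Sum>v<s. b (i, v)) + b (i, s)"
      by (simp flip: lessThan_Suc_atMost)
    also have "\<dots> = r * w" using Dle[OF i] bV[of ?V i] by (simp add: b_def D_def)
    finally have "(\<Sum>v\<le>s. b (i, v)) = r * w" .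
    moreover have "{..s} \<in> fam i" by (simp add: fam_def)
    ultimately have "r * w div w \<le> sum (c i) {..s} \<and> sum (c i) {..s} \<le> (r * w + w - 1) div w"
      using fair[OF i, of "{..s}"] by metis
    then have "sum (c i) {..s} = r" unfolding ceiling_div_mult[OF w(2)] using w by simp
    then show ?thesis by (simp flip: lessThan_Suc_atMost)
  qed
  \<comment> \<open>This difference is to become twice the number of edges among the missing
    vertices. Its parity is where the evenness of \<open>r * m\<close> enters.\<close>
  have evb: "even (r * w - D i)" if i: "i \<in> {1..k}" for i
  proof -
    have "D i + weight (A i) ?V ?V = r * s"
      using sum_deficit[of ?V ?V "A i" r] sp[OF i] by (auto simp: D_def sparse_def)
    moreover have "r * w + r * s = r * m" using s by (simp add: w_def flip: add_mult_distrib2)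
    ultimately have "(r * w - D i) + 2 * (r * s) = r * m + weight (A i) ?V ?V"
      using Dle[OF i] by linarith
    then have "even ((r * w - D i) + 2 * (r * s))" using ev even_weight_self[OF mul[OF i]] by simp
    then show ?thesis by simp
  qed
  \<comment> \<open>\<open>c i s\<close> will be the deficit of the new vertex. The deficit of the
    color changes from \<open>D i\<close> to \<open>D i - (r - c i s) + c i s\<close>, so the bound
    for the next stage is equivalent to \<open>D i + 2 * c i s \<le> r * w\<close>. A rounded half
    would miss this by one if the difference were odd.\<close>
  have half: "2 * c i s \<le> r * w - D i" if i: "i \<in> {1..k}" for i
  proof -
    have "{s} \<in> fam i" by (simp add: fam_def)
    from fair[OF i this] have "c i s \<le> (r * w - D i + w - 1) div w" by (simp add: b_def)
    also have "\<dots> \<le> (r * w - D i + 1) div 2" by (rule div_le_half[OF w(1)])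
    finally show ?thesis using evb[OF i] by (elim evenE) simp
  qed
  \<comment> \<open>The deficits of \<open>v\<close> add up to a multiple of \<open>w\<close>, so
    rounding down and rounding up agree.\<close>
  have col: "(\<Sum>i\<in>{1..k}. c i v) = \<mu>" if "v < s" for v
  proof -
    have "sum b ({1..k} \<times> {v}) = \<mu> * w"
      using sum_deficit_colors[OF A that _ rk] s that by (simp add: sum_column b_def w_def)
    moreover have "{1..k} \<times> {v} \<in> F \<union> G" using that by (simp add: G_def)
    ultimately have "\<mu> * w div w \<le> sum c0 ({1..k} \<times> {v}) \<and>
        sum c0 ({1..k} \<times> {v}) \<le> (\<mu> * w + w - 1) div w"
      using c0(2)[of "{1..k} \<times> {v}"] by metis
    then show ?thesis unfolding ceiling_div_mult[OF w(2)] using w by (simp add: sum_column c_def)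
  qed
  define A' where "A' i = extend_at s (A i) (c i)" for i
  have "multiplicity (A' i) \<and> sparse r {..<Suc s} (A' i) \<and>
      sum (deficit r {..<Suc s} (A' i)) {..<Suc s} \<le> r * (m - Suc s)" if i: "i \<in> {1..k}" for i
  proof (intro conjI)
    show "multiplicity (A' i)" unfolding A'_def using mul[OF i] by (rule multiplicity_extend_at)
    have cr: "sum (c i) ?V \<le> r" using tot[OF i] by simp
    show "sparse r {..<Suc s} (A' i)"
      unfolding A'_def
    proof (rule sparse_extend_at[OF mul[OF i] sp[OF i] cb cr])
      fix T assume T: "T \<subseteq> ?V"
      show "2 * sum (c i) T + weight (A i) T T + 2 \<le> r * (card T + 1)"
      proof (rule sparse_extension_bound[OF _ mul[OF i] sp[OF i] r w(1) _ cr _ T])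
        fix U assume U: "U \<in> bridge_family ?V (A i)"
        then have "U \<subseteq> ?V" "U \<in> fam i" using bf[of i] by (auto simp: fam_def)
        then show "sum (deficit r ?V (A i)) U div w \<le> sum (c i) U \<and>
            sum (c i) U \<le> (sum (deficit r ?V (A i)) U + w - 1) div w"
          using fair[OF i, of U] by (simp add: bV)
      qed (use cb in auto)
    qed
    have new: "deficit r {..<Suc s} (A' i) v + c i v = deficit r ?V (A i) v" if "v < s" for v
      using cb[OF that, of i] that by (simp add: deficit_def A'_def weight_extend_at_degree)
    have "sum (deficit r {..<Suc s} (A' i)) ?V + sum (c i) ?V = D i"
      unfolding D_def sum.distrib[symmetric] using new by (intro sum.cong) auto
    moreover have "deficit r {..<Suc s} (A' i) s = c i s"
      using tot[OF i] by (simp add: deficit_def A'_def weight_extend_at_degree)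
    moreover have "w = Suc (m - Suc s)" using s by (simp add: w_def)
    then have "r * (m - Suc s) + r = r * w" by simp
    ultimately show "sum (deficit r {..<Suc s} (A' i)) {..<Suc s} \<le> r * (m - Suc s)"
      using tot[OF i] half[OF i] Dle[OF i] by simp
  qed
  moreover have "(\<Sum>i\<in>{1..k}. A' i u v) = \<mu>" if uv: "u < Suc s" "v < Suc s" "u \<noteq> v" for u v
  proof -
    consider "u < s" "v < s" | "u < s" "v = s" | "u = s" "v < s" using uv by linarith
    then show ?thesis
      using A uv col by cases (auto simp: A'_def extend_at_def partial_factorization_def)
  qed
  ultimately have "partial_factorization \<mu> r k m (Suc s) A'"
    unfolding partial_factorization_def by blast
  then show ?thesis by (intro exI[of _ A']) (auto simp: A'_def extend_at_def)
qed

text \<open>The last vertex needs its own argument: afterwards no deficit is left, so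
  \<open>sparse\<close> fails for the whole vertex set and only proper subsets keep a cut of 2. It
  has to take all deficits. In each color they add up to at most \<open>r\<close>, and over all
  colors to \<mu>(m - 1) = rk, so to exactly \<open>r\<close> in each. The deficits counted by
  \<open>sparse_iff\<close> thereby turn into edges.\<close>

lemma partial_factorization_last:
  assumes A: "partial_factorization \<mu> r k m s A"
    and rk: "r * k = \<mu> * (m - 1)" and s: "m = Suc s" "0 < s" and r: "2 \<le> r"
  shows "\<exists>A'. (\<forall>i\<in>{1..k}. multiplicity (A' i) \<and> (\<forall>v<m. weight (A' i) {v} {..<m} = r) \<and>
      (\<forall>S\<subseteq>{..<m}. S \<noteq> {} \<longrightarrow> S \<noteq> {..<m} \<longrightarrow> 2 \<le> weight (A' i) S ({..<m} - S))) \<and>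
    (\<forall>u<m. \<forall>v<m. u \<noteq> v \<longrightarrow> (\<Sum>i\<in>{1..k}. A' i u v) = \<mu>) \<and>
    (\<forall>i. \<forall>u<s. \<forall>v<s. A' i u v = A i u v)"
proof -
  let ?V = "{..<s}"
  define c where "c i = deficit r ?V (A i)" for i
  define A' where "A' i = extend_at s (A i) (c i)" for i
  have mul: "multiplicity (A i)" and sp: "sparse r ?V (A i)" and Dle: "sum (c i) ?V \<le> r"
    if "i \<in> {1..k}" for i
    using A that s by (auto simp: partial_factorization_def c_def)
  have col: "(\<Sum>i\<in>{1..k}. c i v) = \<mu>" if "v < s" for v
    using sum_deficit_colors[OF A that _ rk] s by (simp add: c_def)
  have all: "sum (c i) ?V = r" if i: "i \<in> {1..k}" for i
  proof (rule ccontr)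
    assume "sum (c i) ?V \<noteq> r"
    then have "(\<Sum>i\<in>{1..k}. sum (c i) ?V) < (\<Sum>i\<in>{1..k}. r)"
      using Dle i by (intro sum_strict_mono_ex1) (auto intro!: bexI[of _ i] simp: order_le_less)
    moreover have "(\<Sum>i\<in>{1..k}. sum (c i) ?V) = (\<Sum>v<s. \<Sum>i\<in>{1..k}. c i v)" by (rule sum.swap)
    ultimately show False using col rk s by (simp add: mult.commute)
  qed
  have deg: "weight (A i) {v} ?V \<le> r" if "i \<in> {1..k}" "v < s" for i v
    using sp[OF that(1)] that(2) by (simp add: sparse_def)
  have "multiplicity (A' i) \<and> (\<forall>v<m. weight (A' i) {v} {..<m} = r) \<and>
      (\<forall>S\<subseteq>{..<m}. S \<noteq> {} \<longrightarrow> S \<noteq> {..<m} \<longrightarrow> 2 \<le> weight (A' i) S ({..<m} - S))"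
    if i: "i \<in> {1..k}" for i
  proof (intro conjI allI impI)
    show mul': "multiplicity (A' i)" unfolding A'_def using mul[OF i] by (rule multiplicity_extend_at)
    show "weight (A' i) {v} {..<m} = r" if "v < m" for v
    proof (cases "v = s")
      case False
      then show ?thesis using that s deg[OF i, of v]
        by (simp add: A'_def weight_extend_at_degree c_def deficit_def)
    qed (simp add: A'_def weight_extend_at_degree all[OF i] s)
    have cut: "2 \<le> weight (A' i) S ({..<m} - S)" if S: "S \<subseteq> ?V" "S \<noteq> {}" for S
    proof -
      have "{..<m} - S = {s} \<union> (?V - S)" using S s by auto
      then have "weight (A' i) S ({..<m} - S) = weight (A' i) S {s} + weight (A' i) S (?V - S)"
        by (simp add: weight_Un_right[of "{s}" "?V - S", simplified])
      also have "\<dots> = sum (c i) S + weight (A i) S (?V - S)"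
        using S weight_extend_at[OF S(1)] by (simp add: A'_def)
      finally show ?thesis
        using sparse_iff[of ?V "A i" r] deg[OF i] sp[OF i] S by (auto simp: c_def add.commute)
    qed
    fix S assume S: "S \<subseteq> {..<m}" "S \<noteq> {}" "S \<noteq> {..<m}"
    show "2 \<le> weight (A' i) S ({..<m} - S)"
    proof (cases "s \<in> S")
      case False
      then have "S \<subseteq> ?V" using S(1) s by (auto simp: less_Suc_eq)
      then show ?thesis using cut S(2) by blast
    next
      case True
      then have "{..<m} - S \<subseteq> ?V" "{..<m} - S \<noteq> {}" using S s by (auto simp: less_Suc_eq)
      then have "2 \<le> weight (A' i) ({..<m} - S) ({..<m} - ({..<m} - S))" by (rule cut)
      moreover have "{..<m} - ({..<m} - S) = S" using S(1) by auto
      ultimately show ?thesis using weight_commute[OF mul'] by metis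
    qed
  qed
  moreover have "(\<Sum>i\<in>{1..k}. A' i u v) = \<mu>" if uv: "u < m" "v < m" "u \<noteq> v" for u v
  proof -
    consider "u < s" "v < s" | "u < s" "v = s" | "u = s" "v < s"
      using uv s(1) by linarith
    then show ?thesis
      using A uv col by cases (auto simp: A'_def extend_at_def partial_factorization_def)
  qed
  ultimately show ?thesis by (intro exI[of _ A']) (auto simp: A'_def extend_at_def)
qed

lemma partial_factorization_complete:
  assumes "partial_factorization \<mu> r k m s A"
    and "r * k = \<mu> * (m - 1)" "even (r * m)" "2 \<le> r" "0 < s" "s < m"
  shows "\<exists>A'. (\<forall>i\<in>{1..k}. multiplicity (A' i) \<and> (\<forall>v<m. weight (A' i) {v} {..<m} = r) \<and>
      (\<forall>S\<subseteq>{..<m}. S \<noteq> {} \<longrightarrow> S \<noteq> {..<m} \<longrightarrow> 2 \<le> weight (A' i) S ({..<m} - S))) \<and>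
    (\<forall>u<m. \<forall>v<m. u \<noteq> v \<longrightarrow> (\<Sum>i\<in>{1..k}. A' i u v) = \<mu>) \<and>
    (\<forall>i. \<forall>u<s. \<forall>v<s. A' i u v = A i u v)"
  using assms
proof (induction "m - s" arbitrary: s A rule: less_induct)
  case less
  show ?case
  proof (cases "m = Suc s")
    case True
    then show ?thesis using partial_factorization_last less.prems by blast
  next
    case False
    then have s2: "s + 2 \<le> m" using less.prems by simp
    obtain B where B: "partial_factorization \<mu> r k m (Suc s) B"
      "\<forall>i. \<forall>u<s. \<forall>v<s. B i u v = A i u v"
      using partial_factorization_step[OF less.prems(1-4) s2] by blast
    have "m - Suc s < m - s" "0 < Suc s" "Suc s < m" using s2 by auto
    from less.hyps[OF this(1) B(1) less.prems(2-4) this(2,3)] obtain A' where A':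
      "\<forall>i\<in>{1..k}. multiplicity (A' i) \<and> (\<forall>v<m. weight (A' i) {v} {..<m} = r) \<and>
        (\<forall>S\<subseteq>{..<m}. S \<noteq> {} \<longrightarrow> S \<noteq> {..<m} \<longrightarrow> 2 \<le> weight (A' i) S ({..<m} - S))"
      "\<forall>u<m. \<forall>v<m. u \<noteq> v \<longrightarrow> (\<Sum>i\<in>{1..k}. A' i u v) = \<mu>"
      "\<forall>i. \<forall>u<Suc s. \<forall>v<Suc s. A' i u v = B i u v"
      by (elim exE conjE)
    have "\<forall>i. \<forall>u<s. \<forall>v<s. A' i u v = A i u v" using A'(3) B(2) by simp
    with A'(1,2) show ?thesis by (intro exI[of _ A'] conjI)
  qed
qed

section \<open>Adding edges\<close>

definition add_edge :: "('a \<Rightarrow> 'a \<Rightarrow> nat) \<Rightarrow> 'a \<Rightarrow> 'a \<Rightarrow> 'a \<Rightarrow> 'a \<Rightarrow> nat" where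
  "add_edge a u v x y =
     a x y + ((if x = u \<and> y = v then 1 else 0) + (if x = v \<and> y = u then 1 else 0))"

lemma multiplicity_add_edge:
  assumes "multiplicity a" "u \<noteq> v"
  shows "multiplicity (add_edge a u v)"
proof -
  have sym: "a x y = a y x" for x y using assms(1) unfolding multiplicity_def by metis
  have "add_edge a u v x y = add_edge a u v y x" for x y
    unfolding add_edge_def sym[of x y] by (simp add: conj_commute add.commute)
  moreover have "add_edge a u v x x = 0" for x
    using assms by (auto simp: add_edge_def multiplicity_def)
  ultimately show ?thesis unfolding multiplicity_def by blast
qed

lemma weight_add_edge:
  assumes "finite A" "finite B"
  shows "weight (add_edge a u v) A B = weight a A B +
    ((if u \<in> A \<and> v \<in> B then 1 else 0) + (if v \<in> A \<and> u \<in> B then 1 else 0))"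
proof -
  have delta: "(\<Sum>x\<in>A. \<Sum>y\<in>B. if x = p \<and> y = q then 1 else 0) = (if p \<in> A \<and> q \<in> B then 1 else 0 :: nat)"
    for p q
  proof -
    have "(\<Sum>y\<in>B. if x = p \<and> y = q then 1 else 0) = (if x = p then if q \<in> B then 1 else 0 else 0 :: nat)" for x
      using assms by simp
    then show ?thesis using assms by simp
  qed
  show ?thesis unfolding weight_def add_edge_def sum.distrib delta by simp
qed

section \<open>Colors that can take one more edge\<close>

lemma double_degree_le:
  assumes "finite V" "multiplicity a" "x \<in> V"
  shows "2 * weight a {x} V \<le> weight a V V"
proof -
  have "V = insert x (V - {x})" using assms by auto
  then have "weight a V V = weight a (V - {x}) (V - {x}) + 2 * weight a {x} (V - {x})"
    using weight_insert_self[of "V - {x}" x a] assms by simp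
  moreover have "weight a {x} V = weight a {x} {x} + weight a {x} (V - {x})"
    using weight_split_right[of V "{x}" a "{x}"] assms by simp
  moreover have "weight a {x} {x} = 0" using assms(2) by (simp add: weight_def multiplicity_def)
  ultimately show ?thesis by simp
qed

text \<open>A singleton spans nothing and \<open>2 \<le> r\<close>; for a larger \<open>S\<close>
  the bound \<open>r * card S\<close> is at least 2r, hence at least r + 2. An edge at
  \<open>x\<close> is counted from both ends in \<open>weight a V V\<close>, which gives the degree
  bound.\<close>

lemma sparse_of_few_edges:
  assumes V: "finite V" and a: "multiplicity a" and few: "weight a V V \<le> r" and r: "2 \<le> r"
  shows "sparse r V a"
  unfolding sparse_def
proof (intro conjI ballI allI impI)
  fix v assume "v \<in> V"
  then show "weight a {v} V \<le> r" using double_degree_le[OF V a] few by fastforce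
next
  fix S assume S: "S \<subseteq> V" "S \<noteq> {}"
  then have fin: "finite S" using V finite_subset by blast
  show "weight a S S + 2 \<le> r * card S"
  proof (cases "card S = 1")
    case True
    then obtain x where "S = {x}" by (auto simp: card_1_singleton_iff)
    then show ?thesis using a r by (simp add: weight_def multiplicity_def)
  next
    case False
    then have "2 \<le> card S" using S fin by (metis One_nat_def Suc_leI card_gt_0_iff le_neq_implies_less numeral_2_eq_2)
    then have "r * 2 \<le> r * card S" by simp
    moreover have "weight a S S \<le> weight a V V" using V S by (intro weight_mono) auto
    ultimately show ?thesis using few r by linarith
  qed
qed

text \<open>Only sets containing both \<open>u\<close> and \<open>v\<close> are affected, and for
  them a margin of 4 is required: 2 as before and 2 for the new edge. Bounding the edges inside
  \<open>S\<close> by degrees leaves a margin of r + 1, which suffices for r >= 3; for r = 2 parity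
  raises 3 to 4.\<close>

lemma sparse_add_edge:
  assumes V: "finite V" and a: "multiplicity a" and sp: "sparse r V a" and r: "2 \<le> r"
    and uv: "u \<in> V" "v \<in> V" "u \<noteq> v" and slack: "weight a {u} V + weight a {v} V < r"
  shows "sparse r V (add_edge a u v)"
  unfolding sparse_def
proof (intro conjI ballI allI impI)
  fix x assume "x \<in> V"
  then show "weight (add_edge a u v) {x} V \<le> r"
    using sp slack uv V by (auto simp: weight_add_edge sparse_def)
next
  fix S assume S: "S \<subseteq> V" "S \<noteq> {}"
  then have fin: "finite S" using V finite_subset by blast
  show "weight (add_edge a u v) S S + 2 \<le> r * card S"
  proof (cases "u \<in> S \<and> v \<in> S")
    case False
    then show ?thesis using sp S fin by (auto simp: weight_add_edge sparse_def)
  next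
    case True
    then have card: "card S = card (S - {u, v}) + 2"
      using uv(3) card_Diff_subset[of "{u, v}" S] card_mono[OF fin, of "{u, v}"] by simp
    have "weight a S S \<le> weight a S V" using V S fin by (intro weight_mono) auto
    also have "\<dots> = (\<Sum>x\<in>S - {u, v}. weight a {x} V) + (\<Sum>x\<in>{u, v}. weight a {x} V)"
      unfolding weight_degrees[of a S] using True fin by (intro sum.subset_diff) auto
    also have "(\<Sum>x\<in>S - {u, v}. weight a {x} V) \<le> (\<Sum>x\<in>S - {u, v}. r)"
      using sp S by (intro sum_mono) (auto simp: sparse_def)
    finally have le: "weight a S S + r + 1 \<le> r * card S"
      using slack uv(3) by (simp add: card algebra_simps)
    have "weight a S S + 4 \<le> r * card S"
    proof (cases "r = 2")
      case True
      obtain z where "weight a S S = 2 * z" using even_weight_self[OF a, of S] by (elim evenE)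
      moreover from this have "2 * z + 3 \<le> 2 * card S" using le True by simp
      then have "2 * z + 4 \<le> 2 * card S" by presburger
      ultimately show ?thesis using True by simp
    qed (use le r in linarith)
    then show ?thesis using True fin by (simp add: weight_add_edge)
  qed
qed

section \<open>Filling the pairs of old vertices\<close>

definition color_family ::
  "nat \<Rightarrow> nat \<Rightarrow> nat \<Rightarrow> nat \<Rightarrow> (nat \<Rightarrow> nat \<Rightarrow> nat \<Rightarrow> nat) \<Rightarrow> bool" where
  "color_family \<mu> r k n A \<longleftrightarrow> (\<forall>i\<in>{1..k}. multiplicity (A i) \<and> sparse r {..<n} (A i)) \<and>
     (\<forall>u<n. \<forall>v<n. u \<noteq> v \<longrightarrow> (\<Sum>i\<in>{1..k}. A i u v) \<le> \<mu>)"

text \<open>Each edge counts twice, so all pairs are full when this reaches \<mu>n(n - 1).\<close>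

definition total :: "nat \<Rightarrow> nat \<Rightarrow> (nat \<Rightarrow> nat \<Rightarrow> nat \<Rightarrow> nat) \<Rightarrow> nat" where
  "total k n A = (\<Sum>i\<in>{1..k}. weight (A i) {..<n} {..<n})"

lemma total_eq: "total k n A = (\<Sum>u<n. \<Sum>v<n. \<Sum>i\<in>{1..k}. A i u v)"
proof -
  have "total k n A = (\<Sum>u<n. \<Sum>i\<in>{1..k}. \<Sum>v<n. A i u v)"
    unfolding total_def weight_def by (rule sum.swap)
  also have "\<dots> = (\<Sum>u<n. \<Sum>v<n. \<Sum>i\<in>{1..k}. A i u v)"
    by (intro sum.cong refl sum.swap)
  finally show ?thesis .
qed

lemma sum_off_diagonal: "(\<Sum>u<n. \<Sum>v<n. if u = v then 0 else x) = x * (n * (n - 1))" for n x :: nat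
proof -
  have "(\<Sum>v<n. if u = v then 0 else x) = x * (n - 1)" if "u < n" for u
  proof -
    have "(\<Sum>v<n. if u = v then 0 else x) = (\<Sum>v\<in>{..<n} - {u}. if u = v then 0 else x)"
      by (rule sum.mono_neutral_right) auto
    also have "\<dots> = (\<Sum>v\<in>{..<n} - {u}. x)" by (intro sum.cong) auto
    finally show ?thesis using that by (simp add: mult.commute)
  qed
  then have "(\<Sum>u<n. \<Sum>v<n. if u = v then 0 else x) = (\<Sum>u<n. x * (n - 1))"
    by (intro sum.cong) auto
  then show ?thesis by (simp add: mult.left_commute mult.commute)
qed

lemma color_family_diagonal:
  "color_family \<mu> r k n A \<Longrightarrow> (\<Sum>i\<in>{1..k}. A i u u) = 0"
  by (simp add: color_family_def multiplicity_def)

lemma total_le: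
  assumes "color_family \<mu> r k n A"
  shows "total k n A \<le> \<mu> * (n * (n - 1))"
proof -
  have "total k n A \<le> (\<Sum>u<n. \<Sum>v<n. if u = v then 0 else \<mu>)"
    unfolding total_eq using assms color_family_diagonal[OF assms]
    by (intro sum_mono) (auto simp: color_family_def)
  then show ?thesis by (simp only: sum_off_diagonal)
qed

lemma missing_pair:
  assumes A: "color_family \<mu> r k n A" and "total k n A < \<mu> * (n * (n - 1))"
  shows "\<exists>u<n. \<exists>v<n. u \<noteq> v \<and> (\<Sum>i\<in>{1..k}. A i u v) < \<mu>"
proof (rule ccontr)
  assume "\<not> ?thesis"
  then have "\<mu> \<le> (\<Sum>i\<in>{1..k}. A i u v)" if "u < n" "v < n" "u \<noteq> v" for u v
    using that not_less by blast
  then have "(\<Sum>u<n. \<Sum>v<n. if u = v then 0 else \<mu>) \<le> total k n A"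
    unfolding total_eq by (intro sum_mono) simp
  then show False using assms(2) by (simp only: sum_off_diagonal)
qed

lemma color_family_add_edge:
  assumes A: "color_family \<mu> r k n A" and i: "i \<in> {1..k}"
    and uv: "u < n" "v < n" "u \<noteq> v" "(\<Sum>j\<in>{1..k}. A j u v) < \<mu>"
    and sp: "sparse r {..<n} (add_edge (A i) u v)"
  shows "color_family \<mu> r k n (A(i := add_edge (A i) u v))"
    and "total k n (A(i := add_edge (A i) u v)) = total k n A + 2"
proof -
  let ?B = "A(i := add_edge (A i) u v)"
  have up: "(\<Sum>j\<in>{1..k}. f (?B j)) = f (add_edge (A i) u v) + (\<Sum>j\<in>{1..k} - {i}. f (A j))"
    for f :: "(nat \<Rightarrow> nat \<Rightarrow> nat) \<Rightarrow> nat"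
    using i by (simp add: sum.remove[of _ i])
  have old: "(\<Sum>j\<in>{1..k}. f (A j)) = f (A i) + (\<Sum>j\<in>{1..k} - {i}. f (A j))"
    for f :: "(nat \<Rightarrow> nat \<Rightarrow> nat) \<Rightarrow> nat"
    using i by (simp add: sum.remove[of _ i])
  have sym: "A j x y = A j y x" if "j \<in> {1..k}" for j x y
    using A that unfolding color_family_def multiplicity_def by metis
  have vu: "(\<Sum>j\<in>{1..k}. A j v u) < \<mu>"
  proof -
    have "(\<Sum>j\<in>{1..k}. A j v u) = (\<Sum>j\<in>{1..k}. A j u v)" by (intro sum.cong refl sym)
    then show ?thesis using uv(4) by simp
  qed
  have "(\<Sum>j\<in>{1..k}. ?B j x y) \<le> \<mu>" if xy: "x < n" "y < n" "x \<noteq> y" for x y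
  proof -
    have "(\<Sum>j\<in>{1..k}. ?B j x y) = (\<Sum>j\<in>{1..k}. A j x y) +
        ((if x = u \<and> y = v then 1 else 0) + (if x = v \<and> y = u then 1 else 0))"
      unfolding up[of "\<lambda>a. a x y"] old[of "\<lambda>a. a x y"] by (simp add: add_edge_def)
    moreover have "(\<Sum>j\<in>{1..k}. A j x y) \<le> \<mu>" using A xy unfolding color_family_def by blast
    ultimately show ?thesis using uv vu by (auto simp: Suc_le_eq)
  qed
  moreover have "multiplicity (?B j) \<and> sparse r {..<n} (?B j)" if "j \<in> {1..k}" for j
    using that A sp uv(3) multiplicity_add_edge[of "A i" u v] unfolding color_family_def by (cases "j = i") auto
  ultimately show "color_family \<mu> r k n ?B" unfolding color_family_def by blast
  show "total k n ?B = total k n A + 2"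
    unfolding total_def up[of "\<lambda>a. weight a {..<n} {..<n}"] old[of "\<lambda>a. weight a {..<n} {..<n}"]
    using uv by (simp add: weight_add_edge)
qed

lemma add_edge_ge: "a x y \<le> add_edge a u v x y"
  by (simp add: add_edge_def)

text \<open>Giving a missing edge to a color below \<open>q\<close> lowers the sum of shortfalls by
  2 and raises \<open>total\<close> by 2, so their sum stays within the bound; as long as there is a
  shortfall, a pair with a missing edge exists. Since \<open>q\<close> is even, a color below it is
  at least 2 below, so it never overshoots \<open>q \<le> r\<close> and remains sparse by
  \<open>sparse_of_few_edges\<close>.\<close>

lemma raise_small_colors:
  assumes "color_family \<mu> r k n A" "2 \<le> r" "q \<le> r" "even q"
    and "(\<Sum>i\<in>{1..k}. q - weight (A i) {..<n} {..<n}) + total k n A \<le> \<mu> * (n * (n - 1))"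
  shows "\<exists>B. color_family \<mu> r k n B \<and> (\<forall>i. \<forall>u v. A i u v \<le> B i u v) \<and>
    (\<forall>i\<in>{1..k}. q \<le> weight (B i) {..<n} {..<n})"
  using assms
proof (induction "\<mu> * (n * (n - 1)) - total k n A" arbitrary: A rule: less_induct)
  case less
  note A = less.prems(1) and r = less.prems(2)
  show ?case
  proof (cases "\<forall>i\<in>{1..k}. q \<le> weight (A i) {..<n} {..<n}")
    case True
    then show ?thesis using A by (intro exI[of _ A]) auto
  next
    case False
    then obtain i where i: "i \<in> {1..k}" "weight (A i) {..<n} {..<n} < q" by auto
    have mul: "multiplicity (A i)" using A i by (auto simp: color_family_def)
    have two: "weight (A i) {..<n} {..<n} + 2 \<le> q"
    proof -
      obtain x y where "weight (A i) {..<n} {..<n} = 2 * x" "q = 2 * y"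
        using even_weight_self[OF mul] less.prems(4) by (metis evenE)
      then show ?thesis using i(2) by simp
    qed
    have "q - weight (A i) {..<n} {..<n} \<le> (\<Sum>i\<in>{1..k}. q - weight (A i) {..<n} {..<n})"
      using i by (intro member_le_sum) auto
    then have lt: "total k n A < \<mu> * (n * (n - 1))" using less.prems(5) i(2) by linarith
    obtain u v where uv: "u < n" "v < n" "u \<noteq> v" "(\<Sum>j\<in>{1..k}. A j u v) < \<mu>"
      using missing_pair[OF A lt] by blast
    let ?a = "add_edge (A i) u v"
    have wt: "weight ?a {..<n} {..<n} = weight (A i) {..<n} {..<n} + 2"
      using uv by (simp add: weight_add_edge)
    have sp: "sparse r {..<n} ?a"
      using multiplicity_add_edge[OF mul uv(3)] wt two less.prems(3) r
      by (intro sparse_of_few_edges) auto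
    note B = color_family_add_edge[OF A i(1) uv sp]
    let ?B = "A(i := ?a)"
    have "(\<Sum>j\<in>{1..k}. q - weight (?B j) {..<n} {..<n}) + 2 =
        (\<Sum>j\<in>{1..k}. q - weight (A j) {..<n} {..<n})"
      using i two wt by (simp add: sum.remove[of _ i])
    then have "(\<Sum>j\<in>{1..k}. q - weight (?B j) {..<n} {..<n}) + total k n ?B \<le> \<mu> * (n * (n - 1))"
      using less.prems(5) B(2) by linarith
    moreover have "\<mu> * (n * (n - 1)) - total k n ?B < \<mu> * (n * (n - 1)) - total k n A"
      using lt B(2) by linarith
    ultimately obtain C where C: "color_family \<mu> r k n C" "\<forall>j. \<forall>x y. ?B j x y \<le> C j x y"
      "\<forall>j\<in>{1..k}. q \<le> weight (C j) {..<n} {..<n}"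
      using less.hyps[of ?B] B(1) less.prems(2-4) by (elim meta_impE) auto
    have "A j x y \<le> ?B j x y" for j x y by (simp add: add_edge_ge)
    then have "\<forall>j. \<forall>x y. A j x y \<le> C j x y" using C(2) order_trans by blast
    then show ?thesis using C by blast
  qed
qed

text \<open>Because the pair itself is not full, both ends have total degree strictly below \<mu>(n
  - 1). This strictness is what covers the boundary case m = 2n - 1.\<close>

lemma color_with_slack:
  assumes A: "color_family \<mu> r k n A" and uv: "u < n" "v < n" "u \<noteq> v" "(\<Sum>i\<in>{1..k}. A i u v) < \<mu>"
    and rk: "r * k = \<mu> * (m - 1)" and m: "2 * n - 1 \<le> m"
  shows "\<exists>i\<in>{1..k}. weight (A i) {u} {..<n} + weight (A i) {v} {..<n} < r"
proof (rule ccontr)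
  assume "\<not> ?thesis"
  then have "(\<Sum>i\<in>{1..k}. r) \<le> (\<Sum>i\<in>{1..k}. weight (A i) {u} {..<n} + weight (A i) {v} {..<n})"
    by (intro sum_mono) (auto simp: not_less)
  moreover have deg: "(\<Sum>i\<in>{1..k}. weight (A i) {x} {..<n}) < \<mu> * (n - 1)"
    if xy: "x < n" "y < n" "x \<noteq> y" "(\<Sum>i\<in>{1..k}. A i x y) < \<mu>" for x y
  proof -
    have "(\<Sum>i\<in>{1..k}. weight (A i) {x} {..<n}) = (\<Sum>z<n. \<Sum>i\<in>{1..k}. A i x z)"
      unfolding weight_def by simp (rule sum.swap)
    also have "\<dots> = (\<Sum>z\<in>{..<n} - {x}. \<Sum>i\<in>{1..k}. A i x z)"
      using xy color_family_diagonal[OF A, of x] by (subst sum.remove[of _ x]) auto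
    also have "\<dots> < (\<Sum>z\<in>{..<n} - {x}. \<mu>)"
      using A xy unfolding color_family_def
      by (intro sum_strict_mono_ex1) (auto intro!: bexI[of _ y])
    finally show ?thesis using xy by (simp add: mult.commute)
  qed
  have vu: "(\<Sum>i\<in>{1..k}. A i v u) < \<mu>"
  proof -
    have "(\<Sum>i\<in>{1..k}. A i v u) = (\<Sum>i\<in>{1..k}. A i u v)"
      using A unfolding color_family_def multiplicity_def by (intro sum.cong refl) blast
    then show ?thesis using uv(4) by simp
  qed
  moreover have "(\<Sum>i\<in>{1..k}. weight (A i) {u} {..<n}) < \<mu> * (n - 1)"
    "(\<Sum>i\<in>{1..k}. weight (A i) {v} {..<n}) < \<mu> * (n - 1)"
    using deg[OF uv] deg[OF uv(2,1) _ vu] uv(3) by auto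
  ultimately have "r * k < 2 * (\<mu> * (n - 1))"
    unfolding sum.distrib by (simp add: mult.commute)
  moreover have "\<mu> * (2 * (n - 1)) \<le> \<mu> * (m - 1)"
    using m by (intro mult_le_mono2) linarith
  ultimately show False using rk by (simp add: mult.left_commute)
qed

lemma fill_old_pairs:
  assumes "color_family \<mu> r k n A" "2 \<le> r" "r * k = \<mu> * (m - 1)" "2 * n - 1 \<le> m"
  shows "\<exists>B. color_family \<mu> r k n B \<and> (\<forall>i. \<forall>u v. A i u v \<le> B i u v) \<and>
    (\<forall>u<n. \<forall>v<n. u \<noteq> v \<longrightarrow> (\<Sum>i\<in>{1..k}. B i u v) = \<mu>)"
  using assms(1)
proof (induction "\<mu> * (n * (n - 1)) - total k n A" arbitrary: A rule: less_induct)
  case less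
  note A = less.prems
  show ?case
  proof (cases "\<forall>u<n. \<forall>v<n. u \<noteq> v \<longrightarrow> (\<Sum>i\<in>{1..k}. A i u v) = \<mu>")
    case True
    then show ?thesis using A by (intro exI[of _ A]) auto
  next
    case False
    then obtain u v where uv: "u < n" "v < n" "u \<noteq> v" "(\<Sum>i\<in>{1..k}. A i u v) < \<mu>"
      using A unfolding color_family_def by (meson order_le_imp_less_or_eq)
    obtain i where i: "i \<in> {1..k}" "weight (A i) {u} {..<n} + weight (A i) {v} {..<n} < r"
      using color_with_slack[OF A uv assms(3,4)] by blast
    have "sparse r {..<n} (add_edge (A i) u v)"
      using A i uv assms(2) by (intro sparse_add_edge) (auto simp: color_family_def)
    note B = color_family_add_edge[OF A i(1) uv this]
    let ?B = "A(i := add_edge (A i) u v)"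
    have "\<mu> * (n * (n - 1)) - total k n ?B < \<mu> * (n * (n - 1)) - total k n A"
      using total_le[OF B(1)] B(2) by linarith
    then obtain C where C: "color_family \<mu> r k n C" "\<forall>j. \<forall>x y. ?B j x y \<le> C j x y"
      "\<forall>x<n. \<forall>y<n. x \<noteq> y \<longrightarrow> (\<Sum>j\<in>{1..k}. C j x y) = \<mu>"
      using less.hyps[of ?B] B(1) by (elim meta_impE) auto
    have "A j x y \<le> ?B j x y" for j x y by (simp add: add_edge_ge)
    then have "\<forall>j. \<forall>x y. A j x y \<le> C j x y" using C(2) order_trans by blast
    then show ?thesis using C by blast
  qed
qed

lemma color_family_to_partial_factorization:
  assumes A: "color_family \<mu> r k n A" and r: "2 \<le> r" and rk: "r * k = \<mu> * (m - 1)"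
    and m: "2 * n - 1 \<le> m" "n \<le> m" and ev: "even (r * m)"
    and small: "(\<Sum>i\<in>{1..k}. (2 * r * n - r * m) - weight (A i) {..<n} {..<n}) + total k n A
      \<le> \<mu> * (n * (n - 1))"
  shows "\<exists>B. partial_factorization \<mu> r k m n B \<and> (\<forall>i. \<forall>u v. A i u v \<le> B i u v)"
proof -
  \<comment> \<open>This is 2p cut off at 0; it is compared with \<open>weight\<close>, which counts
    every edge twice.\<close>
  define q where "q = 2 * r * n - r * m"
  have "r * (2 * n) \<le> r * (m + 1)" using m by (intro mult_le_mono2) linarith
  then have "q \<le> r" unfolding q_def by (simp add: algebra_simps)
  moreover have "even q" unfolding q_def using ev by simp
  ultimately obtain B where B: "color_family \<mu> r k n B" "\<forall>i. \<forall>u v. A i u v \<le> B i u v"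
    "\<forall>i\<in>{1..k}. q \<le> weight (B i) {..<n} {..<n}"
    using raise_small_colors[OF A r, of q] small by (auto simp: q_def)
  obtain C where C: "color_family \<mu> r k n C" "\<forall>i. \<forall>u v. B i u v \<le> C i u v"
    "\<forall>u<n. \<forall>v<n. u \<noteq> v \<longrightarrow> (\<Sum>i\<in>{1..k}. C i u v) = \<mu>"
    using fill_old_pairs[OF B(1) r rk m(1)] by blast
  \<comment> \<open>The total deficit is rn minus the weight, hence at most rn - q, and q was chosen
    to make this at most r(m - n).\<close>
  have "sum (deficit r {..<n} (C i)) {..<n} \<le> r * (m - n)" if i: "i \<in> {1..k}" for i
  proof -
    have "weight (B i) {..<n} {..<n} \<le> weight (C i) {..<n} {..<n}"
      unfolding weight_def using C(2) by (intro sum_mono) auto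
    then have "q \<le> weight (C i) {..<n} {..<n}" using B(3) i by fastforce
    moreover have "sum (deficit r {..<n} (C i)) {..<n} + weight (C i) {..<n} {..<n} = r * n"
      using sum_deficit[of "{..<n}" "{..<n}" "C i" r] C(1) i
      by (auto simp: color_family_def sparse_def)
    moreover have "r * (m - n) + r * n = r * m" using m(2) by (simp flip: add_mult_distrib2)
    ultimately show ?thesis unfolding q_def by linarith
  qed
  then have "partial_factorization \<mu> r k m n C"
    using C unfolding partial_factorization_def color_family_def by blast
  moreover have "\<forall>i. \<forall>u v. A i u v \<le> C i u v" using B(2) C(2) order_trans by blast
  ultimately show ?thesis by blast
qed

section \<open>Cuts, components and bridges of multigraphs\<close>

definition mult :: "'v mgraph \<Rightarrow> 'v \<Rightarrow> 'v \<Rightarrow> nat" where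
  "mult G u v = card {e \<in> edges G. fst e = {u, v}}"

definition cutset :: "'v mgraph \<Rightarrow> 'v set \<Rightarrow> 'v edge set" where
  "cutset G S = {e \<in> edges G. \<exists>u\<in>S. \<exists>v\<in>verts G - S. fst e = {u, v}}"

lemma multigraphD:
  assumes "multigraph G"
  shows "finite (verts G)" "finite (edges G)"
    "\<And>e. e \<in> edges G \<Longrightarrow> fst e \<subseteq> verts G" "\<And>e. e \<in> edges G \<Longrightarrow> card (fst e) = 2"
  using assms unfolding multigraph_def by blast+

lemma multiplicity_mult:
  assumes "multigraph G"
  shows "multiplicity (mult G)"
proof -
  have "mult G u v = mult G v u" for u v by (simp add: mult_def insert_commute)
  moreover have "mult G u u = 0" for u
  proof -
    have "{e \<in> edges G. fst e = {u, u}} = {}" using multigraphD(4)[OF assms] by fastforce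
    then show ?thesis unfolding mult_def by (simp only: card.empty)
  qed
  ultimately show ?thesis unfolding multiplicity_def by blast
qed

text \<open>Injectivity ensures that no edge is met in both orders of its ends. It holds for a set
  against its complement and for one vertex against all; for all vertices against all it fails, and
  \<open>weight_mult_edges\<close> has a factor 2 instead.\<close>

lemma weight_mult:
  assumes G: "multigraph G" and fin: "finite A" "finite B"
    and inj: "inj_on (\<lambda>(u, v). {u, v}) (A \<times> B)"
  shows "weight (mult G) A B = card {e \<in> edges G. \<exists>u\<in>A. \<exists>v\<in>B. fst e = {u, v}}"
proof -
  let ?E = "\<lambda>p. {e \<in> edges G. fst e = (case p of (u, v) \<Rightarrow> {u, v})}"
  have "weight (mult G) A B = (\<Sum>p\<in>A \<times> B. card (?E p))"
    unfolding weight_def mult_def by (subst sum.cartesian_product) (auto intro: sum.cong)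
  also have "\<dots> = card (\<Union>p\<in>A \<times> B. ?E p)"
  proof (rule card_UN_disjoint[symmetric])
    show "\<forall>p\<in>A \<times> B. \<forall>q\<in>A \<times> B. p \<noteq> q \<longrightarrow> ?E p \<inter> ?E q = {}"
      using inj unfolding inj_on_def by fastforce
  qed (use fin multigraphD(2)[OF G] in auto)
  also have "(\<Union>p\<in>A \<times> B. ?E p) = {e \<in> edges G. \<exists>u\<in>A. \<exists>v\<in>B. fst e = {u, v}}" by auto
  finally show ?thesis .
qed

lemma weight_mult_cut:
  assumes "multigraph G" "S \<subseteq> verts G"
  shows "weight (mult G) S (verts G - S) = card (cutset G S)"
  unfolding cutset_def
proof (rule weight_mult[OF assms(1)])
  show "finite S" "finite (verts G - S)"
    using multigraphD(1)[OF assms(1)] assms(2) finite_subset by auto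
  show "inj_on (\<lambda>(u, v). {u, v}) (S \<times> (verts G - S))"
    by (auto simp: inj_on_def doubleton_eq_iff)
qed

lemma weight_mult_degree:
  assumes "multigraph G"
  shows "weight (mult G) {v} (verts G) = degree G v"
proof -
  have "weight (mult G) {v} (verts G) = card {e \<in> edges G. \<exists>u\<in>{v}. \<exists>w\<in>verts G. fst e = {u, w}}"
    using multigraphD(1)[OF assms]
    by (intro weight_mult[OF assms]) (auto simp: inj_on_def doubleton_eq_iff)
  also have "{e \<in> edges G. \<exists>u\<in>{v}. \<exists>w\<in>verts G. fst e = {u, w}} = {e \<in> edges G. v \<in> fst e}"
  proof -
    have "\<exists>w\<in>verts G. fst e = {v, w}" if e: "e \<in> edges G" "v \<in> fst e" for e
    proof -
      obtain x y where "fst e = {x, y}" using multigraphD(4)[OF assms e(1)] by (auto simp: card_2_iff)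
      then show ?thesis using e multigraphD(3)[OF assms e(1)] by (auto simp: insert_commute)
    qed
    then show ?thesis by auto
  qed
  finally show ?thesis by (simp add: degree_def)
qed

lemma weight_mult_edges:
  assumes "multigraph G"
  shows "weight (mult G) (verts G) (verts G) = 2 * card (edges G)"
proof -
  note m = multigraphD[OF assms]
  have "weight (mult G) (verts G) (verts G) = (\<Sum>v\<in>verts G. degree G v)"
    using weight_degrees[of "mult G" "verts G" "verts G"] weight_mult_degree[OF assms] by simp
  also have "\<dots> = (\<Sum>v\<in>verts G. \<Sum>e\<in>edges G. if v \<in> fst e then 1 else 0)"
    unfolding degree_def using m(2) by (intro sum.cong refl) (simp add: sum.If_cases Int_def)
  also have "\<dots> = (\<Sum>e\<in>edges G. \<Sum>v\<in>verts G. if v \<in> fst e then 1 else 0)" by (rule sum.swap)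
  also have "\<dots> = (\<Sum>e\<in>edges G. 2)"
  proof (intro sum.cong refl)
    fix e assume e: "e \<in> edges G"
    have "(\<Sum>v\<in>verts G. if v \<in> fst e then 1 else 0) = card (verts G \<inter> fst e)"
      using m(1) by (simp add: sum.If_cases Int_def)
    also have "verts G \<inter> fst e = fst e" using m(3)[OF e] by blast
    finally show "(\<Sum>v\<in>verts G. if v \<in> fst e then 1 else 0) = (2 :: nat)" using m(4)[OF e] by simp
  qed
  finally show ?thesis by simp
qed

section \<open>Connectivity expressed by cuts\<close>

lemma adjacency_sym: "(u, v) \<in> adjacency G \<longleftrightarrow> (v, u) \<in> adjacency G"
  by (simp add: adjacency_def insert_commute)

lemma reachable_sym: "(u, v) \<in> (adjacency G)\<^sup>* \<Longrightarrow> (v, u) \<in> (adjacency G)\<^sup>*"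
  by (metis adjacency_sym symI sym_rtrancl symD)

lemma reachable_stays:
  assumes G: "multigraph G" and cut: "cutset G S = {}" and "(u, v) \<in> (adjacency G)\<^sup>*" "u \<in> S"
  shows "v \<in> S"
  using assms(3,4)
proof (induction rule: rtrancl_induct)
  case (step x y)
  then obtain e where e: "e \<in> edges G" "fst e = {x, y}" by (auto simp: adjacency_def)
  then have "y \<in> verts G" using multigraphD(3)[OF G] by blast
  then show ?case using cut e step unfolding cutset_def by blast
qed

lemma connected_mgraphI:
  assumes "v \<in> verts G" "\<And>u. u \<in> verts G \<Longrightarrow> (v, u) \<in> (adjacency G)\<^sup>*"
  shows "connected_mgraph G"
  unfolding connected_mgraph_def
proof (intro conjI ballI)
  show "verts G \<noteq> {}" using assms(1) by blast
  fix u w assume "u \<in> verts G" "w \<in> verts G"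
  then show "(u, w) \<in> (adjacency G)\<^sup>*"
    using reachable_sym[OF assms(2)] assms(2) by (meson rtrancl_trans)
qed

lemma connected_mgraph_iff:
  assumes G: "multigraph G"
  shows "connected_mgraph G \<longleftrightarrow> verts G \<noteq> {} \<and>
    (\<forall>S\<subseteq>verts G. S \<noteq> {} \<longrightarrow> S \<noteq> verts G \<longrightarrow> cutset G S \<noteq> {})"
proof
  assume c: "connected_mgraph G"
  have "cutset G S \<noteq> {}" if S: "S \<subseteq> verts G" "S \<noteq> {}" "S \<noteq> verts G" for S
  proof
    assume "cutset G S = {}"
    moreover obtain u v where "u \<in> S" "v \<in> verts G - S" using S by blast
    moreover have "(u, v) \<in> (adjacency G)\<^sup>*"
      using c calculation S(1) unfolding connected_mgraph_def by blast
    ultimately show False using reachable_stays[OF G] by blast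
  qed
  then show "verts G \<noteq> {} \<and> (\<forall>S\<subseteq>verts G. S \<noteq> {} \<longrightarrow> S \<noteq> verts G \<longrightarrow> cutset G S \<noteq> {})"
    using c by (auto simp: connected_mgraph_def)
next
  assume c: "verts G \<noteq> {} \<and> (\<forall>S\<subseteq>verts G. S \<noteq> {} \<longrightarrow> S \<noteq> verts G \<longrightarrow> cutset G S \<noteq> {})"
  then obtain v where v: "v \<in> verts G" by blast
  define S where "S = {u \<in> verts G. (v, u) \<in> (adjacency G)\<^sup>*}"
  have "cutset G S = {}"
  proof (rule ccontr)
    assume "cutset G S \<noteq> {}"
    then obtain e x y where e: "e \<in> edges G" "x \<in> S" "y \<in> verts G - S" "fst e = {x, y}"
      unfolding cutset_def by blast
    then have "(x, y) \<in> adjacency G" by (auto simp: adjacency_def)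
    then show False using e by (auto simp: S_def dest: rtrancl_into_rtrancl)
  qed
  moreover have "v \<in> S" using v by (simp add: S_def)
  moreover have "S \<subseteq> verts G" by (auto simp: S_def)
  ultimately have "S = verts G" using c by blast
  then show "connected_mgraph G" using v by (intro connected_mgraphI[of v]) (auto simp: S_def)
qed

lemma multigraph_delete_edge: "multigraph G \<Longrightarrow> multigraph (delete_edge G e)"
  by (auto simp: multigraph_def delete_edge_def)

lemma cutset_delete_edge: "cutset (delete_edge G e) S = cutset G S - {e}"
  by (auto simp: cutset_def delete_edge_def)

text \<open>Deleting \<open>e\<close> takes at most \<open>e\<close> away from a cut, so a cut
  survives the deletion of any one of its edges just when it has another one.\<close>

lemma two_edge_connected_iff:
  assumes G: "multigraph G"
  shows "two_edge_connected G \<longleftrightarrow> verts G \<noteq> {} \<and>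
    (\<forall>S\<subseteq>verts G. S \<noteq> {} \<longrightarrow> S \<noteq> verts G \<longrightarrow> 2 \<le> card (cutset G S))"
proof -
  have fin: "finite (cutset G S)" for S
    using multigraphD(2)[OF G] by (auto simp: cutset_def)
  have del: "verts (delete_edge G e) = verts G" for e by (simp add: delete_edge_def)
  show ?thesis
  proof (intro iffI conjI allI impI)
    assume tec: "two_edge_connected G"
    then have c: "connected_mgraph G" by (simp add: two_edge_connected_def)
    then show "verts G \<noteq> {}" by (simp add: connected_mgraph_def)
    fix S assume S: "S \<subseteq> verts G" "S \<noteq> {}" "S \<noteq> verts G"
    then obtain e where e: "e \<in> cutset G S" using c connected_mgraph_iff[OF G] by blast
    then have "connected_mgraph (delete_edge G e)"
      using tec by (simp add: two_edge_connected_def cutset_def)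
    then have "cutset (delete_edge G e) S \<noteq> {}"
      using S connected_mgraph_iff[OF multigraph_delete_edge[OF G], of e] unfolding del by blast
    then obtain f where f: "f \<in> cutset G S" "f \<noteq> e" unfolding cutset_delete_edge by blast
    have "card {e, f} \<le> card (cutset G S)" using e f fin by (intro card_mono) auto
    then show "2 \<le> card (cutset G S)" using f by simp
  next
    assume R: "verts G \<noteq> {} \<and> (\<forall>S\<subseteq>verts G. S \<noteq> {} \<longrightarrow> S \<noteq> verts G \<longrightarrow> 2 \<le> card (cutset G S))"
    have cut: "cutset G S - {e} \<noteq> {}" if "S \<subseteq> verts G" "S \<noteq> {}" "S \<noteq> verts G" for S e
    proof
      assume "cutset G S - {e} = {}"
      then have "card (cutset G S) \<le> card {e}" by (intro card_mono) auto
      moreover have "2 \<le> card (cutset G S)" using R that by blast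
      ultimately show False by simp
    qed
    have "connected_mgraph (delete_edge G e)" for e
      unfolding connected_mgraph_iff[OF multigraph_delete_edge[OF G]] del cutset_delete_edge
      using R by (intro conjI allI impI cut) blast+
    moreover have "connected_mgraph G"
      unfolding connected_mgraph_iff[OF G]
    proof (intro conjI allI impI)
      fix S assume "S \<subseteq> verts G" "S \<noteq> {}" "S \<noteq> verts G"
      \<comment> \<open>\<open>undefined\<close> stands for an arbitrary edge: if something is left
        after its removal, the cut was not empty.\<close>
      then show "cutset G S \<noteq> {}" using cut[of S undefined] by force
    qed (use R in blast)
    ultimately show "two_edge_connected G" by (simp add: two_edge_connected_def)
  qed
qed

text \<open>\<open>conn_components\<close> is defined by maximality, which produces no component;
  this is the explicit one around a given vertex.\<close>

definition component_of :: "'v mgraph \<Rightarrow> 'v \<Rightarrow> 'v mgraph" where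
  "component_of G v = \<lparr>verts = {u \<in> verts G. (v, u) \<in> (adjacency G)\<^sup>*},
     edges = {e \<in> edges G. fst e \<subseteq> {u \<in> verts G. (v, u) \<in> (adjacency G)\<^sup>*}}\<rparr>"

lemma component_of:
  assumes G: "multigraph G" and v: "v \<in> verts G"
  shows "component_of G v \<in> conn_components G" "v \<in> verts (component_of G v)"
proof -
  let ?C = "component_of G v"
  show vC: "v \<in> verts ?C" using v by (simp add: component_of_def)
  have sub: "subgraph ?C G"
    using multigraphD[OF G] G by (auto simp: subgraph_def multigraph_def component_of_def)
  have reach: "(v, u) \<in> (adjacency ?C)\<^sup>*" if "(v, u) \<in> (adjacency G)\<^sup>*" for u
    using that
  proof (induction rule: rtrancl_induct)
    case (step x y)
    then obtain e where e: "e \<in> edges G" "fst e = {x, y}" by (auto simp: adjacency_def)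
    have "(v, y) \<in> (adjacency G)\<^sup>*" using step by (meson rtrancl_into_rtrancl)
    then have "e \<in> edges ?C"
      using e step multigraphD(3)[OF G e(1)] by (simp add: component_of_def)
    then have "(x, y) \<in> adjacency ?C" using e by (auto simp: adjacency_def)
    then show ?case using step by (meson rtrancl_into_rtrancl)
  qed simp
  have "connected_mgraph ?C"
    using vC reach by (intro connected_mgraphI[of v]) (auto simp: component_of_def)
  moreover have "D = ?C" if D: "subgraph D G" "connected_mgraph D" "subgraph ?C D" for D
  proof -
    have sD: "verts D \<subseteq> verts G" "edges D \<subseteq> edges G" "verts ?C \<subseteq> verts D" "edges ?C \<subseteq> edges D"
      "multigraph D"
      using D by (auto simp: subgraph_def)
    have "adjacency D \<subseteq> adjacency G" using sD(2) by (auto simp: adjacency_def)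
    then have "(adjacency D)\<^sup>* \<subseteq> (adjacency G)\<^sup>*" by (rule rtrancl_mono)
    moreover have "(v, u) \<in> (adjacency D)\<^sup>*" if "u \<in> verts D" for u
      using D(2) that vC sD(3) unfolding connected_mgraph_def by blast
    ultimately have vD: "verts D \<subseteq> verts ?C" using sD(1) by (auto simp: component_of_def)
    then have "edges D \<subseteq> edges ?C"
      using sD(2) multigraphD(3)[OF sD(5)] by (fastforce simp: component_of_def)
    then show ?thesis using vD sD(3,4) by (intro mgraph.equality) auto
  qed
  ultimately show "?C \<in> conn_components G" using sub unfolding conn_components_def by blast
qed

text \<open>The third fact holds by maximality: adding an edge that touches \<open>C\<close>,
  together with its other end, keeps the subgraph connected.\<close>

lemma conn_componentsD:
  assumes "C \<in> conn_components G"
  shows "subgraph C G" "connected_mgraph C"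
    and "\<And>e. e \<in> edges G \<Longrightarrow> fst e \<inter> verts C \<noteq> {} \<Longrightarrow> e \<in> edges C"
proof -
  show C: "subgraph C G" "connected_mgraph C" using assms by (auto simp: conn_components_def)
  fix e assume e: "e \<in> edges G" "fst e \<inter> verts C \<noteq> {}"
  have mul: "multigraph C" "multigraph G" and sub: "verts C \<subseteq> verts G" "edges C \<subseteq> edges G"
    using C(1) by (auto simp: subgraph_def)
  obtain x where x: "x \<in> fst e" "x \<in> verts C" using e(2) by blast
  obtain p q where "fst e = {p, q}"
    using multigraphD(4)[OF mul(2) e(1)] by (auto simp: card_2_iff)
  then obtain y where y: "fst e = {x, y}" using x(1) by (metis insertE insert_commute singletonD)
  define D where "D = \<lparr>verts = insert y (verts C), edges = insert e (edges C)\<rparr>"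
  have yG: "y \<in> verts G" using multigraphD(3)[OF mul(2) e(1)] y by blast
  have mD: "multigraph D"
    using mul multigraphD(4)[OF mul(2) e(1)] x y unfolding multigraph_def D_def by fastforce
  then have "subgraph D G" "subgraph C D"
    using mul sub e(1) yG by (auto simp: subgraph_def D_def)
  moreover have "connected_mgraph D"
  proof (rule connected_mgraphI[of x])
    show "x \<in> verts D" using x by (simp add: D_def)
    fix u assume u: "u \<in> verts D"
    have mono: "(adjacency C)\<^sup>* \<subseteq> (adjacency D)\<^sup>*"
      by (rule rtrancl_mono) (auto simp: adjacency_def D_def)
    show "(x, u) \<in> (adjacency D)\<^sup>*"
    proof (cases "u \<in> verts C")
      case True
      then show ?thesis using C(2) x(2) mono unfolding connected_mgraph_def by blast
    next
      case False
      then have "(x, u) \<in> adjacency D" using u y by (auto simp: adjacency_def D_def)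
      then show ?thesis by (rule r_into_rtrancl)
    qed
  qed
  ultimately have "D = C" using assms unfolding conn_components_def by blast
  then show "e \<in> edges C" by (metis D_def insertI1 mgraph.select_convs(2))
qed

lemma cutset_component:
  assumes "C \<in> conn_components G"
  shows "cutset G (verts C) = {}"
proof -
  have "multigraph C" using conn_componentsD(1)[OF assms] by (simp add: subgraph_def)
  then show ?thesis
    using conn_componentsD(3)[OF assms] multigraphD(3) unfolding cutset_def by fastforce
qed

text \<open>\<open>cutedge\<close> compares cardinalities, and \<open>card\<close> is 0 on infinite
  sets.\<close>

lemma finite_conn_components:
  assumes "multigraph G"
  shows "finite (conn_components G)"
proof (rule finite_imageD)
  show "inj_on (\<lambda>C. (verts C, edges C)) (conn_components G)"
    by (rule inj_onI) (auto intro: mgraph.equality)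
  have "(\<lambda>C. (verts C, edges C)) ` conn_components G \<subseteq> Pow (verts G) \<times> Pow (edges G)"
    by (auto simp: conn_components_def subgraph_def)
  then show "finite ((\<lambda>C. (verts C, edges C)) ` conn_components G)"
    by (rule finite_subset) (use multigraphD[OF assms] in simp)
qed

lemma conn_components_connected:
  assumes "connected_mgraph G" "multigraph G"
  shows "conn_components G = {G}"
proof -
  have refl: "subgraph G G" using assms by (simp add: subgraph_def)
  have antisym: "D = G" if "subgraph D G" "subgraph G D" for D
    using that by (intro mgraph.equality) (auto simp: subgraph_def)
  show ?thesis
  proof
    show "conn_components G \<subseteq> {G}"
      using refl assms unfolding conn_components_def by blast
    show "{G} \<subseteq> conn_components G"
      using refl assms antisym unfolding conn_components_def by blast
  qed
qed

text \<open>Without \<open>e\<close> no edge leaves \<open>S\<close>, so vertices inside and outside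
  lie in different components, whereas the connected \<open>C\<close> has just one.\<close>

lemma cutedgeI:
  assumes C: "multigraph C" "connected_mgraph C"
    and S: "S \<subseteq> verts C" "S \<noteq> {}" "S \<noteq> verts C" "cutset C S = {e}"
  shows "cutedge C e"
proof -
  let ?D = "delete_edge C e"
  have D: "multigraph ?D" using C(1) by (rule multigraph_delete_edge)
  have vD: "verts ?D = verts C" by (simp add: delete_edge_def)
  have cut: "cutset ?D S = {}" using S(4) by (simp add: cutset_delete_edge)
  obtain x y where xy: "x \<in> S" "y \<in> verts C - S" using S by blast
  have "component_of ?D x \<noteq> component_of ?D y"
  proof
    assume "component_of ?D x = component_of ?D y"
    then have "y \<in> verts (component_of ?D x)" using component_of(2)[OF D, of y] xy vD by simp
    then have "(x, y) \<in> (adjacency ?D)\<^sup>*" by (simp add: component_of_def)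
    then show False using reachable_stays[OF D cut] xy by blast
  qed
  moreover have "card {component_of ?D x, component_of ?D y} \<le> card (conn_components ?D)"
    using finite_conn_components[OF D] component_of(1)[OF D] xy S(1) vD
    by (intro card_mono) auto
  ultimately have "card (conn_components C) < card (conn_components ?D)"
    using conn_components_connected[OF C(2,1)] by simp
  moreover have "e \<in> edges C" using S(4) by (auto simp: cutset_def)
  ultimately show ?thesis by (simp add: cutedge_def)
qed

section \<open>Admissibility as a condition on cuts\<close>

lemma two_le_sum_iff:
  fixes f :: "'a \<Rightarrow> nat"
  assumes "finite S"
  shows "2 \<le> sum f S \<longleftrightarrow> (\<exists>v\<in>S. 2 \<le> f v) \<or> 2 \<le> card {v \<in> S. 1 \<le> f v}"
proof
  assume two: "2 \<le> sum f S"
  show "(\<exists>v\<in>S. 2 \<le> f v) \<or> 2 \<le> card {v \<in> S. 1 \<le> f v}"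
  proof (rule disjCI)
    assume neg: "\<not> 2 \<le> card {v \<in> S. 1 \<le> f v}"
    show "\<exists>v\<in>S. 2 \<le> f v"
    proof (rule ccontr)
      assume "\<not> ?thesis"
      then have "f v = (if 1 \<le> f v then 1 else 0)" if "v \<in> S" for v using that by force
      then have "sum f S = (\<Sum>v\<in>S. if 1 \<le> f v then 1 else 0)" by (intro sum.cong) auto
      also have "\<dots> = card {v \<in> S. 1 \<le> f v}" using assms by (simp add: sum.If_cases Int_def)
      finally show False using two neg by simp
    qed
  qed
next
  assume "(\<exists>v\<in>S. 2 \<le> f v) \<or> 2 \<le> card {v \<in> S. 1 \<le> f v}"
  then show "2 \<le> sum f S"
  proof
    assume "\<exists>v\<in>S. 2 \<le> f v"
    then show ?thesis using member_le_sum[of _ S f] assms by (meson le_trans zero_le)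
  next
    assume "2 \<le> card {v \<in> S. 1 \<le> f v}"
    also have "\<dots> = (\<Sum>v\<in>{v \<in> S. 1 \<le> f v}. 1)" by simp
    also have "\<dots> \<le> (\<Sum>v\<in>{v \<in> S. 1 \<le> f v}. f v)" by (intro sum_mono) auto
    also have "\<dots> \<le> sum f S" using assms by (intro sum_mono2) auto
    finally show ?thesis .
  qed
qed

text \<open>A violating \<open>S\<close> either is left by no edge, and then contains a component of
  deficit at most 1, or is left by one edge and has no deficit; this edge is then a cutedge of its
  component, with a side inside \<open>S\<close>. Conversely, a component has an empty cut, and only
  \<open>e\<close> can leave a component of \<open>C - e\<close>.\<close>

lemma component_conditions_iff:
  fixes r :: nat
  assumes G: "multigraph G"
  shows "(\<forall>C\<in>conn_components G. (\<exists>v\<in>verts C. degree G v + 2 \<le> r) \<or>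
        card {v \<in> verts C. degree G v + 1 \<le> r} \<ge> 2) \<and>
     (\<forall>C\<in>conn_components G. \<forall>e. cutedge C e \<longrightarrow>
        (\<forall>D\<in>conn_components (delete_edge C e). \<exists>v\<in>verts D. degree G v + 1 \<le> r)) \<longleftrightarrow>
     (\<forall>S\<subseteq>verts G. S \<noteq> {} \<longrightarrow> 2 \<le> card (cutset G S) + (\<Sum>v\<in>S. r - degree G v))"
    (is "?C2 \<and> ?C3 \<longleftrightarrow> ?R")
proof -
  let ?b = "\<lambda>v. r - degree G v"
  have b: "degree G v + 2 \<le> r \<longleftrightarrow> 2 \<le> ?b v" "degree G v + 1 \<le> r \<longleftrightarrow> 1 \<le> ?b v" for v by linarith+
  have finS: "finite S" if "S \<subseteq> verts G" for S
    using that multigraphD(1)[OF G] finite_subset by blast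
  have finC: "finite (cutset G S)" for S using multigraphD(2)[OF G] by (auto simp: cutset_def)
  have subC: "multigraph C" "verts C \<subseteq> verts G" "edges C \<subseteq> edges G" "verts C \<noteq> {}"
    if "C \<in> conn_components G" for C
    using conn_componentsD(1,2)[OF that] by (auto simp: subgraph_def connected_mgraph_def)
  \<comment> \<open>The two alternatives, one vertex lacking 2 or two vertices lacking 1, say
    together that the total deficit of the component is at least 2.\<close>
  have two: "((\<exists>v\<in>verts C. degree G v + 2 \<le> r) \<or> card {v \<in> verts C. degree G v + 1 \<le> r} \<ge> 2)
      \<longleftrightarrow> 2 \<le> sum ?b (verts C)" if "C \<in> conn_components G" for C
    unfolding b using two_le_sum_iff[of "verts C" ?b] finS[OF subC(2)[OF that]] by blast
  show ?thesis
  proof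
    assume "?C2 \<and> ?C3"
    then have C2: "\<And>C. C \<in> conn_components G \<Longrightarrow> 2 \<le> sum ?b (verts C)" and C3: ?C3
      using two by blast+
    show ?R
    proof (intro allI impI, rule ccontr)
      fix S assume S: "S \<subseteq> verts G" "S \<noteq> {}" and neg: "\<not> 2 \<le> card (cutset G S) + sum ?b S"
      have sub: "sum ?b T \<le> sum ?b S" if "T \<subseteq> S" for T
        using that finS[OF S(1)] by (intro sum_mono2) auto
      consider "card (cutset G S) = 0" | "card (cutset G S) = 1" "sum ?b S = 0"
        using neg by linarith
      then show False
      proof cases
        case 1
        then have cut: "cutset G S = {}" using finC by simp
        obtain v where v: "v \<in> S" using S by blast
        let ?C = "component_of G v"
        have "?C \<in> conn_components G" using component_of(1)[OF G] v S by blast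
        moreover have "verts ?C \<subseteq> S"
          using reachable_stays[OF G cut] v by (auto simp: component_of_def)
        ultimately have "2 \<le> sum ?b (verts ?C)" "sum ?b (verts ?C) \<le> sum ?b S"
          using C2 sub by blast+
        then show False using neg by linarith
      next
        case 2
        then obtain e where cut: "cutset G S = {e}" by (meson card_1_singletonE)
        then obtain x y where xy: "x \<in> S" "y \<in> verts G - S" "fst e = {x, y}" "e \<in> edges G"
          unfolding cutset_def by blast
        define C where "C = component_of G x"
        have C: "C \<in> conn_components G" "x \<in> verts C"
          using component_of[OF G] xy S unfolding C_def by blast+
        note sC = subC[OF C(1)]
        have eC: "e \<in> edges C" using conn_componentsD(3)[OF C(1) xy(4)] xy(3) C(2) by blast
        have yC: "y \<in> verts C" using multigraphD(3)[OF sC(1) eC] xy(3) by blast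
        \<comment> \<open>\<open>S\<close> may meet several components; inside the component of
          \<open>e\<close> its trace has the same single cut edge.\<close>
        let ?T = "S \<inter> verts C"
        have cutT: "cutset C ?T = {e}"
        proof
          show "cutset C ?T \<subseteq> {e}"
            using cut sC(2,3) unfolding cutset_def by blast
          show "{e} \<subseteq> cutset C ?T" using eC xy C(2) yC unfolding cutset_def by blast
        qed
        have "cutedge C e"
          using xy C(2) yC cutT by (intro cutedgeI[OF sC(1) conn_componentsD(2)[OF C(1)], of ?T]) auto
        moreover define D where "D = component_of (delete_edge C e) x"
        have mD: "multigraph (delete_edge C e)" using sC(1) by (rule multigraph_delete_edge)
        have "D \<in> conn_components (delete_edge C e)"
          unfolding D_def using C(2) by (intro component_of(1)[OF mD]) (simp add: delete_edge_def)
        moreover have "verts D \<subseteq> S"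
        proof
          fix z assume "z \<in> verts D"
          then have "(x, z) \<in> (adjacency (delete_edge C e))\<^sup>*" by (simp add: D_def component_of_def)
          moreover have "cutset (delete_edge C e) ?T = {}" using cutT by (simp add: cutset_delete_edge)
          ultimately show "z \<in> S" using reachable_stays[OF mD] xy(1) C(2) by blast
        qed
        ultimately obtain v where "v \<in> S" "1 \<le> ?b v" using C3 C(1) b(2) by blast
        then show False using 2(2) finS[OF S(1)] by simp
      qed
    qed
  next
    assume R: ?R
    have ?C2
    proof
      fix C assume C: "C \<in> conn_components G"
      have "2 \<le> card (cutset G (verts C)) + sum ?b (verts C)" using R subC[OF C] by blast
      then show "(\<exists>v\<in>verts C. degree G v + 2 \<le> r) \<or> card {v \<in> verts C. degree G v + 1 \<le> r} \<ge> 2"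
        unfolding two[OF C] by (simp add: cutset_component[OF C])
    qed
    moreover have ?C3
    proof (intro ballI allI impI)
      fix C e D assume C: "C \<in> conn_components G" and D: "D \<in> conn_components (delete_edge C e)"
      have sD: "multigraph D" "verts D \<subseteq> verts C" "verts D \<noteq> {}"
        using conn_componentsD(1,2)[OF D]
        by (auto simp: subgraph_def connected_mgraph_def delete_edge_def)
      have "cutset G (verts D) \<subseteq> {e}"
      proof
        fix f assume "f \<in> cutset G (verts D)"
        then obtain x y where f: "f \<in> edges G" "x \<in> verts D" "y \<in> verts G - verts D" "fst f = {x, y}"
          unfolding cutset_def by blast
        then have fC: "f \<in> edges C" using conn_componentsD(3)[OF C f(1)] sD(2) by blast
        show "f \<in> {e}"
        proof (rule ccontr)
          assume "f \<notin> {e}"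
          then have "f \<in> edges (delete_edge C e)" using fC by (simp add: delete_edge_def)
          then have "f \<in> edges D" using conn_componentsD(3)[OF D] f by blast
          then show False using multigraphD(3)[OF sD(1)] f by blast
        qed
      qed
      then have "card (cutset G (verts D)) \<le> 1" using card_mono[of "{e}"] by simp
      moreover have "2 \<le> card (cutset G (verts D)) + sum ?b (verts D)"
        using R sD subC(2)[OF C] by blast
      ultimately have "sum ?b (verts D) \<noteq> 0" by linarith
      then obtain v where "v \<in> verts D" "?b v \<noteq> 0" by (meson sum.neutral)
      then show "\<exists>v\<in>verts D. degree G v + 1 \<le> r" unfolding b by (metis One_nat_def Suc_leI not_gr_zero)
    qed
    ultimately show "?C2 \<and> ?C3" by blast
  qed
qed

lemma admissible_iff_sparse:
  assumes "\<And>i. i \<in> {1..k} \<Longrightarrow> multigraph (\<G> i)"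
  shows "admissible r k \<G> \<longleftrightarrow> (\<forall>i\<in>{1..k}. sparse r (verts (\<G> i)) (mult (\<G> i)))"
proof -
  have "(\<forall>v\<in>verts (\<G> i). degree (\<G> i) v \<le> r) \<and>
      (\<forall>S\<subseteq>verts (\<G> i). S \<noteq> {} \<longrightarrow> 2 \<le> card (cutset (\<G> i) S) + (\<Sum>v\<in>S. r - degree (\<G> i) v)) \<longleftrightarrow>
    sparse r (verts (\<G> i)) (mult (\<G> i))" if "i \<in> {1..k}" for i
  proof (cases "\<forall>v\<in>verts (\<G> i). degree (\<G> i) v \<le> r")
    case True
    note G = assms[OF that]
    have deg: "weight (mult (\<G> i)) {v} (verts (\<G> i)) \<le> r" if "v \<in> verts (\<G> i)" for v
      using True that by (simp add: weight_mult_degree[OF G])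
    have "sum (deficit r (verts (\<G> i)) (mult (\<G> i))) S = (\<Sum>v\<in>S. r - degree (\<G> i) v)" for S
      by (simp add: deficit_def weight_mult_degree[OF G])
    then show ?thesis
      using True sparse_iff[of "verts (\<G> i)" "mult (\<G> i)" r, OF multigraphD(1)[OF G] deg]
        weight_mult_cut[OF G] by auto
  next
    case False
    then show ?thesis using assms[OF that] by (auto simp: sparse_def weight_mult_degree)
  qed
  \<comment> \<open>\<open>admissible\<close> quantifies over the colors separately in each of its
    conditions; naming two of them for a fixed color allows regrouping by color.\<close>
  moreover define P where "P i \<longleftrightarrow> (\<forall>C\<in>conn_components (\<G> i).
    (\<exists>v\<in>verts C. degree (\<G> i) v + 2 \<le> r) \<or> card {v \<in> verts C. degree (\<G> i) v + 1 \<le> r} \<ge> 2)" for i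
  moreover define Q where "Q i \<longleftrightarrow> (\<forall>C\<in>conn_components (\<G> i). \<forall>e. cutedge C e \<longrightarrow>
    (\<forall>D\<in>conn_components (delete_edge C e). \<exists>v\<in>verts D. degree (\<G> i) v + 1 \<le> r))" for i
  ultimately have "(\<forall>v\<in>verts (\<G> i). degree (\<G> i) v \<le> r) \<and> P i \<and> Q i \<longleftrightarrow>
      sparse r (verts (\<G> i)) (mult (\<G> i))" if "i \<in> {1..k}" for i
    using component_conditions_iff[OF assms[OF that], of r] that by (simp only:)
  moreover have "admissible r k \<G> \<longleftrightarrow> (\<forall>i\<in>{1..k}. \<forall>v\<in>verts (\<G> i). degree (\<G> i) v \<le> r) \<and>
      (\<forall>i\<in>{1..k}. P i) \<and> (\<forall>i\<in>{1..k}. Q i)"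
    by (simp only: admissible_def P_def Q_def)
  ultimately show ?thesis by blast
qed

section \<open>Enclosing decompositions\<close>

text \<open>Greedy choice: \<open>M x\<close> avoids all other \<open>N j\<close>, and there is room
  for it because these occupy at most \<open>sum f I\<close> elements. It will distribute the labels
  of the parallel edges over one pair among the colors.\<close>

lemma extend_disjoint_family:
  assumes "finite I" "finite U"
    and "\<And>i. i \<in> I \<Longrightarrow> N i \<subseteq> U" "\<And>i j. i \<in> I \<Longrightarrow> j \<in> I \<Longrightarrow> i \<noteq> j \<Longrightarrow> N i \<inter> N j = {}"
    and "\<And>i. i \<in> I \<Longrightarrow> card (N i) \<le> f i" "sum f I = card U"
  shows "\<exists>M. (\<forall>i\<in>I. N i \<subseteq> M i \<and> card (M i) = f i) \<and>
    (\<forall>i\<in>I. \<forall>j\<in>I. i \<noteq> j \<longrightarrow> M i \<inter> M j = {}) \<and> (\<Union>i\<in>I. M i) = U"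
  using assms
proof (induction I arbitrary: U rule: finite_induct)
  case empty
  then show ?case by simp
next
  case (insert x I)
  let ?R = "U - (\<Union>j\<in>I. N j)"
  have cardN: "card (\<Union>j\<in>I. N j) = (\<Sum>j\<in>I. card (N j))"
    using insert.hyps insert.prems(1-3) by (intro card_UN_disjoint) (auto intro: finite_subset)
  have subN: "(\<Union>j\<in>I. N j) \<subseteq> U" using insert.prems(2) by blast
  have "card ?R = card U - (\<Sum>j\<in>I. card (N j))"
    using cardN subN insert.prems(1) by (metis card_Diff_subset finite_subset)
  moreover have "(\<Sum>j\<in>I. card (N j)) \<le> sum f I" using insert.prems(4) by (intro sum_mono) auto
  moreover have "f x + sum f I = card U" using insert.prems(5) insert.hyps by simp
  ultimately have fx: "f x \<le> card ?R" by linarith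
  have "N x \<subseteq> ?R" using insert.prems(2,3) insert.hyps(2) by fastforce
  moreover have "card (N x) \<le> f x" using insert.prems(4) by simp
  ultimately obtain Mx where Mx: "N x \<subseteq> Mx" "Mx \<subseteq> ?R" "card Mx = f x"
    using exists_subset_between[of "N x" "f x" ?R] fx insert.prems(1) by auto
  have fin: "finite (U - Mx)" using insert.prems(1) by simp
  have MxU: "Mx \<subseteq> U" using Mx(2) by blast
  have "card (U - Mx) = card U - f x"
    using Mx(3) MxU insert.prems(1) by (metis card_Diff_subset finite_subset)
  then have sum: "sum f I = card (U - Mx)" using \<open>f x + sum f I = card U\<close> by simp
  have "\<exists>M. (\<forall>i\<in>I. N i \<subseteq> M i \<and> card (M i) = f i) \<and>
    (\<forall>i\<in>I. \<forall>j\<in>I. i \<noteq> j \<longrightarrow> M i \<inter> M j = {}) \<and> (\<Union>i\<in>I. M i) = U - Mx"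
  proof (rule insert.IH[OF fin _ _ _ sum])
    show "N i \<subseteq> U - Mx" if "i \<in> I" for i using that insert.prems(2) Mx(2) by blast
    show "N i \<inter> N j = {}" if "i \<in> I" "j \<in> I" "i \<noteq> j" for i j
      using that insert.prems(3) by blast
    show "card (N i) \<le> f i" if "i \<in> I" for i using that insert.prems(4) by blast
  qed
  then obtain M where M0: "\<forall>i\<in>I. N i \<subseteq> M i \<and> card (M i) = f i"
    "\<forall>i\<in>I. \<forall>j\<in>I. i \<noteq> j \<longrightarrow> M i \<inter> M j = {}" "(\<Union>i\<in>I. M i) = U - Mx"
    by (elim exE conjE)
  then have M: "\<And>i. i \<in> I \<Longrightarrow> N i \<subseteq> M i" "\<And>i. i \<in> I \<Longrightarrow> card (M i) = f i"
    "\<And>i j. i \<in> I \<Longrightarrow> j \<in> I \<Longrightarrow> i \<noteq> j \<Longrightarrow> M i \<inter> M j = {}" "(\<Union>i\<in>I. M i) = U - Mx"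
    by simp_all
  let ?M = "M(x := Mx)"
  have eq: "?M i = M i" if "i \<in> I" for i using that insert.hyps(2) by auto
  have dis: "Mx \<inter> M i = {}" if "i \<in> I" for i using that M(4) by blast
  show ?case
  proof (intro exI[of _ ?M] conjI ballI impI)
    show "N i \<subseteq> ?M i" "card (?M i) = f i" if "i \<in> insert x I" for i
      using that M(1,2) Mx eq by auto
    show "?M i \<inter> ?M j = {}" if "i \<in> insert x I" "j \<in> insert x I" "i \<noteq> j" for i j
      using that M(3)[of i j] dis[of i] dis[of j] eq by auto
    have "(\<Union>i\<in>I. ?M i) = (\<Union>i\<in>I. M i)" by (rule SUP_cong[OF refl eq])
    then have "(\<Union>i\<in>insert x I. ?M i) = Mx \<union> (\<Union>i\<in>I. M i)" by (simp only: UN_insert fun_upd_same)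
    then show "(\<Union>i\<in>insert x I. ?M i) = U" using MxU by (simp only: M(4) Un_Diff_cancel Un_absorb1)
  qed
qed

section \<open>Counting edges of decompositions\<close>

lemma mult_complete:
  assumes "u < m" "v < m" "u \<noteq> v"
  shows "{e \<in> edges (complete_mgraph \<mu> m). fst e = {u, v}} = Pair {u, v} ` {..<\<mu>}"
  using assms by (auto simp: complete_mgraph_def)

lemma decompositionD:
  assumes "decomposition (complete_mgraph \<mu> m) k \<H>" "i \<in> {1..k}"
  shows "multigraph (\<H> i)" "verts (\<H> i) = {..<m}" "edges (\<H> i) \<subseteq> edges (complete_mgraph \<mu> m)"
  using assms unfolding decomposition_def spanning_subgraph_def subgraph_def
  by (auto simp: complete_mgraph_def)

lemma sum_mult_decomposition:
  assumes H: "decomposition (complete_mgraph \<mu> m) k \<H>" and uv: "u < m" "v < m" "u \<noteq> v"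
  shows "(\<Sum>i\<in>{1..k}. mult (\<H> i) u v) = \<mu>"
proof -
  let ?E = "\<lambda>i. {e \<in> edges (\<H> i). fst e = {u, v}}"
  have "(\<Sum>i\<in>{1..k}. mult (\<H> i) u v) = card (\<Union>i\<in>{1..k}. ?E i)"
    unfolding mult_def
  proof (rule card_UN_disjoint[symmetric])
    show "\<forall>i\<in>{1..k}. finite (?E i)" using multigraphD(2)[OF decompositionD(1)[OF H]] by simp
    show "\<forall>i\<in>{1..k}. \<forall>j\<in>{1..k}. i \<noteq> j \<longrightarrow> ?E i \<inter> ?E j = {}"
      using H unfolding decomposition_def by blast
  qed simp
  also have "(\<Union>i\<in>{1..k}. ?E i) = {e \<in> edges (complete_mgraph \<mu> m). fst e = {u, v}}"
    using H unfolding decomposition_def by blast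
  also have "card \<dots> = \<mu>" unfolding mult_complete[OF uv] by (simp add: card_image inj_on_def)
  finally show ?thesis .
qed

lemma total_const:
  assumes "\<And>i. i \<in> {1..k} \<Longrightarrow> multiplicity (A i)"
    and "\<And>u v. u < n \<Longrightarrow> v < n \<Longrightarrow> u \<noteq> v \<Longrightarrow> (\<Sum>i\<in>{1..k}. A i u v) = \<mu>"
  shows "total k n A = \<mu> * (n * (n - 1))"
proof -
  have "total k n A = (\<Sum>u<n. \<Sum>v<n. if u = v then 0 else \<mu>)"
    unfolding total_eq using assms by (intro sum.cong refl) (auto simp: multiplicity_def)
  then show ?thesis by (simp only: sum_off_diagonal)
qed

text \<open>Grouping the indices by the value of \<open>f\<close> turns the sum over sizes in (B3)
  into a sum over colors. For negative \<open>p\<close> the left sum is empty and all positive parts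
  vanish.\<close>

lemma sum_positive_parts:
  fixes f :: "'i \<Rightarrow> nat" and p :: real
  assumes "finite I"
  shows "(\<Sum>j\<in>{j::nat. real j \<le> p}. (p - real j) * real (card {i \<in> I. f i = j})) =
    (\<Sum>i\<in>I. max 0 (p - real (f i)))"
proof -
  let ?J = "{j::nat. real j \<le> p}"
  have fin: "finite ?J" by (rule finite_subset[of _ "{..nat \<lfloor>p\<rfloor>}"]) (auto simp: le_nat_floor)
  have "(\<Sum>j\<in>?J. (p - real j) * real (card {i \<in> I. f i = j})) =
      (\<Sum>j\<in>?J. \<Sum>i\<in>I. if f i = j then p - real j else 0)"
    using assms by (intro sum.cong refl) (simp add: sum.If_cases Int_def mult.commute)
  also have "\<dots> = (\<Sum>i\<in>I. \<Sum>j\<in>?J. if f i = j then p - real j else 0)" by (rule sum.swap)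
  also have "\<dots> = (\<Sum>i\<in>I. max 0 (p - real (f i)))"
    using fin by (intro sum.cong refl) (auto simp: sum.delta)
  finally show ?thesis .
qed

lemma edge_count_condition_iff:
  fixes p :: real
  assumes p: "p = real r * (2 * real n - real m) / 2" and n: "0 < n" and l: "l \<le> \<mu>"
    and G: "decomposition (complete_mgraph l n) k \<G>"
  shows "(\<Sum>j\<in>{j::nat. real j \<le> p}. (p - real j) * real (card (classes_of_size k \<G> j)))
        \<le> (real \<mu> - real l) * (real n * (real n - 1) / 2) \<longleftrightarrow>
    (\<Sum>i\<in>{1..k}. (2 * r * n - r * m) - weight (mult (\<G> i)) {..<n} {..<n}) + total k n (\<lambda>i. mult (\<G> i))
      \<le> \<mu> * (n * (n - 1))"
proof -
  let ?e = "\<lambda>i. card (edges (\<G> i))"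
  have w: "weight (mult (\<G> i)) {..<n} {..<n} = 2 * ?e i" if "i \<in> {1..k}" for i
    using weight_mult_edges[OF decompositionD(1)[OF G that]] decompositionD(2)[OF G that] by simp
  \<comment> \<open>Truncated subtraction of naturals is the positive part; this also covers the
    case where already \<open>2 * r * n - r * m\<close> is cut off. Doubling (B3) makes all its
    terms integers.\<close>
  have q: "real (2 * r * n - r * m - 2 * x) = 2 * max 0 (p - real x)" for x
  proof (cases "r * m + 2 * x \<le> 2 * r * n")
    case True
    then have "real (r * m + 2 * x) \<le> real (2 * r * n)" by (simp only: of_nat_le_iff)
    moreover have "real (2 * r * n - r * m - 2 * x) = real (2 * r * n) - real (r * m + 2 * x)"
      using True by linarith
    ultimately show ?thesis by (simp add: p field_simps)
  next
    case False
    then have "real (2 * r * n) \<le> real (r * m + 2 * x)" by (simp only: of_nat_le_iff)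
    then show ?thesis using False by (simp add: p field_simps)
  qed
  have tot: "total k n (\<lambda>i. mult (\<G> i)) = l * (n * (n - 1))"
    using multiplicity_mult[OF decompositionD(1)[OF G]] sum_mult_decomposition[OF G]
    by (intro total_const) auto
  have sum: "real (\<Sum>i\<in>{1..k}. (2 * r * n - r * m) - weight (mult (\<G> i)) {..<n} {..<n}) =
      2 * (\<Sum>i\<in>{1..k}. max 0 (p - real (?e i)))"
    unfolding of_nat_sum sum_distrib_left using w q by (intro sum.cong refl) simp
  have "(\<Sum>j\<in>{j::nat. real j \<le> p}. (p - real j) * real (card (classes_of_size k \<G> j))) =
      (\<Sum>i\<in>{1..k}. max 0 (p - real (?e i)))"
    unfolding classes_of_size_def by (rule sum_positive_parts) simp
  moreover have "real (l * (n * (n - 1))) = real l * (real n * (real n - 1))"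
    "real (\<mu> * (n * (n - 1))) = real \<mu> * (real n * (real n - 1))"
    using n by (simp_all add: of_nat_diff)
  ultimately show ?thesis
    unfolding tot of_nat_le_iff[where ?'a = real, symmetric] of_nat_add sum
    by (simp add: algebra_simps)
qed

section \<open>The two directions of the equivalence\<close>

lemma mult_mono: "multigraph H \<Longrightarrow> edges G \<subseteq> edges H \<Longrightarrow> mult G u v \<le> mult H u v"
  unfolding mult_def by (intro card_mono) (auto dest: multigraphD(2))

lemma factorization_necessary:
  assumes pos: "0 < k" "2 \<le> r" "0 < n" "2 * n - 1 \<le> m"
    and G: "decomposition (complete_mgraph l n) k \<G>"
    and H: "two_edge_connected_factorization (complete_mgraph \<mu> m) r k \<H>"
    and enc: "enclosed_in k \<G> \<H>"
  shows "r * k = \<mu> * (m - 1)" "even (r * m)" "admissible r k \<G>"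
    "(\<Sum>i\<in>{1..k}. (2 * r * n - r * m) - weight (mult (\<G> i)) {..<n} {..<n}) + total k n (\<lambda>i. mult (\<G> i))
      \<le> \<mu> * (n * (n - 1))"
proof -
  have dec: "decomposition (complete_mgraph \<mu> m) k \<H>"
    using H by (simp add: two_edge_connected_factorization_def)
  note mH = decompositionD(1)[OF dec] and vH = decompositionD(2)[OF dec]
  note mG = decompositionD(1)[OF G] and vG = decompositionD(2)[OF G]
  have deg: "weight (mult (\<H> i)) {v} {..<m} = r" if i: "i \<in> {1..k}" and "v < m" for i v
    using H weight_mult_degree[OF mH[OF i], of v] that vH[OF i]
    by (simp add: two_edge_connected_factorization_def regular_mgraph_def)
  have "(\<Sum>i\<in>{1..k}. weight (mult (\<H> i)) {0} {..<m}) = \<mu> * (m - 1)"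
    using multiplicity_mult[OF mH] sum_mult_decomposition[OF dec] pos by (intro sum_weight_row) auto
  then show rk: "r * k = \<mu> * (m - 1)" using deg pos by (simp add: mult.commute)
  have degsum: "weight (mult (\<H> i)) A {..<m} = r * card A" if "i \<in> {1..k}" "A \<subseteq> {..<m}" for i A
  proof -
    have "weight (mult (\<H> i)) A {..<m} = (\<Sum>v\<in>A. r)"
      unfolding weight_degrees[of _ A] using deg[OF that(1)] that(2) by (intro sum.cong) auto
    then show ?thesis by (simp add: mult.commute)
  qed
  have one: "1 \<in> {1..k}" using pos by simp
  show "even (r * m)"
    using even_weight_self[OF multiplicity_mult[OF mH[OF one]], of "{..<m}"] degsum[OF one, of "{..<m}"]
    by simp
  \<comment> \<open>\<open>m \<ge> 2 * n - 1\<close> yields n < m except for n = m = 1, where rk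
    would be 0. So sets of old vertices are proper subsets, and their cuts have at least 2
    edges.\<close>
  have "m \<noteq> 1"
  proof
    assume "m = 1"
    then show False using rk pos by simp
  qed
  then have nm: "n < m" using pos by linarith
  then have sub: "{..<n} \<subseteq> {..<m}" by auto
  have le: "mult (\<G> i) u v \<le> mult (\<H> i) u v" if i: "i \<in> {1..k}" for i u v
    using enc i unfolding enclosed_in_def subgraph_def by (intro mult_mono[OF mH[OF i]]) blast
  have wle: "weight (mult (\<G> i)) A B \<le> weight (mult (\<H> i)) A B" if "i \<in> {1..k}" for i A B
    unfolding weight_def using le[OF that] by (intro sum_mono)
  have "sparse r {..<n} (mult (\<G> i))" if i: "i \<in> {1..k}" for i
    unfolding sparse_def
  proof (intro conjI ballI allI impI)
    fix v assume v: "v \<in> {..<n}"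
    have "weight (mult (\<G> i)) {v} {..<n} \<le> weight (mult (\<H> i)) {v} {..<n}" by (rule wle[OF i])
    also have "\<dots> \<le> weight (mult (\<H> i)) {v} {..<m}" using sub by (intro weight_mono) auto
    finally show "weight (mult (\<G> i)) {v} {..<n} \<le> r" using deg[OF i, of v] v nm by simp
  next
    fix S assume S: "S \<subseteq> {..<n}" "S \<noteq> {}"
    then have Sm: "S \<subseteq> {..<m}" "S \<noteq> {..<m}" using nm by auto
    have "two_edge_connected (\<H> i)"
      using H i by (simp add: two_edge_connected_factorization_def)
    then have "2 \<le> card (cutset (\<H> i) S)"
      using S Sm unfolding two_edge_connected_iff[OF mH[OF i]] vH[OF i] by blast
    then have "2 \<le> weight (mult (\<H> i)) S ({..<m} - S)"
      using weight_mult_cut[OF mH[OF i], of S] Sm vH[OF i] by simp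
    moreover have "weight (mult (\<H> i)) S S + weight (mult (\<H> i)) S ({..<m} - S) = r * card S"
      using weight_split_right[of "{..<m}" S "mult (\<H> i)" S] degsum[OF i, of S] Sm by simp
    ultimately show "weight (mult (\<G> i)) S S + 2 \<le> r * card S"
      using wle[OF i, of S S] by linarith
  qed
  then show "admissible r k \<G>" using admissible_iff_sparse[of k \<G> r, OF mG] vG by auto
  \<comment> \<open>The left side is the maximum of q = 2rn - rm, cut off at 0, and the weight of
    \<open>\<G> i\<close>. That q is a lower bound follows because the old vertices send at most r(m
    - n) edges to the new ones. Summing over the colors gives the doubled (B3).\<close>
  have "(2 * r * n - r * m) - weight (mult (\<G> i)) {..<n} {..<n} + weight (mult (\<G> i)) {..<n} {..<n}
      \<le> weight (mult (\<H> i)) {..<n} {..<n}" if i: "i \<in> {1..k}" for i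
  proof -
    let ?h = "weight (mult (\<H> i))" and ?W = "{..<m} - {..<n}"
    have "?h {..<n} {..<n} + ?h {..<n} ?W = r * n"
      using weight_split_right[OF _ sub, of "mult (\<H> i)" "{..<n}"] degsum[OF i sub] by simp
    moreover have "?h {..<n} ?W = ?h ?W {..<n}" by (rule weight_commute[OF multiplicity_mult[OF mH[OF i]]])
    moreover have "?h ?W {..<n} \<le> ?h ?W {..<m}" using sub by (intro weight_mono) auto
    moreover have "?h ?W {..<m} = r * card ?W" by (rule degsum[OF i]) blast
    moreover have "card ?W = m - n" using sub by (simp add: card_Diff_subset)
    moreover have "r * (m - n) + r * n = r * m" using nm by (simp flip: add_mult_distrib2)
    ultimately have "2 * r * n - r * m \<le> ?h {..<n} {..<n}" by (simp add: mult.assoc)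
    then show ?thesis using wle[OF i, of "{..<n}" "{..<n}"] by linarith
  qed
  then have "(\<Sum>i\<in>{1..k}. (2 * r * n - r * m) - weight (mult (\<G> i)) {..<n} {..<n}) +
      total k n (\<lambda>i. mult (\<G> i)) \<le> total k n (\<lambda>i. mult (\<H> i))"
    unfolding total_def sum.distrib[symmetric] by (intro sum_mono)
  also have "total k n (\<lambda>i. mult (\<H> i)) = \<mu> * (n * (n - 1))"
    using multiplicity_mult[OF mH] sum_mult_decomposition[OF dec] nm by (intro total_const) auto
  finally show "(\<Sum>i\<in>{1..k}. (2 * r * n - r * m) - weight (mult (\<G> i)) {..<n} {..<n}) +
      total k n (\<lambda>i. mult (\<G> i)) \<le> \<mu> * (n * (n - 1))" .
qed

text \<open>Edges regain their names pair by pair: on each pair \<open>E\<close> the labels used by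
  \<open>\<G> i\<close> stay with color \<open>i\<close>, and the others are handed out according to
  the prescribed multiplicities.\<close>

lemma realize_multiplicities:
  assumes G: "decomposition (complete_mgraph l n) k \<G>" and le: "l \<le> \<mu>" "n \<le> m"
    and mul: "\<And>i. i \<in> {1..k} \<Longrightarrow> multiplicity (A i)"
    and A: "\<And>u v. u < m \<Longrightarrow> v < m \<Longrightarrow> u \<noteq> v \<Longrightarrow> (\<Sum>i\<in>{1..k}. A i u v) = \<mu>"
    and GA: "\<And>i u v. i \<in> {1..k} \<Longrightarrow> u < n \<Longrightarrow> v < n \<Longrightarrow> mult (\<G> i) u v \<le> A i u v"
  shows "\<exists>\<H>. decomposition (complete_mgraph \<mu> m) k \<H> \<and> enclosed_in k \<G> \<H> \<and>
    (\<forall>i\<in>{1..k}. \<forall>u<m. \<forall>v<m. mult (\<H> i) u v = A i u v)"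
proof -
  note mG = decompositionD(1)[OF G] and vG = decompositionD(2)[OF G] and eG = decompositionD(3)[OF G]
  define pairs where "pairs = {E :: nat set. E \<subseteq> {..<m} \<and> card E = 2}"
  define N where "N E i = {j. (E, j) \<in> edges (\<G> i)}" for E i
  have sym: "A i u v = A i v u" if "i \<in> {1..k}" for i u v
    using mul[OF that] unfolding multiplicity_def by metis
  have cardN: "card (N {u, v} i) = mult (\<G> i) u v" for u v i
  proof -
    have "{e \<in> edges (\<G> i). fst e = {u, v}} = Pair {u, v} ` N {u, v} i" by (auto simp: N_def)
    then show ?thesis by (simp add: mult_def card_image inj_on_def)
  qed
  \<comment> \<open>The choice is made for the unordered pair \<open>E\<close>; the cardinality is
    required for both ways of writing it, which agree by symmetry of \<open>A i\<close>.\<close>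
  have "\<exists>M. (\<forall>i\<in>{1..k}. N E i \<subseteq> M i \<and> (\<forall>u v. E = {u, v} \<longrightarrow> card (M i) = A i u v)) \<and>
      (\<forall>i\<in>{1..k}. \<forall>j\<in>{1..k}. i \<noteq> j \<longrightarrow> M i \<inter> M j = {}) \<and> (\<Union>i\<in>{1..k}. M i) = {..<\<mu>}"
    if E: "E \<in> pairs" for E
  proof -
    obtain u v where uv: "E = {u, v}" "u \<noteq> v" "u < m" "v < m"
      using E by (auto simp: pairs_def card_2_iff)
    have Nl: "N E i \<subseteq> {..<l}" "N E i \<noteq> {} \<Longrightarrow> u < n \<and> v < n" if "i \<in> {1..k}" for i
      using eG[OF that] uv(1) by (auto simp: N_def complete_mgraph_def)
    have "\<exists>M. (\<forall>i\<in>{1..k}. N E i \<subseteq> M i \<and> card (M i) = A i u v) \<and>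
      (\<forall>i\<in>{1..k}. \<forall>j\<in>{1..k}. i \<noteq> j \<longrightarrow> M i \<inter> M j = {}) \<and> (\<Union>i\<in>{1..k}. M i) = {..<\<mu>}"
    proof (rule extend_disjoint_family)
      show "N E i \<subseteq> {..<\<mu>}" if "i \<in> {1..k}" for i using Nl(1)[OF that] le(1) by fastforce
      show "N E i \<inter> N E j = {}" if "i \<in> {1..k}" "j \<in> {1..k}" "i \<noteq> j" for i j
        using G that unfolding decomposition_def N_def by blast
      show "card (N E i) \<le> A i u v" if "i \<in> {1..k}" for i
        using Nl(2)[OF that] GA[OF that] cardN[of u v i] uv(1) by (cases "N E i = {}") auto
      show "(\<Sum>i\<in>{1..k}. A i u v) = card {..<\<mu>}" using A uv by simp
    qed simp_all
    then obtain M where M: "\<forall>i\<in>{1..k}. N E i \<subseteq> M i \<and> card (M i) = A i u v"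
      "(\<forall>i\<in>{1..k}. \<forall>j\<in>{1..k}. i \<noteq> j \<longrightarrow> M i \<inter> M j = {}) \<and> (\<Union>i\<in>{1..k}. M i) = {..<\<mu>}"
      by (elim exE conjE) simp
    have "card (M i) = A i x y" if i: "i \<in> {1..k}" and "E = {x, y}" for i x y
    proof -
      have "x = u \<and> y = v \<or> x = v \<and> y = u" using that(2) uv(1) by (auto simp: doubleton_eq_iff)
      then show ?thesis using M(1) i sym[OF i] by metis
    qed
    then show ?thesis using M by (intro exI[of _ M] conjI) simp_all
  qed
  then have "\<forall>E\<in>pairs. \<exists>M. (\<forall>i\<in>{1..k}. N E i \<subseteq> M i \<and> (\<forall>u v. E = {u, v} \<longrightarrow> card (M i) = A i u v)) \<and>
      (\<forall>i\<in>{1..k}. \<forall>j\<in>{1..k}. i \<noteq> j \<longrightarrow> M i \<inter> M j = {}) \<and> (\<Union>i\<in>{1..k}. M i) = {..<\<mu>}"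
    by (rule ballI)
  from bchoice[OF this] obtain M where "\<forall>E\<in>pairs.
      (\<forall>i\<in>{1..k}. N E i \<subseteq> M E i \<and> (\<forall>u v. E = {u, v} \<longrightarrow> card (M E i) = A i u v)) \<and>
      (\<forall>i\<in>{1..k}. \<forall>j\<in>{1..k}. i \<noteq> j \<longrightarrow> M E i \<inter> M E j = {}) \<and> (\<Union>i\<in>{1..k}. M E i) = {..<\<mu>}"
    by (rule exE)
  then have M: "\<And>E i. E \<in> pairs \<Longrightarrow> i \<in> {1..k} \<Longrightarrow> N E i \<subseteq> M E i"
    "\<And>E i u v. E \<in> pairs \<Longrightarrow> i \<in> {1..k} \<Longrightarrow> E = {u, v} \<Longrightarrow> card (M E i) = A i u v"
    "\<And>E i j. E \<in> pairs \<Longrightarrow> i \<in> {1..k} \<Longrightarrow> j \<in> {1..k} \<Longrightarrow> i \<noteq> j \<Longrightarrow> M E i \<inter> M E j = {}"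
    "\<And>E. E \<in> pairs \<Longrightarrow> (\<Union>i\<in>{1..k}. M E i) = {..<\<mu>}"
    by simp_all
  define \<H> where "\<H> i = \<lparr>verts = {..<m}, edges = {(E, j). E \<in> pairs \<and> j \<in> M E i}\<rparr>" for i
  let ?K = "complete_mgraph \<mu> m"
  have edgesK: "edges ?K = {(E, j). E \<in> pairs \<and> j < \<mu>}"
    by (auto simp: complete_mgraph_def pairs_def)
  have K: "multigraph ?K" by (rule multigraph_complete_mgraph)
  have sub: "edges (\<H> i) \<subseteq> edges ?K" if "i \<in> {1..k}" for i
    using M(4) that unfolding \<H>_def edgesK by fastforce
  have mH: "multigraph (\<H> i)" if "i \<in> {1..k}" for i
  proof -
    have "finite (edges (\<H> i))" using sub[OF that] multigraphD(2)[OF K] by (rule finite_subset)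
    then show ?thesis by (auto simp: multigraph_def \<H>_def pairs_def)
  qed
  have "decomposition ?K k \<H>"
    unfolding decomposition_def
  proof (intro conjI ballI impI)
    show "spanning_subgraph (\<H> i) ?K" if "i \<in> {1..k}" for i
      using mH[OF that] sub[OF that] K
      by (simp add: spanning_subgraph_def subgraph_def \<H>_def complete_mgraph_def)
    show "edges (\<H> i) \<inter> edges (\<H> j) = {}" if "i \<in> {1..k}" "j \<in> {1..k}" "i \<noteq> j" for i j
      using M(3)[OF _ that] by (auto simp: \<H>_def)
    show "(\<Union>i\<in>{1..k}. edges (\<H> i)) = edges ?K"
    proof
      show "(\<Union>i\<in>{1..k}. edges (\<H> i)) \<subseteq> edges ?K" using sub by blast
      show "edges ?K \<subseteq> (\<Union>i\<in>{1..k}. edges (\<H> i))"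
      proof
        fix e assume "e \<in> edges ?K"
        then obtain E j where e: "e = (E, j)" "E \<in> pairs" "j < \<mu>" unfolding edgesK by blast
        then obtain i where "i \<in> {1..k}" "j \<in> M E i" using M(4)[OF e(2)] by blast
        then show "e \<in> (\<Union>i\<in>{1..k}. edges (\<H> i))" using e by (auto simp: \<H>_def)
      qed
    qed
  qed
  moreover have "enclosed_in k \<G> \<H>"
    unfolding enclosed_in_def
  proof
    fix i assume i: "i \<in> {1..k}"
    have "edges (\<G> i) \<subseteq> edges (\<H> i)"
    proof
      fix e assume e: "e \<in> edges (\<G> i)"
      obtain E j where Ej: "e = (E, j)" by (cases e)
      have "E \<in> pairs" using eG[OF i] e le(2) unfolding Ej pairs_def complete_mgraph_def by fastforce
      moreover have "j \<in> N E i" using e Ej by (simp add: N_def)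
      ultimately show "e \<in> edges (\<H> i)" using M(1)[of E i] i Ej by (auto simp: \<H>_def)
    qed
    then show "subgraph (\<G> i) (\<H> i)"
      using mG[OF i] mH[OF i] vG[OF i] le(2) by (auto simp: subgraph_def \<H>_def)
  qed
  moreover have "mult (\<H> i) u v = A i u v" if i: "i \<in> {1..k}" and uv: "u < m" "v < m" for i u v
  proof (cases "u = v")
    case True
    then show ?thesis
      using multiplicity_mult[OF mH[OF i]] mul[OF i] by (simp add: multiplicity_def)
  next
    case False
    then have pair: "{u, v} \<in> pairs" using uv by (simp add: pairs_def)
    then have "{e \<in> edges (\<H> i). fst e = {u, v}} = Pair {u, v} ` M {u, v} i" by (auto simp: \<H>_def)
    then show ?thesis using M(2)[OF pair i refl] by (simp add: mult_def card_image inj_on_def)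
  qed
  ultimately show ?thesis by blast
qed

lemma factorization_sufficient:
  assumes pos: "0 < k" "2 \<le> r" "0 < n" "2 * n - 1 \<le> m" "l \<le> \<mu>"
    and G: "decomposition (complete_mgraph l n) k \<G>"
    and rk: "r * k = \<mu> * (m - 1)" and ev: "even (r * m)" and adm: "admissible r k \<G>"
    and small: "(\<Sum>i\<in>{1..k}. (2 * r * n - r * m) - weight (mult (\<G> i)) {..<n} {..<n}) +
      total k n (\<lambda>i. mult (\<G> i)) \<le> \<mu> * (n * (n - 1))"
  shows "\<exists>\<H>. two_edge_connected_factorization (complete_mgraph \<mu> m) r k \<H> \<and> enclosed_in k \<G> \<H>"
proof -
  note mG = decompositionD(1)[OF G] and vG = decompositionD(2)[OF G]
  have "m \<noteq> 1"
  proof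
    assume "m = 1"
    then show False using rk pos by simp
  qed
  then have nm: "n < m" using pos by linarith
  have "sparse r {..<n} (mult (\<G> i))" if "i \<in> {1..k}" for i
  proof -
    have "sparse r (verts (\<G> i)) (mult (\<G> i))"
      using adm admissible_iff_sparse[of k \<G> r, OF mG] that by blast
    then show ?thesis by (simp only: vG[OF that])
  qed
  then have fam: "color_family \<mu> r k n (\<lambda>i. mult (\<G> i))"
    using multiplicity_mult[OF mG] sum_mult_decomposition[OF G] pos(5)
    unfolding color_family_def by simp
  obtain B where B: "partial_factorization \<mu> r k m n B" "\<forall>i u v. mult (\<G> i) u v \<le> B i u v"
    using color_family_to_partial_factorization[OF fam pos(2) rk pos(4) _ ev small] nm by auto
  from partial_factorization_complete[OF B(1) rk ev pos(2,3) nm]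
  obtain A where A0: "\<forall>i\<in>{1..k}. multiplicity (A i) \<and> (\<forall>v<m. weight (A i) {v} {..<m} = r) \<and>
      (\<forall>S\<subseteq>{..<m}. S \<noteq> {} \<longrightarrow> S \<noteq> {..<m} \<longrightarrow> 2 \<le> weight (A i) S ({..<m} - S))"
    "\<forall>u<m. \<forall>v<m. u \<noteq> v \<longrightarrow> (\<Sum>i\<in>{1..k}. A i u v) = \<mu>"
    "\<forall>i. \<forall>u<n. \<forall>v<n. A i u v = B i u v"
    by (elim exE conjE)
  then have A: "\<And>i. i \<in> {1..k} \<Longrightarrow> multiplicity (A i)"
    "\<And>i v. i \<in> {1..k} \<Longrightarrow> v < m \<Longrightarrow> weight (A i) {v} {..<m} = r"
    "\<And>i S. i \<in> {1..k} \<Longrightarrow> S \<subseteq> {..<m} \<Longrightarrow> S \<noteq> {} \<Longrightarrow> S \<noteq> {..<m} \<Longrightarrow> 2 \<le> weight (A i) S ({..<m} - S)"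
    "\<And>u v. u < m \<Longrightarrow> v < m \<Longrightarrow> u \<noteq> v \<Longrightarrow> (\<Sum>i\<in>{1..k}. A i u v) = \<mu>"
    "\<And>i u v. u < n \<Longrightarrow> v < n \<Longrightarrow> A i u v = B i u v"
    by simp_all
  have GA: "mult (\<G> i) u v \<le> A i u v" if "u < n" "v < n" for i u v
    using A(5)[OF that] B(2) by simp
  have "\<exists>\<H>. decomposition (complete_mgraph \<mu> m) k \<H> \<and> enclosed_in k \<G> \<H> \<and>
      (\<forall>i\<in>{1..k}. \<forall>u<m. \<forall>v<m. mult (\<H> i) u v = A i u v)"
  proof (rule realize_multiplicities[OF G pos(5) less_imp_le[OF nm]])
    show "multiplicity (A i)" if "i \<in> {1..k}" for i using that by (rule A(1))
    show "(\<Sum>i\<in>{1..k}. A i u v) = \<mu>" if "u < m" "v < m" "u \<noteq> v" for u v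
      using that by (rule A(4))
    show "mult (\<G> i) u v \<le> A i u v" if "i \<in> {1..k}" "u < n" "v < n" for i u v
      using that(2,3) by (rule GA)
  qed
  then obtain \<H> where H: "decomposition (complete_mgraph \<mu> m) k \<H>" "enclosed_in k \<G> \<H>"
    "\<forall>i\<in>{1..k}. \<forall>u<m. \<forall>v<m. mult (\<H> i) u v = A i u v"
    by (elim exE conjE)
  note mH = decompositionD(1)[OF H(1)] and vH = decompositionD(2)[OF H(1)]
  have w: "weight (mult (\<H> i)) X Y = weight (A i) X Y" if "i \<in> {1..k}" "X \<subseteq> {..<m}" "Y \<subseteq> {..<m}" for i X Y
    unfolding weight_def using H(3) that by (intro sum.cong refl) (simp add: subset_eq)
  have "regular_mgraph r (\<H> i) \<and> two_edge_connected (\<H> i)" if i: "i \<in> {1..k}" for i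
  proof
    show "regular_mgraph r (\<H> i)"
      unfolding regular_mgraph_def vH[OF i]
    proof
      fix v assume "v \<in> {..<m}"
      then show "degree (\<H> i) v = r"
        using weight_mult_degree[OF mH[OF i], of v] w[OF i, of "{v}" "{..<m}"] A(2)[OF i, of v] vH[OF i]
        by simp
    qed
    have "2 \<le> card (cutset (\<H> i) S)" if S: "S \<subseteq> {..<m}" "S \<noteq> {}" "S \<noteq> {..<m}" for S
      using weight_mult_cut[OF mH[OF i], of S] vH[OF i] w[OF i S(1), of "{..<m} - S"] A(3)[OF i S] S
      by simp
    moreover have "{..<m} \<noteq> {}" using nm by auto
    ultimately show "two_edge_connected (\<H> i)"
      unfolding two_edge_connected_iff[OF mH[OF i]] vH[OF i] by blast
  qed
  then show ?thesis using H(1,2) unfolding two_edge_connected_factorization_def by blast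
qed

theorem theorem1p2:
  fixes l \<mu> k r m n :: nat
    and p :: real
    and \<G> :: "nat \<Rightarrow> nat mgraph"
  assumes "0 < l" "0 < \<mu>" "0 < k" "0 < r" "0 < m" "0 < n"
    and "l < \<mu>"
    and "m \<ge> 2 * n - 1"
    and "r \<ge> 2"
    and p: "p = real r * (2 * real n - real m) / 2"
    and "decomposition (complete_mgraph l n) k \<G>"
  shows "(\<exists>\<H>. two_edge_connected_factorization (complete_mgraph \<mu> m) r k \<H> \<and>
             enclosed_in k \<G> \<H>) \<longleftrightarrow>
         (r * k = \<mu> * (m - 1) \<and> even (r * m)) \<and>
         admissible r k \<G> \<and>
         (\<Sum>i\<in>{i::nat. real i \<le> p}. (p - real i) * real (card (classes_of_size k \<G> i)))
           \<le> (real \<mu> - real l) * (real n * (real n - 1) / 2)"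
proof -
  have "l \<le> \<mu>" using assms(7) by simp
  note count = edge_count_condition_iff[OF p assms(6) this assms(11)]
  show ?thesis
    unfolding count
    using factorization_necessary[OF assms(3,9,6,8,11)]
      factorization_sufficient[OF assms(3,9,6,8) \<open>l \<le> \<mu>\<close> assms(11)]
    by blast
qed

end
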